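(* Let $X=(X_t)_{t\in\mathbb R_+}$ and $Y=(Y_t)_{t\in\mathbb R_+}$ be Poisson processes with intensity functions $f$ and $g$, respectively, and let $\mathcal L(X),\mathcal L(Y)$ denote their laws. Then the Kullback--Leibler divergence is given by $$\mathrm{KL}(\mathcal L(X)\|\mathcal L(Y))=\int_0^\infty\left(f_t\log\frac{f_t}{g_t}+g_t-f_t\right)dt,$$ the R\'enyi divergence of order $\alpha\ne1$ is given by $$R_\alpha(\mathcal L(X)\|\mathcal L(Y))=\int_0^\infty\left(\frac{\alpha f_t+(1-\alpha)g_t-f_t^\alpha g_t^{1-\alpha}}{1-\alpha}\right)dt,$$ and the Hellinger distance is given by $$H(\mathcal L(X),\mathcal L(Y))=\sqrt{1-e^{-\frac12T_{1/2}(\lambda\|\mu)}},\qquad\text{where } T_{1/2}(\lambda\|\mu)=\int_0^\infty\left(\sqrt{f_t}-\sqrt{g_t}\right)^2dt$$ and $\lambda(dt)=f_t\,dt$, $\mu(dt)=g_t\,dt$ are the intensity measures of $X$ and $Y$.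
   Context: Notation: $\mathbb R_+=[0,\infty)$ and $\mathbb Z_+=\{0,1,2,\dots\}$. Point patterns: for a measurable space $(S,\mathcal S)$, $N(S)$ is the set of measures on $(S,\mathcal S)$ that can be written as a countable sum of integer-valued finite measures, equipped with the sigma-algebra $\mathcal N(S)$ generated by the evaluation maps $\eta\mapsto\eta(B)$, $B\in\mathcal S$. For a sigma-finite measure $\lambda$ on $(S,\mathcal S)$, the Poisson PP distribution $P_\lambda$ with intensity measure $\lambda$ is the unique probability measure on $(N(S),\mathcal N(S))$ under which $\eta(B_1),\dots,\eta(B_n)$ are independent for all $n\ge1$ and mutually disjoint $B_1,\dots,B_n\in\mathcal S$, and $\eta(B)$ is Poisson distributed with mean $\lambda(B)$ for every $B\in\mathcal S$ (with $\mathrm{Poi}(0)=\delta_0$, $\mathrm{Poi}(\infty)=\delta_\infty$). Poisson processes: the counting process of a point pattern $\eta\in N(\mathbb R_+)$ is the function $X:\mathbb R_+\to\mathbb Z_+$ defined by $X_t=\eta([0,t])$. A Poisson process with intensity measure $\lambda$ is the counting process of a point pattern $\eta$ sampled from the Poisson PP distribution $P_\lambda$, where $\lambda$ is a sigma-finite measure on $\mathbb R_+$. Its law $\mathcal L(X)$ is the pushforward of $P_\lambda$ under the map $\eta\mapsto X$, where the set of nondecreasing c\`adl\`ag functions $X:\mathbb R_+\to\mathbb Z_+$ is equipped with the sigma-algebra generated by the evaluation maps $X\mapsto X_t$. When $\lambda$ admits a density $f:\mathbb R_+\to\mathbb R_+$ with respect to the Lebesgue measure on $\mathbb R_+$, the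 process is called a Poisson process with intensity function $f$. Divergences: for probability measures $P,Q$ with densities $p,q$ with respect to a sigma-finite measure $m$ (the values do not depend on the choice of $m$, $p$, $q$), the R\'enyi divergence of order $\alpha\in[0,\infty)$ is $R_0(P\|Q)=-\log Q(p>0)$; $R_\alpha(P\|Q)=\frac1{\alpha-1}\log\int p^\alpha q^{1-\alpha}\,dm$ for $\alpha\notin\{0,1\}$; and $R_1(P\|Q)=\int p\log\frac pq\,dm$, which equals the Kullback--Leibler divergence $\mathrm{KL}(P\|Q)$. The Hellinger distance is $H(P,Q)=\left(\frac12\int(\sqrt p-\sqrt q)^2\,dm\right)^{1/2}$. Conventions (used both for $p,q$ and for $f,g$): for $\alpha>1$, $f^\alpha g^{1-\alpha}$ is read as $\frac{f^\alpha}{g^{\alpha-1}}$; $\frac00=0$ and $\frac t0=\infty$ for $t>0$; $t\log\frac t0=\infty$ for $t>0$; $0\log\frac0t=0$ for $t\ge0$.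
   Formalization: At order α = 0 the Rényi formula is claimed only if T_{1/2}(λ‖μ) < ∞ or μ({f = 0}) = ∞, with f^0 read as the indicator of f > 0; otherwise it is false (f = 1, g = 2: the laws are mutually singular, so R_0 = ∞, but the integral is 0). *)

theory Defs
  imports "HOL-Probability.Probability"
begin

section \<open>Point patterns and Poisson point patterns\<close>

definition integer_valued_finite_measure :: "'a measure \<Rightarrow> bool" where
  "integer_valued_finite_measure K \<longleftrightarrow> (\<forall>B\<in>sets K. \<exists>n::nat. emeasure K B = of_nat n)"

text \<open>Finite sums are covered by padding with zero measures.\<close>
definition point_patterns :: "'a measure \<Rightarrow> 'a measure set" where
  "point_patterns S = {\<eta>. sets \<eta> = sets S \<and>
     (\<exists>K :: nat \<Rightarrow> 'a measure.
        (\<forall>i. sets (K i) = sets S \<and> integer_valued_finite_measure (K i)) \<and>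
        (\<forall>B\<in>sets S. emeasure \<eta> B = (\<Sum>i. emeasure (K i) B)))}"

text \<open>As for \<^const>\<open>subprob_algebra\<close>, only the \<open>\<sigma>\<close>-algebra of the argument matters, so an
  intensity measure can be passed in place of its underlying measurable space.\<close>
definition point_pattern_algebra :: "'a measure \<Rightarrow> 'a measure measure" where
  "point_pattern_algebra S =
     (SUP B\<in>sets S. vimage_algebra (point_patterns S) (\<lambda>\<eta>. emeasure \<eta> B) borel)"

text \<open>The library's \<^const>\<open>poisson_pmf\<close> is only specified for positive rates.\<close>
definition Poi :: "ennreal \<Rightarrow> ennreal measure" where
  "Poi c = (if c = 0 then return borel 0
            else if c = \<infinity> then return borel \<infinity>
            else distr (measure_pmf (poisson_pmf (enn2real c))) borel of_nat)"

definition poisson_PP_distribution :: "'a measure \<Rightarrow> 'a measure measure \<Rightarrow> bool" where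
  "poisson_PP_distribution L P \<longleftrightarrow>
     sigma_finite_measure L \<and> prob_space P \<and> sets P = sets (point_pattern_algebra L) \<and>
     (\<forall>n\<ge>1. \<forall>B :: nat \<Rightarrow> 'a set.
        (\<forall>i\<in>{1..n}. B i \<in> sets L) \<longrightarrow> disjoint_family_on B {1..n} \<longrightarrow>
        prob_space.indep_vars P (\<lambda>_. borel) (\<lambda>i \<eta>. emeasure \<eta> (B i)) {1..n}) \<and>
     (\<forall>B\<in>sets L. distr P borel (\<lambda>\<eta>. emeasure \<eta> B) = Poi (emeasure L B))"

section \<open>Poisson processes\<close>

text \<open>Functions on \<open>[0,\<infinity>)\<close> are represented as extensional functions on \<open>{0..} :: real set\<close>;
  \<^typ>\<open>nat\<close> carries the discrete topology.\<close>
definition counting_paths :: "(real \<Rightarrow> nat) set" where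
  "counting_paths = {x \<in> extensional {0..}. mono_on {0..} x \<and>
     (\<forall>t\<ge>0. (x \<longlongrightarrow> x t) (at_right t)) \<and> (\<forall>t>0. \<exists>l. (x \<longlongrightarrow> l) (at_left t))}"

definition path_space :: "(real \<Rightarrow> nat) measure" where
  "path_space = (SUP t\<in>{0..}. vimage_algebra counting_paths (\<lambda>x. x t) (count_space UNIV))"

text \<open>A counting process takes finite values, although a point pattern may have infinitely many
  points in a bounded interval.  That the values \<open>\<eta>([0,t])\<close> are natural numbers is thus part
  of the notion, and it forces \<open>L([0,t]) < \<infinity>\<close> for all \<open>t\<close>.  It is demanded almost surely, so
  that \<open>\<eta>\<close> may be the identity on the space of all point patterns.\<close>
definition poisson_process :: "'w measure \<Rightarrow> real measure \<Rightarrow> ('w \<Rightarrow> real \<Rightarrow> nat) \<Rightarrow> bool" where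
  "poisson_process M L X \<longleftrightarrow>
     prob_space M \<and> sets L = sets (restrict_space borel {0..}) \<and>
     X \<in> measurable M path_space \<and>
     (\<exists>\<eta> \<in> measurable M (point_pattern_algebra L).
        poisson_PP_distribution L (distr M (point_pattern_algebra L) \<eta>) \<and>
        (AE \<omega> in M. \<forall>t\<ge>0. of_nat (X \<omega> t) = emeasure (\<eta> \<omega>) {0..t}))"

definition law :: "'w measure \<Rightarrow> ('w \<Rightarrow> real \<Rightarrow> nat) \<Rightarrow> (real \<Rightarrow> nat) measure" where
  "law M X = distr M path_space X"

abbreviation lebesgue_Rplus :: "real measure" where
  "lebesgue_Rplus \<equiv> restrict_space lborel {0..}"

definition intensity_function :: "(real \<Rightarrow> real) \<Rightarrow> bool" where
  "intensity_function f \<longleftrightarrow> f \<in> borel_measurable lebesgue_Rplus \<and> (\<forall>t\<ge>0. 0 \<le> f t)"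

definition intensity_measure :: "(real \<Rightarrow> real) \<Rightarrow> real measure" where
  "intensity_measure f = density lebesgue_Rplus (\<lambda>t. ennreal (f t))"

section \<open>Extended-real conventions\<close>

text \<open>\<open>\<integral>\<phi>\<^sup>+ - \<integral>\<phi>\<^sup>-\<close>; meaningful whenever one of the two integrals is finite, which is the case
  at every use below.\<close>
definition ereal_integral :: "'a measure \<Rightarrow> ('a \<Rightarrow> ereal) \<Rightarrow> ereal" where
  "ereal_integral m \<phi> =
     enn2ereal (\<integral>\<^sup>+x. e2ennreal (\<phi> x) \<partial>m) - enn2ereal (\<integral>\<^sup>+x. e2ennreal (- \<phi> x) \<partial>m)"

definition ext_log :: "ennreal \<Rightarrow> ereal" where
  "ext_log x = (if x = 0 then - \<infinity> else if x = \<infinity> then \<infinity> else ereal (ln (enn2real x)))"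

text \<open>\<open>e\<^sup>-\<^sup>x\<close> with \<open>e\<^sup>-\<^sup>\<infinity> = 0\<close>\<close>
definition exp_minus :: "ennreal \<Rightarrow> real" where
  "exp_minus x = (if x = \<infinity> then 0 else exp (- enn2real x))"

text \<open>\<open>x\<^sup>\<alpha> y\<^sup>1\<^sup>-\<^sup>\<alpha>\<close>.  Division on \<^typ>\<open>ennreal\<close> satisfies \<open>0/0 = 0\<close> and \<open>t/0 = \<infinity>\<close> for
  \<open>t > 0\<close>.  Since \<open>0 powr 0 = 0\<close>, the value for \<open>\<alpha> = 0\<close> is \<open>y\<close> if \<open>x > 0\<close> and \<open>0\<close> if \<open>x = 0\<close>.\<close>
definition power_product :: "real \<Rightarrow> real \<Rightarrow> real \<Rightarrow> ennreal" where
  "power_product \<alpha> x y =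
     (if \<alpha> > 1 then ennreal (x powr \<alpha>) / ennreal (y powr (\<alpha> - 1))
      else ennreal (x powr \<alpha> * y powr (1 - \<alpha>)))"

text \<open>\<open>x log (x/y)\<close>\<close>
definition x_log_ratio :: "real \<Rightarrow> real \<Rightarrow> ereal" where
  "x_log_ratio x y =
     (if x = 0 then 0 else if y = 0 then \<infinity> else ereal (x * ln (x / y)))"

section \<open>Divergences\<close>

definition common_densities ::
    "'a measure \<Rightarrow> 'a measure \<Rightarrow> 'a measure \<Rightarrow> ('a \<Rightarrow> real) \<Rightarrow> ('a \<Rightarrow> real) \<Rightarrow> bool" where
  "common_densities P Q m p q \<longleftrightarrow>
     sigma_finite_measure m \<and> p \<in> borel_measurable m \<and> q \<in> borel_measurable m \<and>
     (\<forall>x\<in>space m. 0 \<le> p x \<and> 0 \<le> q x) \<and>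
     P = density m (\<lambda>x. ennreal (p x)) \<and> Q = density m (\<lambda>x. ennreal (q x))"

text \<open>The divergences of probability measures \<open>P, Q\<close> on the same measurable space are the common
  value of the defining expressions over all \<open>m, p, q\<close>.  The library's \<^const>\<open>KL_divergence\<close>
  is not used because it is real-valued and cannot express an infinite divergence.\<close>
definition KL :: "'a measure \<Rightarrow> 'a measure \<Rightarrow> ereal" where
  "KL P Q = (THE r. \<exists>m p q. common_densities P Q m p q \<and>
     r = ereal_integral m (\<lambda>x. x_log_ratio (p x) (q x)))"

definition renyi_divergence :: "real \<Rightarrow> 'a measure \<Rightarrow> 'a measure \<Rightarrow> ereal" where
  "renyi_divergence \<alpha> P Q = (THE r. \<exists>m p q. common_densities P Q m p q \<and>
     r = (if \<alpha> = 0 then - ext_log (emeasure Q {x\<in>space m. p x > 0})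
          else if \<alpha> = 1 then ereal_integral m (\<lambda>x. x_log_ratio (p x) (q x))
          else ereal (1 / (\<alpha> - 1)) * ext_log (\<integral>\<^sup>+x. power_product \<alpha> (p x) (q x) \<partial>m)))"

definition hellinger_distance :: "'a measure \<Rightarrow> 'a measure \<Rightarrow> real" where
  "hellinger_distance P Q = (THE r. \<exists>m p q. common_densities P Q m p q \<and>
     r = sqrt (1 / 2 * (\<integral>x. (sqrt (p x) - sqrt (q x))\<^sup>2 \<partial>m)))"

text \<open>\<open>T\<^sub>1\<^sub>/\<^sub>2(\<lambda>\<parallel>\<mu>)\<close> for the intensity measures \<open>\<lambda>, \<mu>\<close> with densities \<open>f, g\<close>\<close>
definition tsallis_half :: "(real \<Rightarrow> real) \<Rightarrow> (real \<Rightarrow> real) \<Rightarrow> ennreal" where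
  "tsallis_half f g = (\<integral>\<^sup>+t. ennreal ((sqrt (f t) - sqrt (g t))\<^sup>2) \<partial>lebesgue_Rplus)"

end

theory Submission
  imports Defs "HOL-Real_Asymp.Real_Asymp"
begin

text \<open>The nonnegative gap \<open>\<bar>\<alpha>x + (1-\<alpha>)y - x\<^sup>\<alpha>y\<^sup>1\<^sup>-\<^sup>\<alpha>\<bar>\<close> in Young's inequality is
  a supremum of countably many linear forms \<open>ax + by\<close>.  Hence its integral over a pair of densities
  is a supremum of finite sums \<open>\<Sum> a\<^sub>i P(A\<^sub>i) + b\<^sub>i Q(A\<^sub>i)\<close> over measurable partitions: it depends
  only on the measures, decreases under measurable maps, and converges along refining maps that
  generate the \<open>\<sigma>\<close>-algebra.  This is applied twice with the same dyadic grid, to the intensity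
  measures and to the laws on path space.  On the grid the increments are independent Poisson
  variables, for which \<open>\<integral>p\<^sup>\<alpha>q\<^sup>1\<^sup>-\<^sup>\<alpha>\<close> is the exponential of the sum of the gaps of the means, so
  in the limit it is the exponential of the integrated gap of \<open>f\<close> and \<open>g\<close>.  The Kullback--Leibler
  divergence and the case \<open>\<alpha> = 0\<close> follow by letting \<open>\<alpha> \<rightarrow> 1\<close> and \<open>\<alpha> \<rightarrow> 0\<close>.\<close>

section \<open>Suprema of linear forms on pairs of densities\<close>

text \<open>Neither law need be absolutely continuous with respect to the other, so no likelihood
  ratio is available, and \<open>f\<close>, \<open>g\<close> may have infinite mass, so
  \<open>f^\<alpha> g^(1-\<alpha>)\<close> need not be integrable. The gap, being nonnegative, has
  an integral in either case. It is convex and homogeneous of degree one, whence the linear forms.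
  These are integrated piecewise, so masses must be finite: intensities are cut off to
  \<open>[0,T]\<close>. For probability densities, \<open>gap = 1 - affinity\<close> if
  \<open>\<alpha> < 1\<close> and \<open>affinity = gap + 1\<close> if \<open>\<alpha> > 1\<close>,
  which carries limits of gaps over to affinities. At \<open>\<alpha> = 0\<close> the formula can
  fail: if \<open>tsallis_half f g\<close> is infinite, all affinities of order in
  \<open>(0,1)\<close> vanish, the laws are mutually singular and the divergence is infinite,
  whereas the formula gives the \<open>g\<close>-mass of \<open>{f = 0}\<close>. The hypothesis at
  order 0 excludes exactly the case where that mass is finite. The divergences are values common to
  all \<open>m\<close>, \<open>p\<close>, \<open>q\<close>, so each identity is shown for an
  arbitrary choice.\<close>

locale density_pair =
  fixes m :: "'a measure" and P Q :: "'a measure" and p q :: "'a \<Rightarrow> real"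
  assumes finite_P: "finite_measure P" and finite_Q: "finite_measure Q"
    and p_meas [measurable]: "p \<in> borel_measurable m"
    and q_meas [measurable]: "q \<in> borel_measurable m"
    and p_nonneg: "x \<in> space m \<Longrightarrow> 0 \<le> p x" and q_nonneg: "x \<in> space m \<Longrightarrow> 0 \<le> q x"
    and P_eq: "P = density m (\<lambda>x. ennreal (p x))"
    and Q_eq: "Q = density m (\<lambda>x. ennreal (q x))"
begin

lemma sets_P [measurable_cong, simp]: "sets P = sets m"
  and sets_Q [measurable_cong, simp]: "sets Q = sets m"
  and space_P [simp]: "space P = space m" and space_Q [simp]: "space Q = space m"
  by (simp_all add: P_eq Q_eq)

lemma nn_integral_p: "(\<integral>\<^sup>+x. ennreal (p x) \<partial>m) = emeasure P (space P)"
  and nn_integral_q: "(\<integral>\<^sup>+x. ennreal (q x) \<partial>m) = emeasure Q (space Q)"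
  by (auto simp: P_eq Q_eq emeasure_density intro!: nn_integral_cong)

lemma integrable_p [simp]: "integrable m p"
proof (rule integrableI_nonneg)
  show "AE x in m. 0 \<le> p x" using p_nonneg by (intro AE_I2)
  show "(\<integral>\<^sup>+x. ennreal (p x) \<partial>m) < \<infinity>"
    using finite_measure.emeasure_finite[OF finite_P] by (simp add: nn_integral_p less_top)
qed simp

lemma integrable_q [simp]: "integrable m q"
proof (rule integrableI_nonneg)
  show "AE x in m. 0 \<le> q x" using q_nonneg by (intro AE_I2)
  show "(\<integral>\<^sup>+x. ennreal (q x) \<partial>m) < \<infinity>"
    using finite_measure.emeasure_finite[OF finite_Q] by (simp add: nn_integral_q less_top)
qed simp

lemma measure_P:
  assumes [measurable]: "A \<in> sets m"
  shows "measure P A = (\<integral>x. indicator A x * p x \<partial>m)"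
proof -
  have "emeasure P A = (\<integral>\<^sup>+x. ennreal (indicator A x * p x) \<partial>m)"
    by (auto simp: P_eq emeasure_density indicator_def intro!: nn_integral_cong)
  also have "\<dots> = ennreal (\<integral>x. indicator A x * p x \<partial>m)"
    using integrable_real_mult_indicator[OF assms integrable_p] p_nonneg
    by (intro nn_integral_eq_integral AE_I2) (auto simp: mult.commute)
  finally show ?thesis
    using p_nonneg by (auto simp: measure_def intro!: Bochner_Integration.integral_nonneg)
qed

lemma measure_Q:
  assumes [measurable]: "A \<in> sets m"
  shows "measure Q A = (\<integral>x. indicator A x * q x \<partial>m)"
proof -
  have "emeasure Q A = (\<integral>\<^sup>+x. ennreal (indicator A x * q x) \<partial>m)"
    by (auto simp: Q_eq emeasure_density indicator_def intro!: nn_integral_cong)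
  also have "\<dots> = ennreal (\<integral>x. indicator A x * q x \<partial>m)"
    using integrable_real_mult_indicator[OF assms integrable_q] q_nonneg
    by (intro nn_integral_eq_integral AE_I2) (auto simp: mult.commute)
  finally show ?thesis
    using q_nonneg by (auto simp: measure_def intro!: Bochner_Integration.integral_nonneg)
qed

text \<open>\<open>I\<close> selects one linear form at each point and has finitely many values, so
  integrating the selected form only sees the masses that \<open>P\<close> and \<open>Q\<close> give
  to the level sets of \<open>I\<close>.\<close>

lemma integral_choice:
  fixes a b :: "nat \<Rightarrow> real"
  assumes [measurable]: "I \<in> measurable m (count_space UNIV)" and I_le: "\<And>x. x \<in> space m \<Longrightarrow> I x \<le> k"
  shows "integrable m (\<lambda>x. a (I x) * p x + b (I x) * q x)" (is ?int)
    and "(\<integral>x. a (I x) * p x + b (I x) * q x \<partial>m) =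
      (\<Sum>i\<le>k. a i * measure P {x\<in>space m. I x = i} + b i * measure Q {x\<in>space m. I x = i})" (is ?eq)
proof -
  let ?A = "\<lambda>i. {x\<in>space m. I x = i}"
  let ?h = "\<lambda>x. \<Sum>i\<le>k. a i * (indicator (?A i) x * p x) + b i * (indicator (?A i) x * q x)"
  have int: "integrable m (\<lambda>x. indicator (?A i) x * p x)" "integrable m (\<lambda>x. indicator (?A i) x * q x)"
    for i using integrable_real_mult_indicator[OF _ integrable_p] integrable_real_mult_indicator[OF _ integrable_q]
    by (auto simp: mult.commute)
  have eq: "a (I x) * p x + b (I x) * q x = ?h x" if "x \<in> space m" for x
  proof -
    have "?h x = (\<Sum>i\<le>k. if i = I x then a (I x) * p x + b (I x) * q x else 0)"
      using that by (intro sum.cong) (auto simp: indicator_def)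
    then show ?thesis using I_le[OF that] by simp
  qed
  show ?int
    using int by (subst Bochner_Integration.integrable_cong[OF refl eq]) (auto intro!: Bochner_Integration.integrable_sum)
  have "(\<integral>x. a (I x) * p x + b (I x) * q x \<partial>m) = (\<integral>x. ?h x \<partial>m)"
    by (rule Bochner_Integration.integral_cong) (auto simp: eq)
  also have "\<dots> = (\<Sum>i\<le>k. a i * (\<integral>x. indicator (?A i) x * p x \<partial>m) + b i * (\<integral>x. indicator (?A i) x * q x \<partial>m))"
    using int by (subst Bochner_Integration.integral_sum) (auto intro!: sum.cong)
  finally show ?eq by (simp add: measure_P measure_Q)
qed

lemma choice_le_nn_integral:
  fixes a b :: "nat \<Rightarrow> real"
  assumes I: "I \<in> measurable m (count_space UNIV)" "\<And>x. x \<in> space m \<Longrightarrow> I x \<le> k"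
  shows "ennreal (\<Sum>i\<le>k. a i * measure P {x\<in>space m. I x = i} + b i * measure Q {x\<in>space m. I x = i})
    \<le> (\<integral>\<^sup>+x. (SUP i. ennreal (a i * p x + b i * q x)) \<partial>m)"
proof -
  let ?h = "\<lambda>x. a (I x) * p x + b (I x) * q x"
  note int = integral_choice(1)[OF I, of a b]
  \<comment> \<open>The selected form may be negative, while \<open>ennreal\<close> inside the
    supremum cuts off at 0; hence the positive part.\<close>
  have "(\<integral>x. ?h x \<partial>m) \<le> (\<integral>x. max 0 (?h x) \<partial>m)"
    by (intro integral_mono int integrable_max) auto
  then have "ennreal (\<integral>x. ?h x \<partial>m) \<le> (\<integral>\<^sup>+x. ennreal (max 0 (?h x)) \<partial>m)"
    by (subst nn_integral_eq_integral) (auto intro!: integrable_max int ennreal_leI)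
  also have "\<dots> \<le> (\<integral>\<^sup>+x. (SUP i. ennreal (a i * p x + b i * q x)) \<partial>m)"
    by (intro nn_integral_mono) (auto intro!: SUP_upper2[where i="I _"] simp: max_def)
  finally show ?thesis by (simp add: integral_choice(2)[OF I])
qed

text \<open>Monotone convergence replaces the supremum by a maximum over finitely many forms, and
  \<open>I\<close> picks the first maximizer. The zero form at index 0 keeps the maximum
  nonnegative, so its \<open>ennreal\<close> integral is an ordinary one.\<close>

lemma less_nn_integral_choice:
  fixes a b :: "nat \<Rightarrow> real"
  assumes zero: "a 0 = 0" "b 0 = 0"
    and c: "c < (\<integral>\<^sup>+x. (SUP i. ennreal (a i * p x + b i * q x)) \<partial>m)"
  obtains k I where "I \<in> measurable m (count_space UNIV)" "\<And>x. I x \<le> k"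
    "c < ennreal (\<Sum>i\<le>k. a i * measure P {x\<in>space m. I x = i} + b i * measure Q {x\<in>space m. I x = i})"
proof -
  let ?l = "\<lambda>i x. a i * p x + b i * q x"
  let ?M = "\<lambda>k x. SUP i\<in>{..k}. ennreal (?l i x)"
  have SUP: "(SUP i. ennreal (?l i x)) = (SUP k. ?M k x)" for x
    by (intro antisym SUP_least) (auto intro!: SUP_upper2 SUP_upper)
  have "(\<integral>\<^sup>+x. (SUP i. ennreal (?l i x)) \<partial>m) = (SUP k. \<integral>\<^sup>+x. ?M k x \<partial>m)"
    unfolding SUP
    by (rule nn_integral_monotone_convergence_SUP) (auto simp: incseq_def le_fun_def intro!: SUP_subset_mono)
  with c obtain k where k: "c < (\<integral>\<^sup>+x. ?M k x \<partial>m)" by (auto simp: less_SUP_iff)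
  \<comment> \<open>The disjunct \<open>k \<le> i\<close> bounds \<open>I\<close> by
    \<open>k\<close>; as some index up to \<open>k\<close> is a maximizer, the least index found is
    one too.\<close>
  define I where "I x = (LEAST i. k \<le> i \<or> (\<forall>j\<in>{..k}. ?l j x \<le> ?l i x))" for x
  have I_le: "I x \<le> k" for x unfolding I_def by (rule Least_le) simp
  have [measurable]: "I \<in> measurable m (count_space UNIV)" unfolding I_def by measurable
  have I_max: "?l j x \<le> ?l (I x) x" if "j \<le> k" for j x
  proof -
    have "finite ((\<lambda>i. ?l i x) ` {..k})" "(\<lambda>i. ?l i x) ` {..k} \<noteq> {}" by auto
    from Max_in[OF this] obtain i where i: "i \<le> k" "?l i x = Max ((\<lambda>i. ?l i x) ` {..k})"
      unfolding image_iff by auto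
    have imax: "\<forall>j\<in>{..k}. ?l j x \<le> ?l i x" unfolding i(2) by (auto intro!: Max_ge)
    then have "I x \<le> i" unfolding I_def by (intro Least_le) auto
    moreover have "k \<le> I x \<or> (\<forall>j\<in>{..k}. ?l j x \<le> ?l (I x) x)"
      unfolding I_def by (rule LeastI[of _ k]) simp
    moreover have "I x = i" if "k \<le> I x" using that i(1) \<open>I x \<le> i\<close> by simp
    ultimately show ?thesis using that imax by auto
  qed
  have M_eq: "?M k x = ennreal (?l (I x) x)" for x
    by (intro antisym SUP_least) (auto intro!: SUP_upper I_le ennreal_leI I_max)
  have nonneg: "0 \<le> ?l (I x) x" for x using I_max[of 0 x] zero by simp
  have "(\<integral>\<^sup>+x. ?M k x \<partial>m) = ennreal (\<integral>x. ?l (I x) x \<partial>m)"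
    unfolding M_eq by (intro nn_integral_eq_integral integral_choice[where k=k]) (auto simp: I_le nonneg)
  with k show ?thesis
    by (intro that[of I k]) (auto simp: I_le integral_choice(2)[of I k])
qed

end

text \<open>A partition of the target, pulled back along \<open>S\<close>, bounds the integral of
  the image densities from below by masses on the source. This serves the lower half of the
  convergence along refining maps.\<close>

lemma density_pair_choice:
  fixes a b :: "nat \<Rightarrow> real"
  assumes "density_pair m P Q p q"
    and S: "S \<in> measurable m E"
    and E: "density_pair m' (distr P E S) (distr Q E S) p' q'"
    and j: "j \<in> measurable E (count_space UNIV)" "\<And>y. j y \<le> k"
  shows "ennreal (\<Sum>i\<le>k. a i * measure P {x\<in>space m. j (S x) = i} + b i * measure Q {x\<in>space m. j (S x) = i})
    \<le> (\<integral>\<^sup>+y. (SUP i. ennreal (a i * p' y + b i * q' y)) \<partial>m')"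
proof -
  interpret density_pair m P Q p q by fact
  interpret E: density_pair m' "distr P E S" "distr Q E S" p' q' by fact
  have m'_sets: "sets m' = sets E" and [simp]: "space m' = space E" using E.sets_P E.space_P by simp_all
  note [measurable] = S j(1)
  have *: "S -` {y \<in> space E. j y = i} \<inter> space m = {x\<in>space m. j (S x) = i}" for i
    using measurable_space[OF S] by auto
  have "measure (distr P E S) {y\<in>space m'. j y = i} = measure P {x\<in>space m. j (S x) = i}"
    "measure (distr Q E S) {y\<in>space m'. j y = i} = measure Q {x\<in>space m. j (S x) = i}" for i
    by (simp_all add: measure_distr * del: vimage_Collect_eq)
  moreover have "j \<in> measurable m' (count_space UNIV)"
    using j(1) by (subst measurable_cong_sets[OF m'_sets refl])
  ultimately show ?thesis
    using E.choice_le_nn_integral[of j k a b] j by simp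
qed

text \<open>Each near-optimal partition for the image measures pulls back along \<open>S\<close> to
  a partition of the source with the same masses.\<close>

lemma density_pair_data_processing:
  fixes a b :: "nat \<Rightarrow> real"
  assumes pair: "density_pair m P Q p q"
    and zero: "a 0 = 0" "b 0 = 0"
    and S: "S \<in> measurable m E"
    and E: "density_pair m' (distr P E S) (distr Q E S) p' q'"
  shows "(\<integral>\<^sup>+y. (SUP i. ennreal (a i * p' y + b i * q' y)) \<partial>m')
    \<le> (\<integral>\<^sup>+x. (SUP i. ennreal (a i * p x + b i * q x)) \<partial>m)"
proof (rule dense_le)
  interpret density_pair m P Q p q by fact
  interpret E: density_pair m' "distr P E S" "distr Q E S" p' q' by fact
  have m'_sets: "sets m' = sets E" and [simp]: "space m' = space E" using E.sets_P E.space_P by simp_all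
  fix c assume "c < (\<integral>\<^sup>+y. (SUP i. ennreal (a i * p' y + b i * q' y)) \<partial>m')"
  then obtain k I where I: "I \<in> measurable m' (count_space UNIV)" "\<And>x. I x \<le> k"
    and c: "c < ennreal (\<Sum>i\<le>k. a i * measure (distr P E S) {x\<in>space m'. I x = i} + b i * measure (distr Q E S) {x\<in>space m'. I x = i})"
    by (rule E.less_nn_integral_choice[where a=a and b=b, OF zero]) blast
  have I'[measurable]: "I \<in> measurable E (count_space UNIV)" using I(1) by (subst measurable_cong_sets[OF m'_sets[symmetric] refl])
  note [measurable] = S
  have *: "S -` {y \<in> space E. I y = i} \<inter> space m = {x\<in>space m. I (S x) = i}" for i
    using measurable_space[OF S] by auto
  have "measure (distr P E S) {y\<in>space m'. I y = i} = measure P {x\<in>space m. I (S x) = i}"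
    "measure (distr Q E S) {y\<in>space m'. I y = i} = measure Q {x\<in>space m. I (S x) = i}" for i
    by (simp_all add: measure_distr * del: vimage_Collect_eq)
  then have "c < ennreal (\<Sum>i\<le>k. a i * measure P {x\<in>space m. I (S x) = i} + b i * measure Q {x\<in>space m. I (S x) = i})"
    using c by simp
  also have "\<dots> \<le> (\<integral>\<^sup>+x. (SUP i. ennreal (a i * p x + b i * q x)) \<partial>m)"
    by (rule choice_le_nn_integral) (auto simp: I)
  finally show "c \<le> (\<integral>\<^sup>+x. (SUP i. ennreal (a i * p x + b i * q x)) \<partial>m)" by simp
qed

text \<open>The approximable sets contain \<open>G\<close> and are closed under complements and
  countable disjoint unions: for a union, a tail of mass below \<open>e/2\<close> is dropped and the
  remaining \<open>N\<close> sets share the other \<open>e/2\<close>.\<close>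

lemma (in finite_measure) approx_generating_algebra:
  assumes alg: "algebra (space M) G" and gen: "sets M = sigma_sets (space M) G"
    and A: "A \<in> sets M" and "0 < e"
  shows "\<exists>B\<in>G. measure M (sym_diff A B) < e"
proof -
  interpret G: algebra "space M" G by fact
  have G_sets: "G \<subseteq> sets M" unfolding gen by (auto intro: sigma_sets.Basic)
  have "\<forall>e>0. \<exists>B\<in>G. measure M (sym_diff A B) < e"
    using G.Int_stable G.space_closed A[unfolded gen]
  proof (induct rule: sigma_sets_induct_disjoint)
    case (basic A)
    then show ?case by (auto intro!: bexI[of _ A])
  next
    case empty
    then show ?case by (auto intro!: bexI[of _ "{}"])
  next
    case (compl A)
    show ?case
    proof (intro allI impI)
      fix e :: real assume "0 < e"
      with compl obtain B where B: "B \<in> G" "measure M (sym_diff A B) < e" by blast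
      have "A \<subseteq> space M" "B \<subseteq> space M" using compl(1) sets.sets_into_space B G_sets gen by blast+
      then have "sym_diff (space M - A) (space M - B) = sym_diff A B" by auto
      then show "\<exists>B\<in>G. measure M (sym_diff (space M - A) B) < e"
        using B by (intro bexI[of _ "space M - B"]) (auto simp: Un_commute)
    qed
  next
    case (union A)
    have A: "A i \<in> sets M" for i using union(2) gen by auto
    show ?case
    proof (intro allI impI)
      fix e :: real assume e: "0 < e"
      have "(\<lambda>n. \<Sum>i<n. measure M (A i)) \<longlonglongrightarrow> measure M (\<Union>i. A i)"
        using finite_measure_UNION[of A] union(1) A by (auto simp: sums_def)
      from LIMSEQ_D[OF this, of "e/2"] e obtain N
        where N: "\<bar>(\<Sum>i<N. measure M (A i)) - measure M (\<Union>i. A i)\<bar> < e/2" by auto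
      have "\<exists>B. \<forall>i. B i \<in> G \<and> measure M (sym_diff (A i) (B i)) < e / (2 * (real N + 1))"
        using union(3) e by (intro choice) (auto simp: Bex_def)
      then obtain B where B: "\<And>i. B i \<in> G" "\<And>i. measure M (sym_diff (A i) (B i)) < e / (2 * (real N + 1))"
        by blast
      have Bm: "B i \<in> sets M" for i using B(1) G_sets by auto
      have "measure M ((\<Union>i. A i) - (\<Union>i<N. A i)) = measure M (\<Union>i. A i) - measure M (\<Union>i<N. A i)"
        using A by (intro finite_measure_Diff) auto
      also have "measure M (\<Union>i<N. A i) = (\<Sum>i<N. measure M (A i))"
        using A union(1) by (intro finite_measure_finite_Union) (auto simp: disjoint_family_on_def)
      finally have tail: "measure M ((\<Union>i. A i) - (\<Union>i<N. A i)) < e/2" using N by linarith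
      have "measure M (\<Union>i<N. sym_diff (A i) (B i)) \<le> (\<Sum>i<N. measure M (sym_diff (A i) (B i)))"
        using A Bm by (intro finite_measure_subadditive_finite) auto
      also have "\<dots> \<le> (\<Sum>i<N. e / (2 * (real N + 1)))"
        by (intro sum_mono less_imp_le B)
      also have "\<dots> \<le> e/2" using e by (simp add: field_simps)
      finally have head: "measure M (\<Union>i<N. sym_diff (A i) (B i)) \<le> e/2" .
      have "measure M (sym_diff (\<Union>i. A i) (\<Union>i<N. B i))
        \<le> measure M (((\<Union>i. A i) - (\<Union>i<N. A i)) \<union> (\<Union>i<N. sym_diff (A i) (B i)))"
        using A Bm by (intro finite_measure_mono sets.Un sets.Diff sets.countable_UN sets.finite_UN) auto
      also have "\<dots> \<le> measure M ((\<Union>i. A i) - (\<Union>i<N. A i)) + measure M (\<Union>i<N. sym_diff (A i) (B i))"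
        using A Bm by (intro measure_Un_le sets.Diff sets.countable_UN sets.finite_UN) auto
      also have "\<dots> < e" using tail head by simp
      finally show "\<exists>B\<in>G. measure M (sym_diff (\<Union> (range A)) B) < e"
        using B by (intro bexI[of _ "\<Union>i<N. B i"]) auto
    qed
  qed
  then show ?thesis using \<open>0 < e\<close> by blast
qed


text \<open>No term exceeds the limit, by data processing. For the lower bound, a near-optimal
  partition of \<open>m\<close> is approximated by sets from a finite level: \<open>h\<close> makes
  the levels increase, so their preimages form an algebra and one level serves all finitely many
  sets.\<close>

lemma density_pair_convergence:
  fixes a b :: "nat \<Rightarrow> real" and S :: "nat \<Rightarrow> 'a \<Rightarrow> 'b"
  assumes pair: "density_pair m P Q p q"
    and zero: "a 0 = 0" "b 0 = 0"
    and S: "\<And>n. S n \<in> measurable m (E n)"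
    and E: "\<And>n. density_pair (m' n) (distr P (E n) (S n)) (distr Q (E n) (S n)) (p' n) (q' n)"
    and h: "\<And>n. h n \<in> measurable (E (Suc n)) (E n)"
    and S_h: "\<And>n x. x \<in> space m \<Longrightarrow> S n x = h n (S (Suc n) x)"
    and gen: "sets m \<subseteq> sigma_sets (space m) (\<Union>n. {S n -` C \<inter> space m | C. C \<in> sets (E n)})"
  shows "(\<lambda>n. \<integral>\<^sup>+y. (SUP i. ennreal (a i * p' n y + b i * q' n y)) \<partial>m' n)
    \<longlonglongrightarrow> (\<integral>\<^sup>+x. (SUP i. ennreal (a i * p x + b i * q x)) \<partial>m)" (is "?D \<longlonglongrightarrow> ?d")
proof (rule order_tendstoI)
  fix c assume "?d < c"
  then show "\<forall>\<^sub>F n in sequentially. ?D n < c"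
    by (intro always_eventually allI le_less_trans[OF density_pair_data_processing[where a=a and b=b, OF pair zero S E]])
next
  interpret density_pair m P Q p q by fact
  interpret P: finite_measure P by (rule finite_P)
  interpret Q: finite_measure Q by (rule finite_Q)
  \<comment> \<open>Approximation in \<open>P + Q\<close> controls the error under both measures at
    once.\<close>
  define R where "R = density m (\<lambda>x. ennreal (p x + q x))"
  have R_eq: "emeasure R A = emeasure P A + emeasure Q A" if "A \<in> sets m" for A
    using that p_nonneg q_nonneg
    by (auto simp: R_def P_eq Q_eq emeasure_density distrib_right nn_integral_add[symmetric]
        intro!: nn_integral_cong)
  have sets_R: "sets R = sets m" "space R = space m" by (simp_all add: R_def)
  interpret R: finite_measure R
    by (rule finite_measureI) (simp add: sets_R R_eq P.emeasure_finite Q.emeasure_finite ennreal_add_eq_top)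
  have measure_R: "measure R A = measure P A + measure Q A" if "A \<in> sets m" for A
    using R_eq[OF that] by (simp add: R.emeasure_eq_measure P.emeasure_eq_measure Q.emeasure_eq_measure
        ennreal_plus[symmetric] del: ennreal_plus)
  define F where "F n = {S n -` C \<inter> space m | C. C \<in> sets (E n)}" for n
  define G where "G = (\<Union>n. F n)"
  have F_mono: "F n \<subseteq> F k" if "n \<le> k" for n k
  proof (rule lift_Suc_mono_le[of F _ k, OF _ that])
    fix n show "F n \<subseteq> F (Suc n)"
    proof
      fix A assume "A \<in> F n"
      then obtain C where C: "C \<in> sets (E n)" "A = S n -` C \<inter> space m" by (auto simp: F_def)
      have "A = S (Suc n) -` (h n -` C \<inter> space (E (Suc n))) \<inter> space m"
        using measurable_space[OF S] by (auto simp: C(2) S_h[of _ n])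
      with measurable_sets[OF h C(1)] show "A \<in> F (Suc n)" unfolding F_def by blast
    qed
  qed
  have alg: "algebra (space R) G"
  proof (unfold algebra_iff_Un, intro conjI ballI)
    show "G \<subseteq> Pow (space R)" by (auto simp: G_def F_def sets_R)
    show "{} \<in> G" by (force simp: G_def F_def)
    show "space R - A \<in> G" if A: "A \<in> G" for A
    proof -
      from A obtain n C where C: "C \<in> sets (E n)" "A = S n -` C \<inter> space m" by (auto simp: F_def G_def)
      have "space R - A = S n -` (space (E n) - C) \<inter> space m"
        using measurable_space[OF S] by (auto simp: C(2) sets_R)
      with sets.compl_sets[OF C(1)] show ?thesis by (auto simp: F_def G_def)
    qed
    show "A \<union> B \<in> G" if AB: "A \<in> G" "B \<in> G" for A B
    proof -
      from AB obtain n1 n2 where "A \<in> F n1" "B \<in> F n2" by (auto simp: G_def)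
      then have "A \<in> F (max n1 n2)" "B \<in> F (max n1 n2)"
        using F_mono[of n1 "max n1 n2"] F_mono[of n2 "max n1 n2"] by auto
      then obtain C D where C: "C \<in> sets (E (max n1 n2))" "A = S (max n1 n2) -` C \<inter> space m"
        and D: "D \<in> sets (E (max n1 n2))" "B = S (max n1 n2) -` D \<inter> space m" by (auto simp: F_def)
      have "A \<union> B = S (max n1 n2) -` (C \<union> D) \<inter> space m" by (auto simp: C(2) D(2))
      with sets.Un[OF C(1) D(1)] show ?thesis unfolding F_def G_def by blast
    qed
  qed
  have gen': "sets R = sigma_sets (space R) G"
  proof
    show "sets R \<subseteq> sigma_sets (space R) G" using gen by (simp add: sets_R G_def F_def)
    show "sigma_sets (space R) G \<subseteq> sets R"
      using measurable_sets[OF S] by (intro sets.sigma_sets_subset) (auto simp: sets_R G_def F_def)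
  qed
  fix c assume "c < ?d"
  then obtain k I where I[measurable]: "I \<in> measurable m (count_space UNIV)" and I_le: "\<And>x. I x \<le> k"
    and c: "c < ennreal (\<Sum>i\<le>k. a i * measure P {x\<in>space m. I x = i} + b i * measure Q {x\<in>space m. I x = i})"
      (is "c < ennreal ?V")
    by (rule less_nn_integral_choice[where a=a and b=b, OF zero]) blast
  obtain \<delta> where \<delta>: "0 < \<delta>" "c < ennreal (?V - \<delta>)"
  proof -
    obtain d where d: "c < d" "d < ennreal ?V" using dense[OF c] by blast
    then obtain r where r: "d = ennreal r" "0 \<le> r" by (cases d) auto
    with d have "r < ?V" by (simp add: ennreal_less_iff)
    with d r show ?thesis by (intro that[of "?V - r"]) auto
  qed
  define K where "K = (\<Sum>i\<le>k. \<bar>a i\<bar> + \<bar>b i\<bar>)"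
  have K: "0 \<le> K" by (auto simp: K_def intro!: sum_nonneg)
  \<comment> \<open>Moving mass at most \<open>(k + 1) * e\<close> changes the sum by at most
    \<open>K * \<delta> / (K + 1)\<close>, hence by at most \<delta>; the added 1 keeps the divisor
    positive.\<close>
  define e where "e = \<delta> / ((K + 1) * (real k + 1))"
  have e: "0 < e" using \<delta> K by (simp add: e_def)
  have "\<exists>B\<in>G. measure R (sym_diff {x\<in>space m. I x = i} B) < e" for i
    by (rule R.approx_generating_algebra[OF alg gen' _ e]) (simp add: sets_R)
  then obtain B where B: "\<And>i. B i \<in> G" "\<And>i. measure R (sym_diff {x\<in>space m. I x = i} (B i)) < e"
    by metis
  then obtain \<nu> where \<nu>: "\<And>i. B i \<in> F (\<nu> i)" unfolding G_def by (metis UN_E)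
  have "c < ?D n" if n: "(\<Sum>i\<le>k. \<nu> i) \<le> n" for n
  proof -
    have "B i \<in> F n" if "i \<le> k" for i
    proof -
      have "\<nu> i \<le> (\<Sum>i\<le>k. \<nu> i)" using that by (intro member_le_sum) auto
      with n have "\<nu> i \<le> n" by simp
      then show ?thesis using F_mono \<nu> by blast
    qed
    then have "\<forall>i. \<exists>C. i \<le> k \<longrightarrow> C \<in> sets (E n) \<and> B i = S n -` C \<inter> space m" unfolding F_def by blast
    from choice[OF this] obtain C where C: "\<And>i. i \<le> k \<Longrightarrow> C i \<in> sets (E n)" "\<And>i. i \<le> k \<Longrightarrow> B i = S n -` C i \<inter> space m"
      by blast
    \<comment> \<open>The sets \<open>C i\<close> may overlap and need not cover, so the first index
      wins, and points in none of the sets below \<open>k\<close> get \<open>k\<close>. Off the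
      symmetric differences this reproduces \<open>I\<close>.\<close>
    define j where "j y = (LEAST i. i = k \<or> (i < k \<and> y \<in> C i))" for y
    have j_le: "j y \<le> k" for y unfolding j_def by (rule Least_le) simp
    have pred_C: "(\<lambda>y. i < k \<and> y \<in> C i) \<in> measurable (E n) (count_space UNIV)" for i
    proof (cases "i < k")
      case True
      have "Measurable.pred (E n) (\<lambda>y. y \<in> C i)" using C(1)[of i] True by (intro pred_sets2[where N="E n"]) auto
      then show ?thesis using True by simp
    qed simp
    have [measurable]: "j \<in> measurable (E n) (count_space UNIV)"
      unfolding j_def using pred_C by measurable
    have [measurable]: "(\<lambda>x. j (S n x)) \<in> measurable m (count_space UNIV)"
      by (rule measurable_compose[OF S]) measurable
    have j_S: "j (S n x) = I x" if x: "x \<in> space m" "\<And>i. i \<le> k \<Longrightarrow> x \<notin> sym_diff {x\<in>space m. I x = i} (B i)" for x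
    proof -
      have "S n x \<in> C i \<longleftrightarrow> I x = i" if "i \<le> k" for i using x x(2)[OF that] C(2)[OF that] by auto
      then have "j (S n x) = (LEAST i. i = k \<or> (i < k \<and> I x = i))"
        unfolding j_def by (intro arg_cong[where f=Least]) auto
      also have "\<dots> = I x" using I_le[of x] by (intro Least_equality) auto
      finally show ?thesis .
    qed
    define N where "N = {x\<in>space m. I x \<noteq> j (S n x)}"
    have "N = (\<Union>i. {x\<in>space m. I x = i \<and> j (S n x) \<noteq> i})" by (auto simp: N_def)
    then have [measurable]: "N \<in> sets m" by simp
    have Bm: "B i \<in> sets m" for i using B(1)[of i] gen' by (auto simp: sets_R[symmetric])
    have N_sub: "N \<subseteq> (\<Union>i\<in>{..k}. sym_diff {x\<in>space m. I x = i} (B i))"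
    proof
      fix x assume "x \<in> N"
      then have "x \<in> space m" "j (S n x) \<noteq> I x" unfolding N_def by simp_all
      with j_S[of x] obtain i where "i \<le> k" "x \<in> sym_diff {x\<in>space m. I x = i} (B i)" by meson
      then show "x \<in> (\<Union>i\<in>{..k}. sym_diff {x\<in>space m. I x = i} (B i))" by blast
    qed
    have "measure R N \<le> measure R (\<Union>i\<in>{..k}. sym_diff {x\<in>space m. I x = i} (B i))"
      by (intro R.finite_measure_mono N_sub) (use Bm in \<open>auto simp: sets_R\<close>)
    also have "\<dots> \<le> (\<Sum>i\<le>k. measure R (sym_diff {x\<in>space m. I x = i} (B i)))"
      using Bm by (intro R.finite_measure_subadditive_finite) (auto simp: sets_R)
    also have "\<dots> \<le> (\<Sum>i\<le>k. e)" by (intro sum_mono less_imp_le B)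
    also have "\<dots> = \<delta> / (K + 1)" using K by (simp add: e_def add.commute)
    finally have R_N: "measure R N \<le> \<delta> / (K + 1)" .
    have diff: "\<bar>measure P' {x\<in>space m. I x = i} - measure P' {x\<in>space m. j (S n x) = i}\<bar> \<le> measure P' N"
      if "finite_measure P'" "sets P' = sets m" for P' i
    proof -
      interpret P': finite_measure P' by fact
      let ?A = "{x\<in>space m. I x = i}" and ?B = "{x\<in>space m. j (S n x) = i}"
      have "?A \<in> sets m" "?B \<in> sets m" "N \<in> sets m" by measurable
      then have sets: "?A \<in> sets P'" "?B \<in> sets P'" "N \<in> sets P'" unfolding that(2) .
      have "?A \<subseteq> ?B \<union> N" "?B \<subseteq> ?A \<union> N" by (auto simp: N_def)
      then have "measure P' ?A \<le> measure P' (?B \<union> N)" "measure P' ?B \<le> measure P' (?A \<union> N)"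
        using sets by (intro P'.finite_measure_mono; blast)+
      moreover have "measure P' (?B \<union> N) \<le> measure P' ?B + measure P' N" "measure P' (?A \<union> N) \<le> measure P' ?A + measure P' N"
        using sets by (intro measure_Un_le; blast)+
      ultimately show ?thesis by linarith
    qed
    let ?W = "\<Sum>i\<le>k. a i * measure P {x\<in>space m. j (S n x) = i} + b i * measure Q {x\<in>space m. j (S n x) = i}"
    have "?V - ?W = (\<Sum>i\<le>k. a i * (measure P {x\<in>space m. I x = i} - measure P {x\<in>space m. j (S n x) = i})
        + b i * (measure Q {x\<in>space m. I x = i} - measure Q {x\<in>space m. j (S n x) = i}))"
      by (simp add: sum_subtractf[symmetric] algebra_simps)
    also have "\<dots> \<le> (\<Sum>i\<le>k. \<bar>a i\<bar> * measure R N + \<bar>b i\<bar> * measure R N)"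
    proof (intro sum_mono add_mono)
      fix i
      have le: "u * v \<le> \<bar>u\<bar> * w" if "\<bar>v\<bar> \<le> w" for u v w :: real
        using mult_left_mono[OF that, of "\<bar>u\<bar>"] abs_ge_self[of "u * v"] by (simp add: abs_mult)
      have "measure P N \<le> measure R N" "measure Q N \<le> measure R N" by (simp_all add: measure_R)
      with diff[OF finite_P sets_P, of i] diff[OF finite_Q sets_Q, of i]
      show "a i * (measure P {x\<in>space m. I x = i} - measure P {x\<in>space m. j (S n x) = i}) \<le> \<bar>a i\<bar> * measure R N"
        and "b i * (measure Q {x\<in>space m. I x = i} - measure Q {x\<in>space m. j (S n x) = i}) \<le> \<bar>b i\<bar> * measure R N"
        by (intro le; linarith)+
    qed
    also have "\<dots> = K * measure R N" by (simp add: K_def sum_distrib_right distrib_right)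
    also have "\<dots> \<le> K * (\<delta> / (K + 1))" by (intro mult_left_mono R_N K)
    also have "\<dots> \<le> \<delta>" using K \<delta> by (simp add: field_simps)
    finally have "?V - \<delta> \<le> ?W" by simp
    with \<delta> have "c < ennreal ?W" using ennreal_leI[of "?V - \<delta>" ?W] by (meson less_le_trans)
    also have "\<dots> \<le> ?D n" by (rule density_pair_choice[OF pair S E]) (auto simp: j_le)
    finally show ?thesis .
  qed
  then show "\<forall>\<^sub>F n in sequentially. c < ?D n" by (auto simp: eventually_sequentially)
qed

section \<open>The gap in Young's inequality\<close>

text \<open>The sign makes this the absolute gap. As \<open>0 powr (1 - \<alpha>)\<close> is 0, the
  infinite value for \<open>\<alpha> > 1\<close> at \<open>y = 0 < x\<close> is set separately. At
  order 0 the gap is \<open>y\<close> if \<open>x = 0\<close>, and 0 otherwise.\<close>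

definition young_gap :: "real \<Rightarrow> real \<Rightarrow> real \<Rightarrow> ennreal" where
  "young_gap \<alpha> x y =
     (if \<alpha> > 1 \<and> x \<noteq> 0 \<and> y = 0 then \<infinity>
      else ennreal (sgn (1 - \<alpha>) * (\<alpha> * x + (1 - \<alpha>) * y - x powr \<alpha> * y powr (1 - \<alpha>))))"

text \<open>The coefficients of the tangent of \<^const>\<open>young_gap\<close> along the ray \<open>y = s x\<close>.\<close>

definition young_tangent :: "real \<Rightarrow> real \<Rightarrow> real \<times> real" where
  "young_tangent \<alpha> s =
     (sgn (1 - \<alpha>) * \<alpha> * (1 - s powr (1 - \<alpha>)), sgn (1 - \<alpha>) * (1 - \<alpha>) * (1 - s powr (- \<alpha>)))"

text \<open>The power with exponent \<open>1 - \<alpha>\<close> is concave for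
  \<open>\<alpha> < 1\<close> and convex for \<open>\<alpha> > 1\<close>;
  \<open>\<alpha> + (1 - \<alpha>) * r\<close> is its tangent at \<open>r = 1\<close>.\<close>

lemma Bernoulli_powr:
  fixes r :: real
  assumes "0 < r" "0 < \<alpha>"
  shows "sgn (1 - \<alpha>) * r powr (1 - \<alpha>) \<le> sgn (1 - \<alpha>) * (\<alpha> + (1 - \<alpha>) * r)"
proof (cases \<alpha> "1 :: real" rule: linorder_cases)
  case less
  then show ?thesis
    using Youngs_inequality_0[of \<alpha> "1 - \<alpha>" 1 r] assms by simp
next
  case greater
  \<comment> \<open>Young's inequality with weight \<open>1 / \<alpha>\<close> on
    \<open>(1 / r)^\<alpha>\<close>; multiplying by \<alpha> and then by \<open>r\<close> gives the
    convex case.\<close>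
  have "((1 / r) powr \<alpha>) powr (1 / \<alpha>) * 1 powr (1 - 1 / \<alpha>) \<le> 1 / \<alpha> * (1 / r) powr \<alpha> + (1 - 1 / \<alpha>) * 1"
    using assms greater by (intro Youngs_inequality_0) auto
  then have "\<alpha> * (1 / r) \<le> \<alpha> * (1 / \<alpha> * (1 / r) powr \<alpha> + (1 - 1 / \<alpha>))"
    using assms by (intro mult_left_mono) (auto simp: powr_powr)
  moreover have "\<alpha> * (1 / \<alpha> * z + (1 - 1 / \<alpha>)) = z + \<alpha> - 1" for z
    using assms by (simp add: field_simps)
  ultimately have "\<alpha> / r \<le> (1 / r) powr \<alpha> + \<alpha> - 1" by simp
  then have "r * (\<alpha> / r) \<le> r * ((1 / r) powr \<alpha> + \<alpha> - 1)"
    using assms by (intro mult_left_mono) auto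
  moreover have "r * (1 / r) powr \<alpha> = r powr (1 - \<alpha>)"
    using assms by (simp add: powr_divide powr_diff)
  ultimately show ?thesis
    using greater assms by (simp add: algebra_simps)
qed simp

text \<open>By homogeneity, \<open>y\<close> is measured relative to the ray of slope
  \<open>s\<close>: the ratio \<open>y / (s * x)\<close> is 1 on that ray, where Bernoulli's
  inequality is an equality.\<close>

lemma powr_along_ray:
  fixes x y s :: real
  assumes "0 < s" "0 < x" "0 < y"
  shows "x powr \<alpha> * y powr (1 - \<alpha>) = s powr (1 - \<alpha>) * x * (y / (s * x)) powr (1 - \<alpha>)"
    and "s powr (1 - \<alpha>) * x * (y / (s * x)) = s powr (- \<alpha>) * y"
proof -
  have "x powr \<alpha> * x powr (1 - \<alpha>) = x" using assms by (simp add: powr_add[symmetric])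
  then show "x powr \<alpha> * y powr (1 - \<alpha>) = s powr (1 - \<alpha>) * x * (y / (s * x)) powr (1 - \<alpha>)"
    using assms by (simp add: powr_divide powr_mult field_simps)
  show "s powr (1 - \<alpha>) * x * (y / (s * x)) = s powr (- \<alpha>) * y"
    using assms by (simp add: powr_diff powr_minus field_simps)
qed

text \<open>Bernoulli's inequality for the ratio \<open>y / (s * x)\<close>, scaled back; the slope
  \<open>s = 1\<close> is Young's inequality itself. On the axes the ratio is of no use, but there
  the power term vanishes.\<close>

lemma young_le:
  fixes \<alpha> s x y :: real
  assumes \<alpha>: "0 < \<alpha>" "\<alpha> \<noteq> 1" and "0 < s" "0 \<le> x" "0 \<le> y" and fin: "\<not> (\<alpha> > 1 \<and> x \<noteq> 0 \<and> y = 0)"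
  shows "sgn (1 - \<alpha>) * (x powr \<alpha> * y powr (1 - \<alpha>)) \<le>
    sgn (1 - \<alpha>) * (\<alpha> * s powr (1 - \<alpha>) * x + (1 - \<alpha>) * s powr (- \<alpha>) * y)"
proof (cases "x = 0 \<or> y = 0")
  case True
  moreover have "sgn (1 - \<alpha>) = (if \<alpha> < 1 then 1 else -1)" using assms by auto
  ultimately show ?thesis
    using assms by (auto simp: mult_nonpos_nonneg split: if_splits)
next
  case False
  then have xy: "0 < x" "0 < y" using assms by auto
  let ?r = "y / (s * x)"
  have "s powr (1 - \<alpha>) * x * (sgn (1 - \<alpha>) * ?r powr (1 - \<alpha>)) \<le> s powr (1 - \<alpha>) * x * (sgn (1 - \<alpha>) * (\<alpha> + (1 - \<alpha>) * ?r))"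
    using xy assms by (intro mult_left_mono Bernoulli_powr) auto
  then have "sgn (1 - \<alpha>) * (s powr (1 - \<alpha>) * x * ?r powr (1 - \<alpha>)) \<le>
      sgn (1 - \<alpha>) * (\<alpha> * s powr (1 - \<alpha>) * x + (1 - \<alpha>) * (s powr (1 - \<alpha>) * x * ?r))"
    by (simp only: algebra_simps)
  then show ?thesis
    unfolding powr_along_ray[OF \<open>0 < s\<close> xy] by (simp only: mult.assoc)
qed

lemma young_tangent_le:
  assumes "0 < \<alpha>" "\<alpha> \<noteq> 1" "0 < s" "0 \<le> x" "0 \<le> y"
  shows "ennreal (fst (young_tangent \<alpha> s) * x + snd (young_tangent \<alpha> s) * y) \<le> young_gap \<alpha> x y"
proof (cases "\<alpha> > 1 \<and> x \<noteq> 0 \<and> y = 0")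
  case False
  with young_le[OF assms this] show ?thesis
    unfolding young_gap_def young_tangent_def by (auto simp: algebra_simps intro!: ennreal_leI)
qed (simp add: young_gap_def)

lemma young_gap_real_nonneg:
  fixes \<alpha> x y :: real
  assumes "0 < \<alpha>" "\<alpha> \<noteq> 1" "0 \<le> x" "0 \<le> y" "\<not> (\<alpha> > 1 \<and> x \<noteq> 0 \<and> y = 0)"
  shows "0 \<le> sgn (1 - \<alpha>) * (\<alpha> * x + (1 - \<alpha>) * y - x powr \<alpha> * y powr (1 - \<alpha>))"
  using young_le[of \<alpha> 1 x y] assms
  by (simp add: right_diff_distrib[of "sgn _"] del: mult_le_cancel_left)

text \<open>An enumeration of the positive rationals that starts at 1: the tangent at slope 1 is the
  zero form, which the choice arguments expect at index 0. Nonpositive rationals are sent to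
  1.\<close>

definition positive_rat :: "nat \<Rightarrow> real" where
  "positive_rat i = (if i = 0 then 1 else if 0 < real_of_rat (from_nat (i - 1)) then real_of_rat (from_nat (i - 1)) else 1)"

lemma positive_rat_pos: "0 < positive_rat i"
  by (simp add: positive_rat_def)

lemma positive_rat_0: "positive_rat 0 = 1"
  by (simp add: positive_rat_def)

lemma positive_rat_surj:
  assumes "r \<in> \<rat>" "0 < r"
  obtains i where "r = positive_rat i"
proof -
  from assms obtain q where "r = real_of_rat q" by (auto elim: Rats_cases)
  with assms have "r = positive_rat (Suc (to_nat q))" by (simp add: positive_rat_def)
  then show ?thesis using that by blast
qed

lemma tendsto_le_SUP_tangent:
  fixes a b :: "real \<Rightarrow> real"
  assumes "\<And>n. X n \<in> \<rat>" "\<And>n. 0 < X n"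
    and "(\<lambda>n. ennreal (a (X n) * x + b (X n) * y)) \<longlonglongrightarrow> l"
  shows "l \<le> (SUP i. ennreal (a (positive_rat i) * x + b (positive_rat i) * y))"
proof (rule LIMSEQ_le_const2[OF assms(3)], intro exI allI impI)
  fix n :: nat
  obtain i where "X n = positive_rat i" using positive_rat_surj[of "X n"] assms by blast
  then show "ennreal (a (X n) * x + b (X n) * y) \<le> (SUP i. ennreal (a (positive_rat i) * x + b (positive_rat i) * y))"
    by (auto intro!: SUP_upper2[of i])
qed

lemma rat_sequence:
  fixes r :: real
  assumes "0 < r"
  obtains X where "\<And>n::nat. X n \<in> \<rat>" "\<And>n. 0 < X n" "X \<longlonglongrightarrow> r"
proof -
  have "\<forall>n::nat. \<exists>q. q \<in> \<rat> \<and> r < q \<and> q < r + 1 / real (Suc n)"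
    using Rats_dense_in_real by (metis less_add_same_cancel1 of_nat_0_less_iff zero_less_Suc zero_less_divide_1_iff)
  from choice[OF this] obtain X where X: "\<And>n. X n \<in> \<rat>" "\<And>n. r < X n" "\<And>n. X n < r + 1 / real (Suc n)"
    by blast
  have "X \<longlonglongrightarrow> r"
  proof (rule real_tendsto_sandwich)
    show "(\<lambda>n. r) \<longlonglongrightarrow> r" by simp
    show "(\<lambda>n. r + 1 / real (Suc n)) \<longlonglongrightarrow> r" by real_asymp
  qed (use X in \<open>auto intro!: always_eventually less_imp_le\<close>)
  with X assms show ?thesis by (intro that[of X]) (auto intro: less_trans)
qed

text \<open>The gap is reached in the limit of rational slopes: they tend to \<open>y / x\<close>
  inside the quadrant, to infinity on \<open>x = 0\<close>, and to 0 on \<open>y = 0 < x\<close>,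
  where for \<open>\<alpha> > 1\<close> the tangent values diverge as the gap demands.\<close>

lemma young_gap_eq_SUP:
  assumes \<alpha>: "0 < \<alpha>" "\<alpha> \<noteq> 1" and xy: "0 \<le> x" "0 \<le> y"
  shows "young_gap \<alpha> x y =
    (SUP i. ennreal (fst (young_tangent \<alpha> (positive_rat i)) * x + snd (young_tangent \<alpha> (positive_rat i)) * y))"
proof (rule antisym[OF _ SUP_least], goal_cases)
  case 1
  let ?l = "\<lambda>s. fst (young_tangent \<alpha> s) * x + snd (young_tangent \<alpha> s) * y"
  consider "x = 0" | "0 < x" "y = 0" "\<alpha> < 1" | "0 < x" "y = 0" "\<alpha> > 1" | "0 < x" "0 < y"
    using xy \<alpha> by fastforce
  then obtain X :: "nat \<Rightarrow> real" where X: "\<And>n. X n \<in> \<rat>" "\<And>n. 0 < X n"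
    and lim: "(\<lambda>n. ennreal (?l (X n))) \<longlonglongrightarrow> young_gap \<alpha> x y"
  proof cases
    case 1
    have L: "(\<lambda>n. real (Suc n) powr (- \<alpha>)) \<longlonglongrightarrow> 0"
      using \<alpha> by (intro tendsto_neg_powr filterlim_compose[OF filterlim_real_sequentially filterlim_Suc]) auto
    then have "(\<lambda>n. ?l (real (Suc n))) \<longlonglongrightarrow> sgn (1 - \<alpha>) * (1 - \<alpha>) * (1 - 0) * y"
      unfolding young_tangent_def 1 fst_conv snd_conv mult_zero_right add_0_left add_0_right
      by (intro tendsto_intros L)
    with 1 \<alpha> show ?thesis
      by (intro that[of "\<lambda>n. real (Suc n)"]) (auto simp: young_gap_def mult.assoc intro!: tendsto_ennrealI)
  next
    case 2
    have L: "(\<lambda>n. (1 / real (Suc n)) powr (1 - \<alpha>)) \<longlonglongrightarrow> 0"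
      using 2 by (intro tendsto_zero_powrI[where b="1-\<alpha>"]) (real_asymp | auto)+
    then have "(\<lambda>n. ?l (1 / real (Suc n))) \<longlonglongrightarrow> sgn (1 - \<alpha>) * \<alpha> * (1 - 0) * x"
      unfolding young_tangent_def 2 fst_conv snd_conv mult_zero_right add_0_left add_0_right
      by (intro tendsto_intros L)
    with 2 \<alpha> show ?thesis
      by (intro that[of "\<lambda>n. 1 / real (Suc n)"]) (auto simp: young_gap_def mult.assoc intro!: tendsto_ennrealI)
  next
    case 3
    have "filterlim (\<lambda>n. real (Suc n) powr (\<alpha> - 1) - 1) at_top sequentially"
      using 3 by real_asymp
    moreover have "(1 / real (Suc n)) powr (1 - \<alpha>) = real (Suc n) powr (\<alpha> - 1)" for n
      by (simp add: powr_divide powr_minus_divide[symmetric])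
    ultimately have "filterlim (\<lambda>n. \<alpha> * x * ((1 / real (Suc n)) powr (1 - \<alpha>) - 1)) at_top sequentially"
      using 3 \<alpha> by (intro filterlim_tendsto_pos_mult_at_top[OF tendsto_const]) simp_all
    then show ?thesis
      using 3 \<alpha> by (intro that[of "\<lambda>n. 1 / real (Suc n)"])
         (auto simp: young_gap_def young_tangent_def ennreal_tendsto_top_eq_at_top algebra_simps)
  next
    case 4
    obtain X where X: "\<And>n::nat. X n \<in> \<rat>" "\<And>n. 0 < X n" "X \<longlonglongrightarrow> y / x"
      using rat_sequence[of "y / x"] 4 by auto
    have "(\<lambda>n. ?l (X n)) \<longlonglongrightarrow> ?l (y / x)"
      unfolding young_tangent_def fst_conv snd_conv using X(3) 4 by (intro tendsto_intros) auto
    moreover have "?l (y / x) = sgn (1 - \<alpha>) * (\<alpha> * x + (1 - \<alpha>) * y - x powr \<alpha> * y powr (1 - \<alpha>))"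
      using powr_along_ray[of "y/x" x y \<alpha>] 4 by (simp add: young_tangent_def algebra_simps)
    ultimately show ?thesis
      using X(1,2) 4 by (intro that[of X]) (auto simp: young_gap_def mult.assoc intro!: tendsto_ennrealI)
  qed
  show ?case by (rule tendsto_le_SUP_tangent[OF X lim])
next
  case (2 i)
  show ?case by (rule young_tangent_le) (auto simp: \<alpha> xy positive_rat_pos)
qed

lemma young_tangent_1 [simp]: "young_tangent \<alpha> 1 = (0, 0)"
  by (simp add: young_tangent_def)

section \<open>Affinities\<close>

lemma power_product_eq:
  assumes "0 < y \<or> x = 0 \<or> \<alpha> < 1" "0 \<le> y" "\<alpha> \<noteq> 1"
  shows "power_product \<alpha> x y = ennreal (x powr \<alpha> * y powr (1 - \<alpha>))"
proof (cases "\<alpha> > 1")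
  case True
  then show ?thesis
  proof (cases "x = 0")
    case False
    then have "0 < y" using assms True by auto
    then have "ennreal (x powr \<alpha>) / ennreal (y powr (\<alpha> - 1)) = ennreal (x powr \<alpha> / y powr (\<alpha> - 1))"
      by (intro divide_ennreal) auto
    also have "x powr \<alpha> / y powr (\<alpha> - 1) = x powr \<alpha> * y powr (1 - \<alpha>)"
      using \<open>0 < y\<close> by (simp add: powr_diff field_simps)
    finally show ?thesis using True by (simp add: power_product_def)
  qed (auto simp: power_product_def)
qed (simp add: power_product_def)

lemma power_product_infinite:
  assumes "\<alpha> > 1" "x \<noteq> 0" "0 \<le> x"
  shows "power_product \<alpha> x 0 = \<infinity>"
  using assms by (simp add: power_product_def ennreal_divide_eq_top_iff)

text \<open>Written with sums on both sides because subtraction on \<open>ennreal\<close> truncates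
  and, for \<open>\<alpha> > 1\<close>, both the product and the gap may be infinite.\<close>

lemma power_product_young_gap:
  assumes \<alpha>: "0 < \<alpha>" "\<alpha> \<noteq> 1" and xy: "0 \<le> x" "0 \<le> y"
  shows "\<alpha> < 1 \<Longrightarrow> power_product \<alpha> x y + young_gap \<alpha> x y = ennreal (\<alpha> * x + (1 - \<alpha>) * y)"
    and "1 < \<alpha> \<Longrightarrow> power_product \<alpha> x y + ennreal ((\<alpha> - 1) * y) = young_gap \<alpha> x y + ennreal (\<alpha> * x)"
proof -
  show "power_product \<alpha> x y + young_gap \<alpha> x y = ennreal (\<alpha> * x + (1 - \<alpha>) * y)" if "\<alpha> < 1"
    using that young_gap_real_nonneg[OF \<alpha> xy] xy
    by (simp add: power_product_eq young_gap_def ennreal_plus[symmetric] del: ennreal_plus)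
  show "power_product \<alpha> x y + ennreal ((\<alpha> - 1) * y) = young_gap \<alpha> x y + ennreal (\<alpha> * x)" if "1 < \<alpha>"
  proof (cases "x \<noteq> 0 \<and> y = 0")
    case True
    with that xy show ?thesis by (simp add: young_gap_def power_product_infinite)
  next
    case False
    with that xy young_gap_real_nonneg[OF \<alpha> xy] show ?thesis
      by (subst power_product_eq) (auto simp: young_gap_def ennreal_plus[symmetric] algebra_simps simp del: ennreal_plus)
  qed
qed

text \<open>Multiplicativity survives the zeros: \<open>0 * \<infinity> = 0\<close> agrees with the
  convention \<open>0 / 0 = 0\<close>.\<close>

lemma power_product_mult:
  assumes "0 \<le> x" "0 \<le> x'" "0 \<le> y" "0 \<le> y'"
  shows "power_product \<alpha> (x * x') (y * y') = power_product \<alpha> x y * power_product \<alpha> x' y'"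
  using assms
  by (simp add: power_product_def powr_mult divide_ennreal_def ennreal_mult ennreal_inverse_mult mult_ac)

lemma power_product_prod:
  assumes "finite I" "\<And>i. i \<in> I \<Longrightarrow> 0 \<le> x i" "\<And>i. i \<in> I \<Longrightarrow> 0 \<le> y i"
  shows "power_product \<alpha> (\<Prod>i\<in>I. x i) (\<Prod>i\<in>I. y i) = (\<Prod>i\<in>I. power_product \<alpha> (x i) (y i))"
  using assms
proof (induction I)
  case empty
  then show ?case by (simp add: power_product_def)
next
  case (insert i I)
  then show ?case by (simp add: power_product_mult prod_nonneg)
qed

lemma power_product_measurable [measurable]:
  assumes [measurable]: "p \<in> borel_measurable m" "q \<in> borel_measurable m"
  shows "(\<lambda>x. power_product \<alpha> (p x) (q x)) \<in> borel_measurable m"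
  unfolding power_product_def by measurable

lemma young_gap_measurable [measurable]:
  assumes [measurable]: "p \<in> borel_measurable m" "q \<in> borel_measurable m"
  shows "(\<lambda>x. young_gap \<alpha> (p x) (q x)) \<in> borel_measurable m"
  unfolding young_gap_def by measurable

section \<open>Exponentials of extended nonnegative numbers and the Poisson affinity\<close>

lemma exp_minus_add: "exp_minus (x + y) = exp_minus x * exp_minus y"
proof (cases "x = \<infinity> \<or> y = \<infinity>")
  case False
  then obtain a b where "x = ennreal a" "0 \<le> a" "y = ennreal b" "0 \<le> b"
    by (metis ennreal_cases infinity_ennreal_def)
  then show ?thesis
    by (simp add: exp_minus_def ennreal_plus[symmetric] exp_add[symmetric] del: ennreal_plus)
qed (auto simp: exp_minus_def)

lemma exp_minus_0 [simp]: "exp_minus 0 = 1"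
  by (simp add: exp_minus_def)

lemma exp_minus_nonneg [simp]: "0 \<le> exp_minus x" and exp_minus_le_1 [simp]: "exp_minus x \<le> 1"
  by (auto simp: exp_minus_def)

lemma exp_minus_ennreal [simp]: "0 \<le> r \<Longrightarrow> exp_minus (ennreal r) = exp (- r)"
  by (simp add: exp_minus_def)

lemma tendsto_exp_minus:
  assumes T: "(T \<longlongrightarrow> t) F"
  shows "((\<lambda>n. exp_minus (T n)) \<longlongrightarrow> exp_minus t) F"
proof (cases "t = \<infinity>")
  case True
  show ?thesis
  proof (rule order_tendstoI)
    fix e :: real assume "exp_minus t < e"
    with True have "0 < e" by (simp add: exp_minus_def)
    define r where "r = max 0 (- ln e)"
    have r: "0 \<le> r" "- ln e \<le> r" by (auto simp: r_def)
    have "eventually (\<lambda>n. ennreal r < T n) F"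
      using T True by (intro order_tendstoD) auto
    then show "eventually (\<lambda>n. exp_minus (T n) < e) F"
    proof eventually_elim
      case (elim n)
      show ?case
      proof (cases "T n")
        case (real s)
        with elim r have "r < s" using r by (simp add: ennreal_less_iff)
        then have "exp (- s) < exp (- r)" by simp
        also have "\<dots> \<le> exp (ln e)" unfolding exp_le_cancel_iff using r by simp
        finally show ?thesis using real \<open>0 < e\<close> by simp
      qed (simp add: exp_minus_def \<open>0 < e\<close>)
    qed
  next
    fix e :: real assume "e < exp_minus t"
    with True have "e < 0" by (simp add: exp_minus_def)
    then show "eventually (\<lambda>n. e < exp_minus (T n)) F"
      by (intro always_eventually allI) (rule less_le_trans, assumption, simp)
  qed
next
  case False
  then have "eventually (\<lambda>n. T n < top) F" using T by (intro order_tendstoD) (auto simp: less_top)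
  then have ev: "eventually (\<lambda>n. exp (- enn2real (T n)) = exp_minus (T n)) F"
    by eventually_elim (auto simp: exp_minus_def)
  have "((\<lambda>n. exp (- enn2real (T n))) \<longlongrightarrow> exp (- enn2real t)) F"
    using False T by (intro tendsto_intros tendsto_enn2real) (auto simp: less_top)
  with ev False show ?thesis
    by (simp add: tendsto_cong[OF ev] exp_minus_def[of t])
qed

text \<open>The affinity \<open>\<integral>p\<^sup>\<alpha>q\<^sup>1\<^sup>-\<^sup>\<alpha>\<close> of two Poisson laws whose intensities have the
  integrated Young gap \<open>T\<close>; for \<open>\<alpha> > 1\<close> it equals \<open>e\<^sup>T\<close>.\<close>

definition poisson_affinity :: "real \<Rightarrow> ennreal \<Rightarrow> ennreal" where
  "poisson_affinity \<alpha> T = (if \<alpha> < 1 then ennreal (exp_minus T) else inverse (ennreal (exp_minus T)))"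

lemma poisson_affinity_add:
  "poisson_affinity \<alpha> (x + y) = poisson_affinity \<alpha> x * poisson_affinity \<alpha> y"
  by (simp add: poisson_affinity_def exp_minus_add ennreal_mult ennreal_inverse_mult)

lemma poisson_affinity_sum:
  "finite I \<Longrightarrow> poisson_affinity \<alpha> (\<Sum>i\<in>I. T i) = (\<Prod>i\<in>I. poisson_affinity \<alpha> (T i))"
  by (induction I rule: finite_induct) (simp_all add: poisson_affinity_add, simp add: poisson_affinity_def)

lemma tendsto_poisson_affinity:
  assumes "(T \<longlongrightarrow> t) F"
  shows "((\<lambda>n. poisson_affinity \<alpha> (T n)) \<longlongrightarrow> poisson_affinity \<alpha> t) F"
proof -
  have lim: "((\<lambda>n. ennreal (exp_minus (T n))) \<longlongrightarrow> ennreal (exp_minus t)) F"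
    by (intro tendsto_ennrealI tendsto_exp_minus assms)
  have "((\<lambda>n. inverse (ennreal (exp_minus (T n)))) \<longlongrightarrow> inverse (ennreal (exp_minus t))) F"
    by (rule continuous_on_tendsto_compose[OF continuous_on_inverse_ennreal[OF continuous_on_id] lim, of UNIV]) auto
  with lim show ?thesis
    by (cases "\<alpha> < 1") (simp_all add: poisson_affinity_def)
qed

text \<open>The pointwise identities are integrated; the linear terms become constants because both
  masses are 1.\<close>

lemma (in density_pair) affinity_young_gap:
  assumes \<alpha>: "0 < \<alpha>" "\<alpha> \<noteq> 1" and prob: "prob_space P" "prob_space Q"
  shows "\<alpha> < 1 \<Longrightarrow> (\<integral>\<^sup>+x. power_product \<alpha> (p x) (q x) \<partial>m) + (\<integral>\<^sup>+x. young_gap \<alpha> (p x) (q x) \<partial>m) = 1"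
    and "1 < \<alpha> \<Longrightarrow> (\<integral>\<^sup>+x. power_product \<alpha> (p x) (q x) \<partial>m) = (\<integral>\<^sup>+x. young_gap \<alpha> (p x) (q x) \<partial>m) + 1"
proof -
  have p1: "(\<integral>\<^sup>+x. ennreal (c * p x) \<partial>m) = ennreal c" and q1: "(\<integral>\<^sup>+x. ennreal (c * q x) \<partial>m) = ennreal c"
    if "0 \<le> c" for c
    using that prob[THEN prob_space.emeasure_space_1] nn_integral_p nn_integral_q p_nonneg q_nonneg
    by (simp_all add: ennreal_mult' nn_integral_cmult)
  show "(\<integral>\<^sup>+x. power_product \<alpha> (p x) (q x) \<partial>m) + (\<integral>\<^sup>+x. young_gap \<alpha> (p x) (q x) \<partial>m) = 1" if "\<alpha> < 1"
  proof -
    have "(\<integral>\<^sup>+x. power_product \<alpha> (p x) (q x) \<partial>m) + (\<integral>\<^sup>+x. young_gap \<alpha> (p x) (q x) \<partial>m)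
      = (\<integral>\<^sup>+x. ennreal (\<alpha> * p x) + ennreal ((1 - \<alpha>) * q x) \<partial>m)"
      using that \<alpha> p_nonneg q_nonneg
      by (subst nn_integral_add[symmetric]) (auto intro!: nn_integral_cong simp: power_product_young_gap)
    also have "\<dots> = ennreal \<alpha> + ennreal (1 - \<alpha>)"
      using that \<alpha> by (simp add: nn_integral_add p1 q1)
    finally show ?thesis using that \<alpha> by (simp add: ennreal_plus[symmetric] del: ennreal_plus)
  qed
  show "(\<integral>\<^sup>+x. power_product \<alpha> (p x) (q x) \<partial>m) = (\<integral>\<^sup>+x. young_gap \<alpha> (p x) (q x) \<partial>m) + 1" if "1 < \<alpha>"
  proof -
    have "(\<integral>\<^sup>+x. power_product \<alpha> (p x) (q x) \<partial>m) + ennreal (\<alpha> - 1)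
      = (\<integral>\<^sup>+x. power_product \<alpha> (p x) (q x) + ennreal ((\<alpha> - 1) * q x) \<partial>m)"
      using that by (simp add: nn_integral_add q1)
    also have "\<dots> = (\<integral>\<^sup>+x. young_gap \<alpha> (p x) (q x) + ennreal (\<alpha> * p x) \<partial>m)"
      using that \<alpha> p_nonneg q_nonneg by (intro nn_integral_cong power_product_young_gap) auto
    also have "\<dots> = (\<integral>\<^sup>+x. young_gap \<alpha> (p x) (q x) \<partial>m) + ennreal \<alpha>"
      using that by (simp add: nn_integral_add p1)
    also have "ennreal \<alpha> = 1 + ennreal (\<alpha> - 1)"
      using that by (simp add: ennreal_plus[symmetric] flip: ennreal_1 del: ennreal_plus)
    finally show ?thesis by (simp add: add.assoc[symmetric] add.commute[of _ "ennreal (\<alpha> - 1)"])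
  qed
qed

section \<open>Poisson distributions\<close>

text \<open>Since \<open>0 ^ 0 = 1\<close>, the rate 0 gives the unit mass at 0, as needed for cells
  of zero intensity.\<close>

definition poisson_mass :: "real \<Rightarrow> nat \<Rightarrow> real" where
  "poisson_mass a k = a ^ k / fact k * exp (- a)"

lemma poisson_mass_nonneg: "0 \<le> a \<Longrightarrow> 0 \<le> poisson_mass a k"
  by (simp add: poisson_mass_def)

lemma power_powr_commute: "0 \<le> a \<Longrightarrow> (a ^ k) powr \<alpha> = (a powr \<alpha>) ^ k" for a :: real
  by (induction k) (simp_all add: powr_mult)

text \<open>Poisson weights are closed under geometric mixing up to normalization: the mean becomes
  \<open>a^\<alpha> b^(1-\<alpha>)\<close>.\<close>

lemma poisson_mass_powr:
  assumes "0 \<le> a" "0 \<le> b"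
  shows "poisson_mass a k powr \<alpha> * poisson_mass b k powr (1 - \<alpha>) =
    (a powr \<alpha> * b powr (1 - \<alpha>)) ^ k / fact k * exp (- (\<alpha> * a + (1 - \<alpha>) * b))"
proof -
  have "(fact k :: real) powr \<alpha> * fact k powr (1 - \<alpha>) = fact k"
    by (simp add: powr_add[symmetric])
  moreover have "exp (- a) powr \<alpha> * exp (- b) powr (1 - \<alpha>) = exp (- (\<alpha> * a + (1 - \<alpha>) * b))"
    by (simp add: powr_def exp_add[symmetric] algebra_simps)
  ultimately show ?thesis
    using assms
    by (simp add: poisson_mass_def powr_mult powr_divide power_powr_commute power_mult_distrib field_simps)
qed

lemma nn_integral_exp_series:
  assumes "0 \<le> c" "0 \<le> d"
  shows "(\<integral>\<^sup>+k. ennreal (c ^ k / fact k * d) \<partial>count_space UNIV) = ennreal (exp c * d)"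
proof -
  have "(\<lambda>k. c ^ k / fact k * d) sums (exp c * d)"
    using exp_converges[of c] by (intro sums_mult2) (simp add: divide_inverse mult.commute)
  then show ?thesis
    using assms by (simp add: nn_integral_count_space_nat suminf_ennreal2 sums_iff)
qed

text \<open>Summing the exponential series leaves the exponent
  \<open>a^\<alpha> b^(1-\<alpha>) - \<alpha> a - (1-\<alpha>) b\<close>, which is minus the gap for
  \<open>\<alpha> < 1\<close> and the gap for \<open>\<alpha> > 1\<close>.\<close>

lemma poisson_mass_affinity:
  assumes \<alpha>: "0 < \<alpha>" "\<alpha> \<noteq> 1" and ab: "0 \<le> a" "0 \<le> b"
  shows "(\<integral>\<^sup>+k. power_product \<alpha> (poisson_mass a k) (poisson_mass b k) \<partial>count_space UNIV)
    = poisson_affinity \<alpha> (young_gap \<alpha> a b)"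
proof (cases "\<alpha> > 1 \<and> a \<noteq> 0 \<and> b = 0")
  case True
  \<comment> \<open>With \<open>b = 0\<close> the second law sits at 0 while the first charges 1, so
    this single term is already infinite.\<close>
  then have "power_product \<alpha> (poisson_mass a 1) (poisson_mass b 1) = \<infinity>"
    using ab by (simp add: power_product_infinite poisson_mass_def)
  then have "(\<integral>\<^sup>+k. power_product \<alpha> (poisson_mass a k) (poisson_mass b k) \<partial>count_space UNIV) = \<infinity>"
    using nn_integral_ge_point[of 1 UNIV "\<lambda>k. power_product \<alpha> (poisson_mass a k) (poisson_mass b k)"]
    by (simp add: top_unique)
  with True show ?thesis
    by (simp add: poisson_affinity_def young_gap_def exp_minus_def)
next
  case False
  let ?c = "a powr \<alpha> * b powr (1 - \<alpha>)" and ?d = "\<alpha> * a + (1 - \<alpha>) * b"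
  have "power_product \<alpha> (poisson_mass a k) (poisson_mass b k) = ennreal (?c ^ k / fact k * exp (- ?d))" for k
  proof (subst power_product_eq)
    show "0 < poisson_mass b k \<or> poisson_mass a k = 0 \<or> \<alpha> < 1"
      using False ab \<alpha> by (cases k) (auto simp: poisson_mass_def)
  qed (use ab \<alpha> in \<open>simp_all add: poisson_mass_nonneg poisson_mass_powr\<close>)
  then have "(\<integral>\<^sup>+k. power_product \<alpha> (poisson_mass a k) (poisson_mass b k) \<partial>count_space UNIV) = ennreal (exp (?c - ?d))"
    using ab by (simp only: nn_integral_exp_series mult_nonneg_nonneg powr_ge_zero exp_ge_zero)
      (simp only: mult_exp_exp diff_conv_add_uminus)
  also have "\<dots> = poisson_affinity \<alpha> (young_gap \<alpha> a b)"
  proof (cases "\<alpha> < 1")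
    case True
    then show ?thesis
      using young_gap_real_nonneg[OF \<alpha> ab False] by (simp add: young_gap_def poisson_affinity_def)
  next
    case 1: False
    then have "\<alpha> > 1" using \<alpha> by simp
    then have "young_gap \<alpha> a b = ennreal (?c - ?d)" "0 \<le> ?c - ?d"
      using young_gap_real_nonneg[OF \<alpha> ab False] False by (auto simp: young_gap_def algebra_simps)
    then show ?thesis
      using 1 by (simp add: poisson_affinity_def inverse_ennreal exp_minus_inverse exp_minus[symmetric] del: exp_diff)
  qed
  finally show ?thesis .
qed

definition poisson_law :: "real \<Rightarrow> nat measure" where
  "poisson_law a = density (count_space UNIV) (\<lambda>k. ennreal (poisson_mass a k))"

lemma prob_space_poisson_law: "0 \<le> a \<Longrightarrow> prob_space (poisson_law a)"
  using nn_integral_exp_series[of a "exp (- a)"]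
  by (intro prob_spaceI) (simp add: poisson_law_def emeasure_density poisson_mass_def exp_minus)

lemma PiM_poisson_law:
  assumes "finite I" "\<And>i. i \<in> I \<Longrightarrow> 0 \<le> a i"
  shows "PiM I (\<lambda>i. poisson_law (a i)) =
    density (PiM I (\<lambda>_. count_space UNIV)) (\<lambda>v. ennreal (\<Prod>i\<in>I. poisson_mass (a i) (v i)))"
proof -
  \<comment> \<open>The product locales ask for sigma-finite factors at every index, also outside
    \<open>I\<close>; \<open>b\<close> makes all rates nonnegative.\<close>
  define b where "b i = max 0 (a i)" for i
  have b: "i \<in> I \<Longrightarrow> b i = a i" "0 \<le> b i" for i using assms by (auto simp: b_def)
  interpret C: product_sigma_finite "\<lambda>_::'a. count_space (UNIV :: nat set)"
    by (intro product_sigma_finite.intro sigma_finite_measure_count_space)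
  interpret L: product_sigma_finite "\<lambda>i. poisson_law (b i)"
    by (intro product_sigma_finite.intro prob_space_imp_sigma_finite prob_space_poisson_law b)
  let ?D = "density (PiM I (\<lambda>_. count_space UNIV)) (\<lambda>v. ennreal (\<Prod>i\<in>I. poisson_mass (a i) (v i)))"
  have "?D = PiM I (\<lambda>i. poisson_law (b i))"
  proof (rule L.PiM_eqI)
    show "sets ?D = sets (PiM I (\<lambda>i. poisson_law (b i)))"
      unfolding sets_density by (intro sets_PiM_cong) (simp_all add: poisson_law_def)
    fix A :: "'a \<Rightarrow> nat set"
    have A: "Pi\<^sub>E I A \<in> sets (PiM I (\<lambda>_. count_space UNIV))"
      using assms by (intro sets_PiM_I_finite) auto
    have "emeasure ?D (Pi\<^sub>E I A) = (\<integral>\<^sup>+v. (\<Prod>i\<in>I. ennreal (poisson_mass (a i) (v i)) * indicator (A i) (v i)) \<partial>PiM I (\<lambda>_. count_space UNIV))"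
      using A assms
      by (subst emeasure_density)
        (auto intro!: nn_integral_cong borel_measurable_prod
          simp: prod.distrib prod_ennreal poisson_mass_nonneg space_PiM indicator_def PiE_iff split: if_splits)
    also have "\<dots> = (\<Prod>i\<in>I. \<integral>\<^sup>+k. ennreal (poisson_mass (a i) k) * indicator (A i) k \<partial>count_space UNIV)"
      using assms by (intro C.product_nn_integral_prod) auto
    also have "\<dots> = (\<Prod>i\<in>I. emeasure (poisson_law (b i)) (A i))"
      by (intro prod.cong) (auto simp: poisson_law_def emeasure_density b)
    finally show "emeasure ?D (Pi\<^sub>E I A) = (\<Prod>i\<in>I. emeasure (poisson_law (b i)) (A i))" .
  qed (fact assms(1))
  also have "\<dots> = PiM I (\<lambda>i. poisson_law (a i))"
    using b by (intro PiM_cong) auto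
  finally show ?thesis ..
qed

lemma poisson_product_affinity:
  assumes \<alpha>: "0 < \<alpha>" "\<alpha> \<noteq> 1" and I: "finite I" "\<And>i. i \<in> I \<Longrightarrow> 0 \<le> a i" "\<And>i. i \<in> I \<Longrightarrow> 0 \<le> b i"
  shows "(\<integral>\<^sup>+v. power_product \<alpha> (\<Prod>i\<in>I. poisson_mass (a i) (v i)) (\<Prod>i\<in>I. poisson_mass (b i) (v i)) \<partial>PiM I (\<lambda>_. count_space UNIV))
    = poisson_affinity \<alpha> (\<Sum>i\<in>I. young_gap \<alpha> (a i) (b i))"
proof -
  interpret C: product_sigma_finite "\<lambda>_::'a. count_space (UNIV :: nat set)"
    by (intro product_sigma_finite.intro sigma_finite_measure_count_space)
  have "(\<integral>\<^sup>+v. power_product \<alpha> (\<Prod>i\<in>I. poisson_mass (a i) (v i)) (\<Prod>i\<in>I. poisson_mass (b i) (v i)) \<partial>PiM I (\<lambda>_. count_space UNIV))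
    = (\<integral>\<^sup>+v. (\<Prod>i\<in>I. power_product \<alpha> (poisson_mass (a i) (v i)) (poisson_mass (b i) (v i))) \<partial>PiM I (\<lambda>_. count_space UNIV))"
    using I by (intro nn_integral_cong power_product_prod) (auto simp: poisson_mass_nonneg)
  also have "\<dots> = (\<Prod>i\<in>I. \<integral>\<^sup>+k. power_product \<alpha> (poisson_mass (a i) k) (poisson_mass (b i) k) \<partial>count_space UNIV)"
    using I by (intro C.product_nn_integral_prod) auto
  also have "\<dots> = poisson_affinity \<alpha> (\<Sum>i\<in>I. young_gap \<alpha> (a i) (b i))"
    using I \<alpha> by (simp add: poisson_affinity_sum poisson_mass_affinity)
  finally show ?thesis .
qed

text \<open>The map inverts the embedding of the naturals into \<open>ennreal\<close>, turning
  extended counts into the natural numbers that the path increments are.\<close>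

lemma distr_Poi:
  assumes "0 \<le> a"
  shows "distr (Poi (ennreal a)) (count_space UNIV) (\<lambda>x. nat \<lfloor>enn2real x\<rfloor>) = poisson_law a"
proof (cases "a = 0")
  case True
  have "return (count_space UNIV) (0::nat) = poisson_law 0"
    by (rule measure_eqI_countable[where A=UNIV])
      (simp_all add: poisson_law_def emeasure_density nn_integral_indicator_singleton poisson_mass_def power_0_left)
  with True show ?thesis by (simp add: Poi_def distr_return)
next
  case False
  with assms have a: "0 < a" by simp
  have "distr (Poi (ennreal a)) (count_space UNIV) (\<lambda>x. nat \<lfloor>enn2real x\<rfloor>)
    = distr (measure_pmf (poisson_pmf a)) (count_space UNIV) (\<lambda>k. nat \<lfloor>enn2real (of_nat k)\<rfloor>)"
    using a by (simp add: Poi_def distr_distr comp_def)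
  also have "\<dots> = distr (measure_pmf (poisson_pmf a)) (count_space UNIV) (\<lambda>k. k)"
    by (simp add: ennreal_of_nat_eq_real_of_nat)
  also have "\<dots> = poisson_law a"
    using a by (subst distr_id2) (simp_all add: measure_pmf_eq_density poisson_law_def poisson_mass_def)
  finally show ?thesis .
qed

section \<open>Dyadic cells\<close>

lemma young_gap_0 [simp]: "young_gap \<alpha> 0 0 = 0"
  by (simp add: young_gap_def)

section \<open>Young gaps of image measures, and the dyadic grid\<close>

lemma (in density_pair) nn_integral_young_gap_eq_SUP:
  assumes "0 < \<alpha>" "\<alpha> \<noteq> 1"
  shows "(\<integral>\<^sup>+x. young_gap \<alpha> (p x) (q x) \<partial>m) =
    (\<integral>\<^sup>+x. (SUP i. ennreal (fst (young_tangent \<alpha> (positive_rat i)) * p x + snd (young_tangent \<alpha> (positive_rat i)) * q x)) \<partial>m)"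
  using assms p_nonneg q_nonneg by (intro nn_integral_cong young_gap_eq_SUP) auto

lemma young_gap_data_processing:
  assumes \<alpha>: "0 < \<alpha>" "\<alpha> \<noteq> 1"
    and pair: "density_pair m P Q p q"
    and S: "S \<in> measurable m E"
    and E: "density_pair m' (distr P E S) (distr Q E S) p' q'"
  shows "(\<integral>\<^sup>+y. young_gap \<alpha> (p' y) (q' y) \<partial>m') \<le> (\<integral>\<^sup>+x. young_gap \<alpha> (p x) (q x) \<partial>m)"
  using density_pair_data_processing[OF pair _ _ S E,
      of "\<lambda>i. fst (young_tangent \<alpha> (positive_rat i))" "\<lambda>i. snd (young_tangent \<alpha> (positive_rat i))"]
  by (simp add: density_pair.nn_integral_young_gap_eq_SUP[OF pair \<alpha>]
      density_pair.nn_integral_young_gap_eq_SUP[OF E \<alpha>] positive_rat_0)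

lemma young_gap_convergence:
  fixes S :: "nat \<Rightarrow> 'a \<Rightarrow> 'b"
  assumes \<alpha>: "0 < \<alpha>" "\<alpha> \<noteq> 1"
    and pair: "density_pair m P Q p q"
    and S: "\<And>n. S n \<in> measurable m (E n)"
    and E: "\<And>n. density_pair (m' n) (distr P (E n) (S n)) (distr Q (E n) (S n)) (p' n) (q' n)"
    and h: "\<And>n. h n \<in> measurable (E (Suc n)) (E n)"
    and S_h: "\<And>n x. x \<in> space m \<Longrightarrow> S n x = h n (S (Suc n) x)"
    and gen: "sets m \<subseteq> sigma_sets (space m) (\<Union>n. {S n -` C \<inter> space m | C. C \<in> sets (E n)})"
  shows "(\<lambda>n. \<integral>\<^sup>+y. young_gap \<alpha> (p' n y) (q' n y) \<partial>m' n) \<longlonglongrightarrow> (\<integral>\<^sup>+x. young_gap \<alpha> (p x) (q x) \<partial>m)"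
  unfolding density_pair.nn_integral_young_gap_eq_SUP[OF pair \<alpha>]
    density_pair.nn_integral_young_gap_eq_SUP[OF E \<alpha>]
  by (rule density_pair_convergence[OF pair _ _ S E h S_h gen]) (simp_all add: positive_rat_0)

text \<open>Cells are left-open, matching the points that a path counts between two times;
  \<open>max 1\<close> puts the time 0 into the first cell, so that points at 0 are counted.\<close>

definition dyadic_index :: "nat \<Rightarrow> real \<Rightarrow> nat" where
  "dyadic_index n t = max 1 (nat \<lceil>t * 2 ^ n\<rceil>)"

definition dyadic_cell :: "nat \<Rightarrow> nat \<Rightarrow> real set" where
  "dyadic_cell n k = {t \<in> {0..}. dyadic_index n t = k}"

lemma dyadic_index_le_iff: "1 \<le> k \<Longrightarrow> dyadic_index n t \<le> k \<longleftrightarrow> t \<le> real k / 2 ^ n"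
  by (auto simp: dyadic_index_def nat_le_iff ceiling_le_iff field_simps)

lemma dyadic_index_pos: "1 \<le> dyadic_index n t"
  by (simp add: dyadic_index_def)

text \<open>Cells \<open>2k - 1\<close> and \<open>2k\<close> of the finer level make up cell
  \<open>k\<close>; comparing right endpoints through \<open>dyadic_index_le_iff\<close> gives both
  inequalities.\<close>

lemma dyadic_index_Suc: "dyadic_index n t = (dyadic_index (Suc n) t + 1) div 2"
proof (rule antisym)
  let ?i = "dyadic_index (Suc n) t" and ?j = "(dyadic_index (Suc n) t + 1) div 2"
  have pos: "1 \<le> ?i" "1 \<le> ?j" "?i \<le> 2 * ?j" using dyadic_index_pos[of "Suc n" t] by auto
  then have "t \<le> real (2 * ?j) / 2 ^ Suc n"
    using dyadic_index_le_iff[of "2 * ?j" "Suc n" t] by linarith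
  then show "dyadic_index n t \<le> ?j"
    using pos by (subst dyadic_index_le_iff) auto
  let ?k = "dyadic_index n t"
  have "t \<le> real (2 * ?k) / 2 ^ Suc n"
    using dyadic_index_le_iff[of ?k n t] dyadic_index_pos[of n t] by simp
  then have "?i \<le> 2 * ?k"
    using dyadic_index_pos[of n t] by (subst dyadic_index_le_iff) auto
  then show "?j \<le> ?k" by linarith
qed

lemma dyadic_index_measurable [measurable]: "dyadic_index n \<in> measurable borel (count_space UNIV)"
  unfolding dyadic_index_def by measurable

lemma dyadic_cell_sets: "dyadic_cell n k \<in> sets (restrict_space borel {0..})"
proof -
  have "dyadic_cell n k = {0..} \<inter> {t \<in> space borel. dyadic_index n t = k}"
    by (auto simp: dyadic_cell_def)
  then show ?thesis
    unfolding sets_restrict_space by (intro image_eqI[of _ _ "{t \<in> space borel. dyadic_index n t = k}"]) auto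
qed

lemma dyadic_cell_disjoint: "disjoint_family_on (dyadic_cell n) I"
  by (auto simp: disjoint_family_on_def dyadic_cell_def)

lemma dyadic_cell_1: "dyadic_cell n 1 = {0..1 / 2 ^ n}"
proof -
  have "dyadic_index n t \<le> 1 \<longleftrightarrow> t \<le> 1 / 2 ^ n" for t
    using dyadic_index_le_iff[of 1 n t] by simp
  moreover have "dyadic_index n t = 1 \<longleftrightarrow> dyadic_index n t \<le> 1" for t
    using dyadic_index_pos[of n t] by linarith
  ultimately have *: "dyadic_index n t = 1 \<longleftrightarrow> t \<le> 1 / 2 ^ n" for t by blast
  show ?thesis unfolding dyadic_cell_def * by auto
qed

lemma dyadic_cell_Suc:
  assumes "1 \<le> k"
  shows "dyadic_cell n (Suc k) = {0..real (Suc k) / 2 ^ n} - {0..real k / 2 ^ n}"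
proof -
  have "dyadic_index n t = Suc k \<longleftrightarrow> dyadic_index n t \<le> Suc k \<and> \<not> dyadic_index n t \<le> k" for t by linarith
  moreover have "dyadic_index n t \<le> Suc k \<longleftrightarrow> t \<le> real (Suc k) / 2 ^ n" "dyadic_index n t \<le> k \<longleftrightarrow> t \<le> real k / 2 ^ n" for t
    using assms by (intro dyadic_index_le_iff; simp)+
  ultimately have *: "dyadic_index n t = Suc k \<longleftrightarrow> t \<le> real (Suc k) / 2 ^ n \<and> \<not> t \<le> real k / 2 ^ n" for t by blast
  show ?thesis unfolding dyadic_cell_def * by auto
qed

lemma dyadic_cell_subset: "dyadic_cell n k \<subseteq> {0..real k / 2 ^ n}" if "1 \<le> k"
proof
  fix t assume "t \<in> dyadic_cell n k"
  then have "0 \<le> t" "dyadic_index n t \<le> k" by (auto simp: dyadic_cell_def)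
  then show "t \<in> {0..real k / 2 ^ n}" using dyadic_index_le_iff[OF that] by simp
qed

lemma dyadic_index_tendsto:
  assumes "0 \<le> t"
  shows "(\<lambda>n. real (dyadic_index n t) / 2 ^ n) \<longlonglongrightarrow> t"
proof (rule real_tendsto_sandwich)
  show "(\<lambda>n. t) \<longlonglongrightarrow> t" by simp
  show "(\<lambda>n. t + 1 / 2 ^ n) \<longlonglongrightarrow> t" by real_asymp
  show "\<forall>\<^sub>F n in sequentially. t \<le> real (dyadic_index n t) / 2 ^ n"
    using dyadic_index_le_iff[OF dyadic_index_pos] by (intro always_eventually allI) blast
  have "real (dyadic_index n t) \<le> t * 2 ^ n + 1" for n
    using assms of_int_ceiling_le_add_one[of "t * 2 ^ n"] by (auto simp: dyadic_index_def max_def)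
  then show "\<forall>\<^sub>F n in sequentially. real (dyadic_index n t) / 2 ^ n \<le> t + 1 / 2 ^ n"
    by (intro always_eventually allI) (simp add: field_simps)
qed

text \<open>A time is the limit of the right endpoints of its cells, so the identity is measurable
  for the sigma-algebra that the indices generate.\<close>

lemma borel_Rplus_generated:
  "sets (restrict_space borel {0::real..}) \<subseteq>
     sigma_sets {0..} (\<Union>n. {dyadic_index n -` C \<inter> {0..} | C. C \<in> sets (count_space UNIV)})"
    (is "_ \<subseteq> sigma_sets _ ?G")
proof
  fix A assume "A \<in> sets (restrict_space borel {0::real..})"
  then obtain B where B: "B \<in> sets (borel :: real measure)" "A = B \<inter> {0..}" by (auto simp: sets_restrict_space)
  let ?M = "sigma {0..} ?G"
  have sets_M: "sets ?M = sigma_sets {0..} ?G" "space ?M = {0..}"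
    by (auto intro!: sets_measure_of space_measure_of)
  have "dyadic_index n \<in> measurable ?M (count_space UNIV)" for n
  proof (rule measurableI)
    fix C
    show "dyadic_index n -` C \<inter> space ?M \<in> sets ?M"
      unfolding sets_M by (intro sigma_sets.Basic UN_I[of n]) auto
  qed simp
  then have idx: "(\<lambda>t. real (dyadic_index n t) / 2 ^ n) \<in> borel_measurable ?M" for n
    by (rule measurable_compose[where g="\<lambda>k. real k / 2 ^ n"]) simp
  have "(\<lambda>t::real. t) \<in> borel_measurable ?M"
    by (rule borel_measurable_LIMSEQ_real[OF _ idx]) (unfold sets_M, rule dyadic_index_tendsto, simp)
  then have "(\<lambda>t::real. t) -` B \<inter> space ?M \<in> sets ?M" using B(1) by (rule measurable_sets)
  moreover have "(\<lambda>t::real. t) -` B \<inter> space ?M = A" unfolding sets_M B(2) by blast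
  ultimately show "A \<in> sigma_sets {0..} ?G" unfolding sets_M by (simp only:)
qed

section \<open>Intensity measures\<close>

text \<open>The cut-off provides the finite mass that \<open>density_pair\<close> asks for.\<close>

definition window :: "(real \<Rightarrow> real) \<Rightarrow> nat \<Rightarrow> real \<Rightarrow> real" where
  "window h T t = h t * indicator {0..real T} t"

definition cell_mass :: "(real \<Rightarrow> real) \<Rightarrow> nat \<Rightarrow> nat \<Rightarrow> real" where
  "cell_mass h n k = measure (intensity_measure h) (dyadic_cell n k)"

text \<open>The local finiteness is supplied by \<open>poisson_process_intensity_finite\<close>: it
  comes from the counts being finite.\<close>

locale intensity_pair =
  fixes f g :: "real \<Rightarrow> real"
  assumes f: "intensity_function f" and g: "intensity_function g"
    and f_finite: "\<And>t. 0 \<le> t \<Longrightarrow> emeasure (intensity_measure f) {0..t} < \<infinity>"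
    and g_finite: "\<And>t. 0 \<le> t \<Longrightarrow> emeasure (intensity_measure g) {0..t} < \<infinity>"
begin

lemma f_meas [measurable]: "f \<in> borel_measurable lebesgue_Rplus"
  and g_meas [measurable]: "g \<in> borel_measurable lebesgue_Rplus"
  and f_nonneg: "0 \<le> t \<Longrightarrow> 0 \<le> f t" and g_nonneg: "0 \<le> t \<Longrightarrow> 0 \<le> g t"
  using f g by (auto simp: intensity_function_def)

lemma sets_Rplus: "sets lebesgue_Rplus = sets (restrict_space borel {0..})"
  by (intro sets_restrict_space_cong) simp

lemma space_Rplus: "space lebesgue_Rplus = {0..}"
  by (simp add: space_restrict_space)

lemma Icc_sets: "{0..t} \<in> sets lebesgue_Rplus"
  by (auto simp: sets_restrict_space image_iff intro!: bexI[of _ "{0..t}"])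

lemma cell_sets [measurable]: "dyadic_cell n k \<in> sets lebesgue_Rplus"
  using dyadic_cell_sets sets_Rplus by simp

lemma window_measurable:
  assumes [measurable]: "h \<in> borel_measurable lebesgue_Rplus"
  shows "window h T \<in> borel_measurable lebesgue_Rplus"
  unfolding window_def using Icc_sets by (intro borel_measurable_times borel_measurable_indicator) auto

lemma emeasure_window:
  assumes h: "h \<in> borel_measurable lebesgue_Rplus" and A: "A \<in> sets lebesgue_Rplus"
  shows "emeasure (density lebesgue_Rplus (\<lambda>t. ennreal (window h T t))) A = emeasure (intensity_measure h) (A \<inter> {0..real T})"
proof -
  have "emeasure (density lebesgue_Rplus (\<lambda>t. ennreal (window h T t))) A
    = (\<integral>\<^sup>+t. ennreal (window h T t) * indicator A t \<partial>lebesgue_Rplus)"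
    using window_measurable[OF h] A by (intro emeasure_density) auto
  also have "\<dots> = (\<integral>\<^sup>+t. ennreal (h t) * indicator (A \<inter> {0..real T}) t \<partial>lebesgue_Rplus)"
    by (intro nn_integral_cong) (auto simp: window_def indicator_def)
  also have "\<dots> = emeasure (intensity_measure h) (A \<inter> {0..real T})"
    unfolding intensity_measure_def using h A Icc_sets by (intro emeasure_density[symmetric] sets.Int) auto
  finally show ?thesis .
qed

lemma density_pair_window:
  "density_pair lebesgue_Rplus (density lebesgue_Rplus (\<lambda>t. ennreal (window f T t)))
     (density lebesgue_Rplus (\<lambda>t. ennreal (window g T t))) (window f T) (window g T)"
proof (intro density_pair.intro finite_measureI)
  show "emeasure (density lebesgue_Rplus (\<lambda>t. ennreal (window f T t))) (space (density lebesgue_Rplus (\<lambda>t. ennreal (window f T t)))) \<noteq> \<infinity>"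
    using f_finite[of "real T"] emeasure_window[OF f_meas sets.top] by (simp add: space_Rplus Int_absorb1)
  show "emeasure (density lebesgue_Rplus (\<lambda>t. ennreal (window g T t))) (space (density lebesgue_Rplus (\<lambda>t. ennreal (window g T t)))) \<noteq> \<infinity>"
    using g_finite[of "real T"] emeasure_window[OF g_meas sets.top] by (simp add: space_Rplus Int_absorb1)
qed (auto intro: window_measurable simp: window_def space_Rplus f_nonneg g_nonneg)

text \<open>\<open>T\<close> is an integer, so the end of the window lies on every grid and each
  cell is inside the window or disjoint from it; cell 0 is empty.\<close>

lemma measure_window_cell:
  assumes h: "h \<in> borel_measurable lebesgue_Rplus" and "1 \<le> T"
  shows "measure (density lebesgue_Rplus (\<lambda>t. ennreal (window h T t))) (dyadic_cell n k) =
    (if 1 \<le> k \<and> k \<le> T * 2 ^ n then cell_mass h n k else 0)"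
proof -
  consider "k = 0" | "1 \<le> k" "k \<le> T * 2 ^ n" | "T * 2 ^ n < k" by linarith
  then have "dyadic_cell n k \<inter> {0..real T} = (if 1 \<le> k \<and> k \<le> T * 2 ^ n then dyadic_cell n k else {})"
  proof cases
    case 1
    then show ?thesis by (auto simp: dyadic_cell_def dyadic_index_def)
  next
    case 2
    have "real k \<le> real (T * 2 ^ n)" using 2 by (simp only: of_nat_le_iff)
    then have "real k / 2 ^ n \<le> real T" by (simp add: field_simps)
    then show ?thesis using dyadic_cell_subset[OF 2(1), of n] 2 by fastforce
  next
    case 3
    have "dyadic_index n t < k" if "t \<le> real T" for t
    proof -
      have "dyadic_index n t \<le> T * 2 ^ n" using that \<open>1 \<le> T\<close> by (subst dyadic_index_le_iff) auto
      with 3 show ?thesis by simp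
    qed
    then have "\<forall>t. t \<le> real T \<longrightarrow> dyadic_index n t \<noteq> k" by (metis less_irrefl)
    then have "dyadic_cell n k \<inter> {0..real T} = {}" by (auto simp: dyadic_cell_def)
    with 3 show ?thesis by simp
  qed
  then show ?thesis
    by (simp add: measure_def emeasure_window[OF h] cell_mass_def)
qed

lemma finite_window:
  "finite_measure (density lebesgue_Rplus (\<lambda>t. ennreal (window f T t)))"
  "finite_measure (density lebesgue_Rplus (\<lambda>t. ennreal (window g T t)))"
  using density_pair_window[of T] by (auto simp: density_pair_def)

lemma dyadic_index_measurable_Rplus: "dyadic_index n \<in> measurable lebesgue_Rplus (count_space UNIV)"
  by (rule measurable_restrict_space1) measurable

lemma distr_window:
  assumes fin: "finite_measure (density lebesgue_Rplus (\<lambda>t. ennreal (window h T t)))" and "1 \<le> T"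
    and h: "h \<in> borel_measurable lebesgue_Rplus"
  shows "distr (density lebesgue_Rplus (\<lambda>t. ennreal (window h T t))) (count_space UNIV) (dyadic_index n) =
    density (count_space UNIV) (\<lambda>k. ennreal (if 1 \<le> k \<and> k \<le> T * 2 ^ n then cell_mass h n k else 0))"
proof (rule measure_eqI_countable[where A=UNIV])
  fix k :: nat
  let ?D = "density lebesgue_Rplus (\<lambda>t. ennreal (window h T t))"
  interpret finite_measure ?D by fact
  have "emeasure (distr ?D (count_space UNIV) (dyadic_index n)) {k} = emeasure ?D (dyadic_cell n k)"
    using dyadic_index_measurable_Rplus[of n]
    by (subst emeasure_distr) (auto simp: dyadic_cell_def space_Rplus intro!: arg_cong[where f="emeasure ?D"])
  then show "emeasure (distr ?D (count_space UNIV) (dyadic_index n)) {k} =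
    emeasure (density (count_space UNIV) (\<lambda>k. ennreal (if 1 \<le> k \<and> k \<le> T * 2 ^ n then cell_mass h n k else 0))) {k}"
    using \<open>1 \<le> T\<close> h
    by (simp add: emeasure_eq_measure measure_window_cell emeasure_density nn_integral_indicator_singleton)
qed auto

lemma cell_mass_nonneg: "0 \<le> cell_mass h n k"
  by (simp add: cell_mass_def)

lemma density_pair_cells:
  assumes "1 \<le> T"
  shows "density_pair (count_space UNIV)
    (distr (density lebesgue_Rplus (\<lambda>t. ennreal (window f T t))) (count_space UNIV) (dyadic_index n))
    (distr (density lebesgue_Rplus (\<lambda>t. ennreal (window g T t))) (count_space UNIV) (dyadic_index n))
    (\<lambda>k. if 1 \<le> k \<and> k \<le> T * 2 ^ n then cell_mass f n k else 0)
    (\<lambda>k. if 1 \<le> k \<and> k \<le> T * 2 ^ n then cell_mass g n k else 0)"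
proof (intro density_pair.intro)
  show "finite_measure (distr (density lebesgue_Rplus (\<lambda>t. ennreal (window f T t))) (count_space UNIV) (dyadic_index n))"
    "finite_measure (distr (density lebesgue_Rplus (\<lambda>t. ennreal (window g T t))) (count_space UNIV) (dyadic_index n))"
    using finite_window dyadic_index_measurable_Rplus by (auto intro!: finite_measure.finite_measure_distr)
qed (auto simp: cell_mass_nonneg intro!: distr_window[OF _ assms, simplified] finite_window)

lemma nn_integral_cells:
  fixes K :: nat
  shows
  "(\<integral>\<^sup>+k. young_gap \<alpha> (if 1 \<le> k \<and> k \<le> K then a k else 0) (if 1 \<le> k \<and> k \<le> K then b k else 0) \<partial>count_space UNIV)
    = (\<Sum>k\<in>{1..K}. young_gap \<alpha> (a k) (b k))"
  by (subst nn_integral_count_space'[of "{1..K}"]) (auto intro!: sum.cong)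

lemma young_gap_window_le:
  "(\<integral>\<^sup>+t. young_gap \<alpha> (window f T t) (window g T t) \<partial>lebesgue_Rplus) \<le> (\<integral>\<^sup>+t. young_gap \<alpha> (f t) (g t) \<partial>lebesgue_Rplus)"
  by (intro nn_integral_mono) (auto simp: window_def indicator_def)

lemma sum_young_gap_le:
  assumes \<alpha>: "0 < \<alpha>" "\<alpha> \<noteq> 1" and T: "1 \<le> T"
  shows "(\<Sum>k\<in>{1..T * 2 ^ n}. young_gap \<alpha> (cell_mass f n k) (cell_mass g n k)) \<le> (\<integral>\<^sup>+t. young_gap \<alpha> (f t) (g t) \<partial>lebesgue_Rplus)"
  using order_trans[OF young_gap_data_processing[OF \<alpha> density_pair_window dyadic_index_measurable_Rplus density_pair_cells[OF T]] young_gap_window_le]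
  unfolding nn_integral_cells .

lemma sum_young_gap_tendsto_window:
  assumes \<alpha>: "0 < \<alpha>" "\<alpha> \<noteq> 1" and T: "1 \<le> T"
  shows "(\<lambda>n. \<Sum>k\<in>{1..T * 2 ^ n}. young_gap \<alpha> (cell_mass f n k) (cell_mass g n k))
    \<longlonglongrightarrow> (\<integral>\<^sup>+t. young_gap \<alpha> (window f T t) (window g T t) \<partial>lebesgue_Rplus)"
proof -
  have gen: "sets lebesgue_Rplus \<subseteq> sigma_sets (space lebesgue_Rplus)
      (\<Union>n. {dyadic_index n -` C \<inter> space lebesgue_Rplus | C. C \<in> sets (count_space UNIV)})"
    unfolding sets_Rplus space_Rplus by (rule borel_Rplus_generated)
  have h: "(\<lambda>k. (k + 1) div 2) \<in> measurable (count_space UNIV) (count_space (UNIV :: nat set))"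
    by simp
  have "(\<lambda>n. \<integral>\<^sup>+k. young_gap \<alpha> (if 1 \<le> k \<and> k \<le> T * 2 ^ n then cell_mass f n k else 0)
      (if 1 \<le> k \<and> k \<le> T * 2 ^ n then cell_mass g n k else 0) \<partial>count_space UNIV)
    \<longlonglongrightarrow> (\<integral>\<^sup>+t. young_gap \<alpha> (window f T t) (window g T t) \<partial>lebesgue_Rplus)"
    by (rule young_gap_convergence[OF \<alpha> density_pair_window dyadic_index_measurable_Rplus
        density_pair_cells[OF T] h dyadic_index_Suc gen])
  then show ?thesis unfolding nn_integral_cells .
qed

text \<open>Horizon and mesh move together here. Data processing bounds every sum from above.
  Conversely, a window that nearly exhausts the integral is fixed; once \<open>n\<close> reaches
  \<open>T\<close>, its sums are part of the full ones.\<close>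

lemma sum_young_gap_tendsto:
  assumes \<alpha>: "0 < \<alpha>" "\<alpha> \<noteq> 1"
  shows "(\<lambda>n. \<Sum>k\<in>{1..Suc n * 2 ^ n}. young_gap \<alpha> (cell_mass f n k) (cell_mass g n k))
    \<longlonglongrightarrow> (\<integral>\<^sup>+t. young_gap \<alpha> (f t) (g t) \<partial>lebesgue_Rplus)" (is "?D \<longlonglongrightarrow> ?d")
proof (rule order_tendstoI)
  have le: "?D n \<le> ?d" for n by (rule sum_young_gap_le[OF \<alpha>]) simp
  fix c assume "?d < c"
  then show "\<forall>\<^sub>F n in sequentially. ?D n < c"
    using le_less_trans[OF le] by (intro always_eventually allI) blast
next
  fix c assume c: "c < ?d"
  have w: "young_gap \<alpha> (window f T t) (window g T t) = (if t \<le> real T then young_gap \<alpha> (f t) (g t) else 0)"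
    if "t \<in> space lebesgue_Rplus" for T t
    using that by (simp add: window_def space_Rplus)
  have SUP: "(SUP T. young_gap \<alpha> (window f (Suc T) t) (window g (Suc T) t)) = young_gap \<alpha> (f t) (g t)"
    if t: "t \<in> space lebesgue_Rplus" for t
  proof (rule antisym[OF SUP_least])
    obtain T where "t \<le> real T" using real_arch_simple by blast
    then have "t \<le> real (Suc T)" by simp
    then show "young_gap \<alpha> (f t) (g t) \<le> (SUP T. young_gap \<alpha> (window f (Suc T) t) (window g (Suc T) t))"
      by (intro SUP_upper2[of T]) (simp_all only: w[OF t] if_True UNIV_I order_refl)
  qed (simp add: w[OF t])
  have mono: "incseq (\<lambda>T t. young_gap \<alpha> (window f (Suc T) t) (window g (Suc T) t))"
  proof (intro incseq_SucI le_funI)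
    fix T t
    show "young_gap \<alpha> (window f (Suc T) t) (window g (Suc T) t) \<le> young_gap \<alpha> (window f (Suc (Suc T)) t) (window g (Suc (Suc T)) t)"
      by (cases "t \<in> {0..real (Suc T)}") (simp_all add: window_def)
  qed
  have "?d = (\<integral>\<^sup>+t. (SUP T. young_gap \<alpha> (window f (Suc T) t) (window g (Suc T) t)) \<partial>lebesgue_Rplus)"
    by (intro nn_integral_cong) (simp add: SUP)
  also have "\<dots> = (SUP T. \<integral>\<^sup>+t. young_gap \<alpha> (window f (Suc T) t) (window g (Suc T) t) \<partial>lebesgue_Rplus)"
    by (rule nn_integral_monotone_convergence_SUP[OF mono])
      (intro young_gap_measurable window_measurable f_meas g_meas)
  finally obtain T where "c < (\<integral>\<^sup>+t. young_gap \<alpha> (window f (Suc T) t) (window g (Suc T) t) \<partial>lebesgue_Rplus)"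
    using c by (auto simp: less_SUP_iff)
  from order_tendstoD(1)[OF sum_young_gap_tendsto_window[OF \<alpha>] this]
  have "\<forall>\<^sub>F n in sequentially. c < (\<Sum>k\<in>{1..Suc T * 2 ^ n}. young_gap \<alpha> (cell_mass f n k) (cell_mass g n k))"
    by simp
  with eventually_ge_at_top[of T] show "\<forall>\<^sub>F n in sequentially. c < ?D n"
  proof eventually_elim
    case (elim n)
    have "(\<Sum>k\<in>{1..Suc T * 2 ^ n}. young_gap \<alpha> (cell_mass f n k) (cell_mass g n k)) \<le> ?D n"
      using elim(1) by (intro sum_mono2) (auto intro: order_trans)
    with elim(2) show ?case by (rule less_le_trans)
  qed
qed

end

section \<open>Laws of Poisson processes\<close>

lemma space_path_space: "space path_space = counting_paths"
  by (simp add: path_space_def space_Sup_eq_UN)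

lemma measurable_path_eval: "0 \<le> t \<Longrightarrow> (\<lambda>x. x t) \<in> measurable path_space (count_space UNIV)"
  unfolding path_space_def by (rule measurable_SUP1[where i=t]) (auto intro: measurable_vimage_algebra1)

lemma space_point_pattern_algebra:
  "sets L \<noteq> {} \<Longrightarrow> space (point_pattern_algebra L) = point_patterns L"
  by (auto simp: point_pattern_algebra_def space_Sup_eq_UN)

lemma measurable_emeasure_point_pattern:
  "B \<in> sets L \<Longrightarrow> (\<lambda>\<eta>. emeasure \<eta> B) \<in> borel_measurable (point_pattern_algebra L)"
  unfolding point_pattern_algebra_def
  by (rule measurable_SUP1[where i=B]) (auto intro: measurable_vimage_algebra1)

text \<open>The first increment is not reduced by \<open>x 0\<close>: the first cell contains 0, and
  a path may start with points there.\<close>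

definition increment :: "nat \<Rightarrow> nat \<Rightarrow> (real \<Rightarrow> nat) \<Rightarrow> nat" where
  "increment n k x = x (real k / 2 ^ n) - (if k = 1 then 0 else x (real (k - 1) / 2 ^ n))"

lemma measurable_increment: "increment n k \<in> measurable path_space (count_space UNIV)"
proof -
  have "(\<lambda>x. F x - (if k = 1 then 0 else G x)) \<in> measurable M (count_space UNIV)"
    if [measurable]: "F \<in> measurable M (count_space UNIV)" "G \<in> measurable M (count_space UNIV)"
    for F G :: "'b \<Rightarrow> nat" and M by measurable
  from this[OF measurable_path_eval measurable_path_eval] show ?thesis
    unfolding increment_def by simp
qed

lemma counting_path_mono: "x \<in> counting_paths \<Longrightarrow> 0 \<le> s \<Longrightarrow> s \<le> t \<Longrightarrow> x s \<le> x t"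
  by (auto simp: counting_paths_def mono_on_def)

text \<open>A telescoping sum; monotonicity of the path keeps subtraction on \<open>nat\<close> from
  truncating.\<close>

lemma increment_refine:
  assumes "x \<in> counting_paths" "1 \<le> k"
  shows "increment n k x = increment (Suc n) (2 * k - 1) x + increment (Suc n) (2 * k) x"
proof -
  have 1: "real (2 * k) / 2 ^ Suc n = real k / 2 ^ n" by simp
  have 2: "real (2 * k - 1 - 1) / 2 ^ Suc n = real (k - 1) / 2 ^ n"
  proof -
    have "2 * k - 1 - 1 = 2 * (k - 1)" by simp
    then show ?thesis by simp
  qed
  have "real (2 * k - 1) / 2 ^ Suc n \<le> real (2 * k) / 2 ^ Suc n"
    "real (2 * k - 1 - 1) / 2 ^ Suc n \<le> real (2 * k - 1) / 2 ^ Suc n"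
    by (intro divide_right_mono; simp)+
  then have "x (real (2 * k - 1) / 2 ^ Suc n) \<le> x (real (2 * k) / 2 ^ Suc n)"
    "x (real (2 * k - 1 - 1) / 2 ^ Suc n) \<le> x (real (2 * k - 1) / 2 ^ Suc n)"
    using assms by (auto intro!: counting_path_mono)
  moreover have "2 * k - 1 = 1 \<longleftrightarrow> k = 1" "2 * k \<noteq> 1" using assms by auto
  ultimately show ?thesis
    unfolding increment_def 1 2 by (cases "k = 1") (simp_all add: 1 2 del: of_nat_mult)
qed

lemma path_eq_sum_increments:
  assumes "x \<in> counting_paths" "1 \<le> K"
  shows "x (real K / 2 ^ n) = (\<Sum>k\<in>{1..K}. increment n k x)"
  using assms(2)
proof (induction K rule: dec_induct)
  case base
  then show ?case by (simp add: increment_def)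
next
  case (step K)
  have "real K / 2 ^ n \<le> real (Suc K) / 2 ^ n" by (intro divide_right_mono) auto
  then have "x (real K / 2 ^ n) \<le> x (real (Suc K) / 2 ^ n)"
    using assms(1) by (intro counting_path_mono) auto
  moreover have "increment n (Suc K) x = x (real (Suc K) / 2 ^ n) - x (real K / 2 ^ n)"
    using step by (simp add: increment_def)
  ultimately show ?case using step by simp
qed

text \<open>The horizon \<open>Suc n\<close> grows with the level: each level has finitely many
  coordinates, yet every time is eventually covered.\<close>

definition dyadic_increments :: "nat \<Rightarrow> (real \<Rightarrow> nat) \<Rightarrow> nat \<Rightarrow> nat" where
  "dyadic_increments n x = (\<lambda>k\<in>{1..Suc n * 2 ^ n}. increment n k x)"

abbreviation increment_space :: "nat \<Rightarrow> (nat \<Rightarrow> nat) measure" where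
  "increment_space n \<equiv> PiM {1..Suc n * 2 ^ n} (\<lambda>_. count_space UNIV)"

lemma measurable_dyadic_increments: "dyadic_increments n \<in> measurable path_space (increment_space n)"
  unfolding dyadic_increments_def by (intro measurable_restrict measurable_increment)

lemma refined_range:
  assumes "k \<in> {1..Suc n * 2 ^ n}"
  shows "2 * k - 1 \<in> {1..Suc (Suc n) * 2 ^ Suc n}" "2 * k \<in> {1..Suc (Suc n) * 2 ^ Suc n}"
proof -
  have k: "1 \<le> k" "k \<le> Suc n * 2 ^ n" using assms by simp_all
  have "Suc n * 2 ^ Suc n \<le> Suc (Suc n) * (2 :: nat) ^ Suc n" by (intro mult_right_mono) auto
  moreover have "2 * (Suc n * 2 ^ n) = Suc n * (2 :: nat) ^ Suc n" by simp
  ultimately have "2 * k \<le> Suc (Suc n) * 2 ^ Suc n" using k(2) by linarith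
  with k(1) show "2 * k - 1 \<in> {1..Suc (Suc n) * 2 ^ Suc n}" "2 * k \<in> {1..Suc (Suc n) * 2 ^ Suc n}"
    unfolding atLeastAtMost_iff by linarith+
qed

lemma dyadic_increments_refine:
  assumes "x \<in> counting_paths"
  shows "dyadic_increments n x =
    (\<lambda>k\<in>{1..Suc n * 2 ^ n}. dyadic_increments (Suc n) x (2 * k - 1) + dyadic_increments (Suc n) x (2 * k))"
proof (rule ext)
  fix k
  show "dyadic_increments n x k =
    (\<lambda>k\<in>{1..Suc n * 2 ^ n}. dyadic_increments (Suc n) x (2 * k - 1) + dyadic_increments (Suc n) x (2 * k)) k"
  proof (cases "k \<in> {1..Suc n * 2 ^ n}")
    case True
    then have "1 \<le> k" by simp
    show ?thesis
      unfolding dyadic_increments_def restrict_apply if_P[OF True] if_P[OF refined_range(1)[OF True]]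
        if_P[OF refined_range(2)[OF True]]
      by (rule increment_refine[OF assms \<open>1 \<le> k\<close>])
  next
    case False
    show ?thesis unfolding dyadic_increments_def restrict_apply if_not_P[OF False] by (rule refl)
  qed
qed

lemma measurable_increments_refine:
  "(\<lambda>v. \<lambda>k\<in>{1..Suc n * 2 ^ n}. v (2 * k - 1) + v (2 * k)) \<in> measurable (increment_space (Suc n)) (increment_space n)"
proof (intro measurable_restrict)
  fix k assume k: "k \<in> {1..Suc n * 2 ^ n}"
  show "(\<lambda>v. v (2 * k - 1) + v (2 * k)) \<in> measurable (increment_space (Suc n)) (count_space UNIV)"
  proof -
    have add: "(\<lambda>v. F v + G v) \<in> measurable M (count_space UNIV)"
      if [measurable]: "F \<in> measurable M (count_space UNIV)" "G \<in> measurable M (count_space UNIV)"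
      for F G :: "'b \<Rightarrow> nat" and M by measurable
    show ?thesis
      using refined_range[OF k, THEN measurable_component_singleton[where M="\<lambda>_. count_space UNIV"]]
      by (rule add)
  qed
qed

text \<open>The approximation is strictly from above, as limits along \<open>at_right t\<close>
  require.\<close>

lemma dyadic_upper_approx:
  assumes "0 \<le> t"
  defines "K \<equiv> \<lambda>n. nat \<lfloor>t * 2 ^ n\<rfloor> + 1"
  shows "t < real (K n) / 2 ^ n" "real (K n) / 2 ^ n \<le> t + 1 / 2 ^ n"
proof -
  have "real (K n) = of_int \<lfloor>t * 2 ^ n\<rfloor> + 1" using assms(1) by (simp add: K_def)
  then have "t * 2 ^ n < real (K n)" "real (K n) \<le> t * 2 ^ n + 1"
    using floor_correct[of "t * 2 ^ n"] by linarith+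
  then show "t < real (K n) / 2 ^ n" "real (K n) / 2 ^ n \<le> t + 1 / 2 ^ n"
    by (auto simp: field_simps)
qed

text \<open>By right-continuity every evaluation is recovered from dyadic times, where the path is a
  sum of increments.\<close>

lemma path_space_generated:
  "sets path_space \<subseteq> sigma_sets counting_paths
     (\<Union>n. {dyadic_increments n -` C \<inter> counting_paths | C. C \<in> sets (increment_space n)})"
  (is "_ \<subseteq> sigma_sets _ ?G")
proof -
  define M where "M = sigma counting_paths ?G"
  have sets_M: "sets M = sigma_sets counting_paths ?G" and space_M: "space M = counting_paths"
    unfolding M_def by (intro sets_measure_of space_measure_of; blast)+
  have incs: "dyadic_increments n \<in> measurable M (increment_space n)" for n
  proof (rule measurableI)
    fix x assume "x \<in> space M"
    then have "x \<in> space path_space" by (simp only: space_M space_path_space)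
    then show "dyadic_increments n x \<in> space (increment_space n)"
      by (rule measurable_space[OF measurable_dyadic_increments])
  next
    fix C assume "C \<in> sets (increment_space n)"
    then show "dyadic_increments n -` C \<inter> space M \<in> sets M"
      unfolding sets_M space_M by (intro sigma_sets.Basic) blast
  qed
  have inc: "increment n k \<in> measurable M (count_space UNIV)" if "k \<in> {1..Suc n * 2 ^ n}" for n k
  proof -
    have "(\<lambda>x. dyadic_increments n x k) \<in> measurable M (count_space UNIV)"
      by (rule measurable_compose[OF incs measurable_component_singleton[OF that]])
    then show ?thesis unfolding dyadic_increments_def restrict_apply using that by (simp only: if_True)
  qed
  have dyadic: "(\<lambda>x. x (real K / 2 ^ n)) \<in> measurable M (count_space UNIV)" if "1 \<le> K" "K \<le> Suc n * 2 ^ n" for K n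
  proof (subst measurable_cong)
    fix x assume "x \<in> space M"
    then show "x (real K / 2 ^ n) = (\<Sum>k\<in>{1..K}. increment n k x)"
      unfolding space_M by (rule path_eq_sum_increments[OF _ that(1)])
  next
    have sum: "(\<lambda>x. \<Sum>k\<in>J. increment n k x) \<in> measurable M (count_space UNIV)" if "finite J" "J \<subseteq> {1..Suc n * 2 ^ n}" for J
      using that
    proof induction
      case (insert k J)
      have "(\<lambda>x. F x + G x) \<in> measurable M (count_space UNIV)"
        if [measurable]: "F \<in> measurable M (count_space UNIV)" "G \<in> measurable M (count_space UNIV)"
        for F G :: "(real \<Rightarrow> nat) \<Rightarrow> nat" by measurable
      with insert inc[of k n] have "(\<lambda>x. increment n k x + (\<Sum>k\<in>J. increment n k x)) \<in> measurable M (count_space UNIV)"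
        by (meson insert_subset)
      then show ?case by (simp only: sum.insert[OF insert.hyps])
    qed simp
    show "(\<lambda>x. \<Sum>k\<in>{1..K}. increment n k x) \<in> measurable M (count_space UNIV)"
      by (intro sum finite_atLeastAtMost atLeastatMost_subset_iff[THEN iffD2] disjI2 conjI order_refl that(2))
  qed
  have eval: "(\<lambda>x. x t) \<in> measurable M (count_space UNIV)" if t: "0 \<le> t" for t
  proof -
    \<comment> \<open>Levels are shifted by \<open>N\<close>: the dyadic time may exceed
      \<open>t\<close> by up to \<open>1 / 2^n\<close>, and it stays within the horizon
      \<open>Suc n\<close> once \<open>n\<close> is at least \<open>t\<close>.\<close>
    define N where "N = nat \<lceil>t\<rceil>"
    define K where "K n = nat \<lfloor>t * 2 ^ n\<rfloor> + 1" for n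
    have K: "t < real (K n) / 2 ^ n" "real (K n) / 2 ^ n \<le> t + 1 / 2 ^ n" for n
      unfolding K_def by (rule dyadic_upper_approx[OF t])+
    have K_le: "K (n + N) \<le> Suc (n + N) * 2 ^ (n + N)" for n
    proof -
      have "real (K (n + N)) \<le> (t + 1 / 2 ^ (n + N)) * 2 ^ (n + N)"
        using mult_right_mono[OF K(2)[of "n + N"], of "2 ^ (n + N)"] by simp
      also have "\<dots> = t * 2 ^ (n + N) + 1" by (simp add: distrib_right)
      also have "\<dots> \<le> real (n + N) * 2 ^ (n + N) + 2 ^ (n + N)"
      proof -
        have "t \<le> real (n + N)" unfolding N_def of_nat_add by (rule add_increasing[OF of_nat_0_le_iff real_nat_ceiling_ge])
        then show ?thesis by (intro add_mono mult_right_mono) auto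
      qed
      also have "\<dots> = real (Suc (n + N) * 2 ^ (n + N))" by (simp add: distrib_right)
      finally show ?thesis by (simp only: of_nat_le_iff)
    qed
    have meas: "(\<lambda>x. real (x (real (K (n + N)) / 2 ^ (n + N)))) \<in> borel_measurable M" for n
    proof (rule measurable_compose[OF dyadic[OF _ K_le]])
      show "1 \<le> K (n + N)" by (simp add: K_def)
    qed simp
    have lim: "(\<lambda>n. real (x (real (K (n + N)) / 2 ^ (n + N)))) \<longlonglongrightarrow> real (x t)" if "x \<in> space M" for x
    proof -
      have "(x \<longlongrightarrow> x t) (at_right t)" using that t unfolding space_M by (auto simp: counting_paths_def)
      moreover have "filterlim (\<lambda>n. real (K n) / 2 ^ n) (at_right t) sequentially"
        unfolding filterlim_at
      proof
        have "real (K n) / 2 ^ n \<in> {t<..} \<and> real (K n) / 2 ^ n \<noteq> t" for n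
          using K(1)[of n] by simp
        then show "\<forall>\<^sub>F n in sequentially. real (K n) / 2 ^ n \<in> {t<..} \<and> real (K n) / 2 ^ n \<noteq> t"
          by (intro always_eventually allI)
        show "(\<lambda>n. real (K n) / 2 ^ n) \<longlonglongrightarrow> t"
        proof (rule real_tendsto_sandwich[of "\<lambda>_. t" _ _ "\<lambda>n. t + 1 / 2 ^ n"])
          show "(\<lambda>n. t + 1 / 2 ^ n) \<longlonglongrightarrow> t" by real_asymp
          show "\<forall>\<^sub>F n in sequentially. t \<le> real (K n) / 2 ^ n"
            by (intro always_eventually allI less_imp_le K(1))
          show "\<forall>\<^sub>F n in sequentially. real (K n) / 2 ^ n \<le> t + 1 / 2 ^ n"
            by (intro always_eventually allI K(2))
        qed simp
      qed
      ultimately have "(\<lambda>n. x (real (K n) / 2 ^ n)) \<longlonglongrightarrow> x t" by (rule filterlim_compose)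
      \<comment> \<open>In the discrete topology on \<open>nat\<close>, convergence means being
        eventually constant.\<close>
      from LIMSEQ_ignore_initial_segment[OF this, of N]
      have "\<forall>\<^sub>F n in sequentially. x (real (K (n + N)) / 2 ^ (n + N)) = x t"
        by (simp only: tendsto_discrete)
      then have "\<forall>\<^sub>F n in sequentially. real (x (real (K (n + N)) / 2 ^ (n + N))) = real (x t)"
        by eventually_elim (simp only:)
      then show ?thesis by (rule tendsto_eventually)
    qed
    have "(\<lambda>x. real (x t)) \<in> borel_measurable M"
      by (rule borel_measurable_LIMSEQ_real[where u="\<lambda>n x. real (x (real (K (n + N)) / 2 ^ (n + N)))"])
        (rule lim, assumption, rule meas)
    then have "(\<lambda>x. nat \<lfloor>real (x t)\<rfloor>) \<in> measurable M (count_space UNIV)"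
      by (rule measurable_compose) measurable
    then show ?thesis by simp
  qed
  have "(\<lambda>x. x) \<in> measurable M path_space"
    unfolding path_space_def
  proof (rule measurable_SUP2)
    fix t :: real assume "t \<in> {0..}"
    then have t: "0 \<le> t" by simp
    show "(\<lambda>x. x) \<in> measurable M (vimage_algebra counting_paths (\<lambda>x. x t) (count_space UNIV))"
      by (rule measurable_vimage_algebra2) (use eval[OF t] in \<open>auto simp: space_M\<close>)
  qed auto
  note id = this
  show ?thesis
  proof
    fix A assume A: "A \<in> sets path_space"
    have "(\<lambda>x. x) -` A \<inter> space M = A"
      using sets.sets_into_space[OF A] unfolding space_M space_path_space by blast
    with measurable_sets[OF id A] show "A \<in> sigma_sets counting_paths ?G"
      unfolding sets_M[symmetric] by (simp only:)
  qed
qed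

section \<open>Counts of the point pattern and the law of the increments\<close>

lemma prob_space_law: "poisson_process M L X \<Longrightarrow> prob_space (law M X)"
  unfolding poisson_process_def law_def by (auto intro: prob_space.prob_space_distr)

text \<open>Otherwise the count on \<open>[0,t]\<close> would have the law
  \<open>Poi \<infinity>\<close> and be almost surely infinite, although it almost surely equals a
  natural number.\<close>

lemma poisson_process_intensity_finite:
  assumes X: "poisson_process M L X" and t: "0 \<le> t"
  shows "emeasure L {0..t} < \<infinity>"
proof (rule ccontr)
  assume "\<not> emeasure L {0..t} < \<infinity>"
  then have inf: "emeasure L {0..t} = \<infinity>" using less_top[of "emeasure L {0..t}"] by auto
  obtain \<eta> where M: "prob_space M" and sets_L: "sets L = sets (restrict_space borel {0..})"
    and \<eta>: "\<eta> \<in> measurable M (point_pattern_algebra L)"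
    and P: "poisson_PP_distribution L (distr M (point_pattern_algebra L) \<eta>)"
    and count: "AE \<omega> in M. \<forall>t\<ge>0. of_nat (X \<omega> t) = emeasure (\<eta> \<omega>) {0..t}"
    using X unfolding poisson_process_def by blast
  interpret prob_space M by fact
  have B: "{0..t} \<in> sets L"
    unfolding sets_L by (auto simp: sets_restrict_space image_iff intro!: bexI[of _ "{0..t}"])
  note ev = measurable_emeasure_point_pattern[OF B]
  have "distr M borel (\<lambda>\<omega>. emeasure (\<eta> \<omega>) {0..t}) = return borel \<infinity>"
    using P B inf \<eta> ev unfolding poisson_PP_distribution_def
    by (auto simp: distr_distr comp_def Poi_def)
  moreover have "AE x in return borel \<infinity>. x = (\<infinity> :: ennreal)"
    by (subst AE_return) auto
  ultimately have "AE x in distr M borel (\<lambda>\<omega>. emeasure (\<eta> \<omega>) {0..t}). x = \<infinity>" by (simp only:)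
  then have "AE \<omega> in M. emeasure (\<eta> \<omega>) {0..t} = \<infinity>"
    using measurable_compose[OF \<eta> ev] by (subst (asm) AE_distr_iff) auto
  with count have "AE \<omega> in M. False"
  proof eventually_elim
    case (elim \<omega>)
    then have "of_nat (X \<omega> t) = (\<infinity> :: ennreal)" using t by metis
    then show False by simp
  qed
  then show False by simp
qed

text \<open>Almost surely the increments are the counts of the pattern in disjoint cells, so they
  are independent with Poisson marginals and their joint law is a product.\<close>

lemma distr_increments_law:
  assumes X: "poisson_process M L X"
  shows "distr (law M X) (increment_space n) (dyadic_increments n) =
    density (increment_space n) (\<lambda>v. ennreal (\<Prod>k\<in>{1..Suc n * 2 ^ n}. poisson_mass (measure L (dyadic_cell n k)) (v k)))"
proof -
  let ?I = "{1..Suc n * 2 ^ n}" and ?C = "dyadic_cell n"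
  let ?c = "\<lambda>e::ennreal. nat \<lfloor>enn2real e\<rfloor>"
  obtain \<eta> where M: "prob_space M" and sets_L: "sets L = sets (restrict_space borel {0..})"
    and Xm: "X \<in> measurable M path_space"
    and \<eta>: "\<eta> \<in> measurable M (point_pattern_algebra L)"
    and P: "poisson_PP_distribution L (distr M (point_pattern_algebra L) \<eta>)"
    and count: "AE \<omega> in M. \<forall>t\<ge>0. of_nat (X \<omega> t) = emeasure (\<eta> \<omega>) {0..t}"
    using X unfolding poisson_process_def by blast
  let ?P = "distr M (point_pattern_algebra L) \<eta>"
  interpret M: prob_space M by fact
  interpret P: prob_space ?P using \<eta> by (rule M.prob_space_distr)
  have Icc: "{0..t} \<in> sets L" for t
    unfolding sets_L by (auto simp: sets_restrict_space image_iff intro!: bexI[of _ "{0..t}"])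
  have C: "?C k \<in> sets L" for k unfolding sets_L by (rule dyadic_cell_sets)
  note ev = measurable_emeasure_point_pattern[OF C]
  have c: "?c \<in> measurable borel (count_space UNIV)" by measurable
  have evc: "(\<lambda>\<eta>. ?c (emeasure \<eta> (?C k))) \<in> measurable (point_pattern_algebra L) (count_space UNIV)" for k
    by (rule measurable_compose[OF ev c])
  have fin: "emeasure L (?C k) = ennreal (measure L (?C k))" if "1 \<le> k" for k
  proof -
    have "emeasure L (?C k) \<le> emeasure L {0..real k / 2 ^ n}"
      by (intro emeasure_mono dyadic_cell_subset that Icc)
    also have "\<dots> < \<infinity>" by (rule poisson_process_intensity_finite[OF X]) simp
    finally show ?thesis by (intro emeasure_eq_ennreal_measure) auto
  qed
  have AE: "AE \<omega> in M. dyadic_increments n (X \<omega>) = (\<lambda>k\<in>?I. ?c (emeasure (\<eta> \<omega>) (?C k)))"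
    using count AE_space
  proof eventually_elim
    case (elim \<omega>)
    have "\<eta> \<omega> \<in> point_patterns L"
      using measurable_space[OF \<eta> elim(2)] Icc[of 0] space_point_pattern_algebra[of L] by auto
    then have sets_\<eta>: "sets (\<eta> \<omega>) = sets L" by (simp add: point_patterns_def)
    have "increment n k (X \<omega>) = ?c (emeasure (\<eta> \<omega>) (?C k))" if k: "k \<in> ?I" for k
    proof (cases "k = 1")
      case True
      have "emeasure (\<eta> \<omega>) (?C 1) = of_nat (X \<omega> (1 / 2 ^ n))"
        unfolding dyadic_cell_1 using elim(1) by simp
      then show ?thesis by (simp add: True increment_def ennreal_of_nat_eq_real_of_nat del: One_nat_def)
    next
      case False
      with k obtain j where j: "k = Suc j" "1 \<le> j" by (cases k) auto
      \<comment> \<open>Counts on initial intervals are natural numbers, so they are finite and may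
        be subtracted.\<close>
      have of_nat: "emeasure (\<eta> \<omega>) {0..real i / 2 ^ n} = ennreal (real (X \<omega> (real i / 2 ^ n)))" for i
      proof -
        have "0 \<le> real i / 2 ^ n" by simp
        with elim(1) have "of_nat (X \<omega> (real i / 2 ^ n)) = emeasure (\<eta> \<omega>) {0..real i / 2 ^ n}" by blast
        then show ?thesis by (simp only: ennreal_of_nat_eq_real_of_nat)
      qed
      have le: "real j / 2 ^ n \<le> real (Suc j) / 2 ^ n" by (intro divide_right_mono) auto
      have "emeasure (\<eta> \<omega>) (?C (Suc j)) = emeasure (\<eta> \<omega>) {0..real (Suc j) / 2 ^ n} - emeasure (\<eta> \<omega>) {0..real j / 2 ^ n}"
        unfolding dyadic_cell_Suc[OF j(2)] using le Icc
        by (intro emeasure_Diff) (auto simp: sets_\<eta> of_nat simp del: of_nat_Suc)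
      also have "\<dots> = ennreal (real (X \<omega> (real (Suc j) / 2 ^ n)) - real (X \<omega> (real j / 2 ^ n)))"
        unfolding of_nat by (simp only: ennreal_minus of_nat_0_le_iff)
      also have "\<dots> = ennreal (real (increment n k (X \<omega>)))"
      proof -
        have "X \<omega> \<in> counting_paths" using measurable_space[OF Xm elim(2)] by (simp add: space_path_space)
        then have "X \<omega> (real j / 2 ^ n) \<le> X \<omega> (real (Suc j) / 2 ^ n)"
          by (rule counting_path_mono) (use le in simp_all)
        moreover have "increment n k (X \<omega>) = X \<omega> (real (Suc j) / 2 ^ n) - X \<omega> (real j / 2 ^ n)"
          using j by (simp add: increment_def)
        ultimately show ?thesis by (simp only: of_nat_diff)
      qed
      finally show ?thesis unfolding j(1)[symmetric] by simp
    qed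
    then show ?case unfolding dyadic_increments_def by (intro restrict_ext) auto
  qed
  have indep: "P.indep_vars (\<lambda>_. borel) (\<lambda>k \<eta>. emeasure \<eta> (?C k)) ?I"
  proof -
    have "\<forall>N\<ge>1. \<forall>B :: nat \<Rightarrow> real set. (\<forall>i\<in>{1..N}. B i \<in> sets L) \<longrightarrow> disjoint_family_on B {1..N} \<longrightarrow>
        P.indep_vars (\<lambda>_. borel) (\<lambda>i \<eta>. emeasure \<eta> (B i)) {1..N}"
      using P unfolding poisson_PP_distribution_def by (elim conjE)
    moreover have "1 \<le> Suc n * (2 :: nat) ^ n" by (simp add: Suc_le_eq)
    ultimately show ?thesis using C dyadic_cell_disjoint by blast
  qed
  have "distr (law M X) (increment_space n) (dyadic_increments n) =
      distr M (increment_space n) (\<lambda>\<omega>. dyadic_increments n (X \<omega>))"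
    unfolding law_def by (subst distr_distr[OF measurable_dyadic_increments Xm]) (simp only: comp_def)
  also have "\<dots> = distr M (increment_space n) (\<lambda>\<omega>. \<lambda>k\<in>?I. ?c (emeasure (\<eta> \<omega>) (?C k)))"
    by (intro distr_cong_AE AE measurable_restrict refl measurable_compose[OF Xm measurable_dyadic_increments]
        measurable_compose[OF \<eta> evc])
  also have "\<dots> = distr ?P (increment_space n) (\<lambda>\<eta>. \<lambda>k\<in>?I. ?c (emeasure \<eta> (?C k)))"
    by (subst distr_distr[OF measurable_restrict[OF evc] \<eta>]) (simp only: comp_def)
  also have "\<dots> = PiM ?I (\<lambda>k. distr ?P (count_space UNIV) (\<lambda>\<eta>. ?c (emeasure \<eta> (?C k))))"
  proof (rule P.indep_vars_iff_distr_eq_PiM'[THEN iffD1])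
    have "1 \<le> Suc n * (2 :: nat) ^ n" by (simp add: Suc_le_eq)
    then show "?I \<noteq> {}" by (metis atLeastAtMost_iff empty_iff order_refl)
    show "P.indep_vars (\<lambda>_. count_space UNIV) (\<lambda>k \<eta>. ?c (emeasure \<eta> (?C k))) ?I"
      by (rule P.indep_vars_compose2[OF indep, of "\<lambda>_. ?c"]) measurable
    show "(\<lambda>\<eta>. ?c (emeasure \<eta> (?C k))) \<in> measurable ?P (count_space UNIV)" for k
      unfolding measurable_distr_eq1 by (rule evc)
  qed
  also have "\<dots> = PiM ?I (\<lambda>k. poisson_law (measure L (?C k)))"
  proof (rule PiM_cong)
    fix k assume k: "k \<in> ?I"
    have "(\<lambda>\<eta>. emeasure \<eta> (?C k)) \<in> borel_measurable ?P"
      unfolding measurable_distr_eq1 by (rule ev)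
    then have "distr ?P (count_space UNIV) (\<lambda>\<eta>. ?c (emeasure \<eta> (?C k))) =
        distr (distr ?P borel (\<lambda>\<eta>. emeasure \<eta> (?C k))) (count_space UNIV) ?c"
      by (subst distr_distr[OF c]) (simp_all only: comp_def)
    also have "distr ?P borel (\<lambda>\<eta>. emeasure \<eta> (?C k)) = Poi (ennreal (measure L (?C k)))"
    proof -
      have "\<forall>B\<in>sets L. distr ?P borel (\<lambda>\<eta>. emeasure \<eta> B) = Poi (emeasure L B)"
        using P unfolding poisson_PP_distribution_def by (elim conjE)
      from bspec[OF this C[of k]] fin[of k] k show ?thesis by simp
    qed
    finally show "distr ?P (count_space UNIV) (\<lambda>\<eta>. ?c (emeasure \<eta> (?C k))) = poisson_law (measure L (?C k))"
      by (simp add: distr_Poi)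
  qed simp
  also have "\<dots> = density (increment_space n) (\<lambda>v. ennreal (\<Prod>k\<in>?I. poisson_mass (measure L (?C k)) (v k)))"
    by (rule PiM_poisson_law) auto
  finally show ?thesis .
qed

section \<open>Divergences between laws of Poisson processes\<close>

text \<open>Both measures are absolutely continuous with respect to their finite sum, which
  therefore yields Radon-Nikodym densities. This gives the existence that each \<open>THE\<close>
  requires.\<close>

lemma ex_common_densities:
  assumes P: "finite_measure P" and Q: "finite_measure Q" and sets: "sets Q = sets P"
  shows "\<exists>m p q. common_densities P Q m p q"
proof -
  interpret P: finite_measure P by fact
  interpret Q: finite_measure Q by fact
  define m where "m = measure_of (space P) (sets P) (\<lambda>A. emeasure P A + emeasure Q A)"
  have sets_m: "sets m = sets P" and space_m: "space m = space P"
    by (simp_all add: m_def sets.space_closed sets.sigma_sets_eq)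
  have em: "emeasure m A = emeasure P A + emeasure Q A" if "A \<in> sets P" for A
    unfolding m_def
  proof (rule emeasure_measure_of_sigma)
    show "sigma_algebra (space P) (sets P)" by (rule sets.sigma_algebra_axioms)
    show "positive (sets P) (\<lambda>A. emeasure P A + emeasure Q A)" by (simp add: positive_def)
    show "countably_additive (sets P) (\<lambda>A. emeasure P A + emeasure Q A)"
    proof (rule countably_additiveI)
      fix A :: "nat \<Rightarrow> 'a set" assume A: "range A \<subseteq> sets P" "disjoint_family A"
      have "(\<Sum>i. emeasure P (A i) + emeasure Q (A i)) = (\<Sum>i. emeasure P (A i)) + (\<Sum>i. emeasure Q (A i))"
        by (intro suminf_add[symmetric]) auto
      then show "(\<Sum>i. emeasure P (A i) + emeasure Q (A i)) = emeasure P (\<Union>i. A i) + emeasure Q (\<Union>i. A i)"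
        using A by (simp add: suminf_emeasure sets)
    qed
  qed (fact that)
  interpret m: finite_measure m
    by (rule finite_measureI)
      (unfold space_m em[OF sets.top], simp add: ennreal_add_eq_top P.emeasure_finite Q.emeasure_finite)
  have dens: "\<exists>D. D \<in> borel_measurable m \<and> (\<forall>x. 0 \<le> D x) \<and> R = density m (\<lambda>x. ennreal (D x))"
    if R: "finite_measure R" "sets R = sets m" "\<And>A. A \<in> sets m \<Longrightarrow> emeasure m A = 0 \<Longrightarrow> emeasure R A = 0"
    for R
  proof -
    have ac: "absolutely_continuous m R"
      using R by (auto simp: absolutely_continuous_def null_sets_def)
    from m.real_RN_deriv[OF R(1) ac R(2)] obtain D where D: "D \<in> borel_measurable m"
      "AE x in m. RN_deriv m R x = ennreal (D x)" "\<And>x. 0 \<le> D x" by blast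
    have "R = density m (RN_deriv m R)" by (rule m.density_RN_deriv[OF ac R(2), symmetric])
    also have "\<dots> = density m (\<lambda>x. ennreal (D x))"
      using D by (intro density_cong) auto
    finally show ?thesis using D by blast
  qed
  from dens[OF P] obtain p where p: "p \<in> borel_measurable m" "\<forall>x. 0 \<le> p x" "P = density m (\<lambda>x. ennreal (p x))"
    by (auto simp: sets_m em)
  from dens[OF Q] obtain q where q: "q \<in> borel_measurable m" "\<forall>x. 0 \<le> q x" "Q = density m (\<lambda>x. ennreal (q x))"
    by (auto simp: sets_m em sets)
  show ?thesis
    using p q m.sigma_finite_measure_axioms unfolding common_densities_def by blast
qed

locale poisson_pair = intensity_pair f g for f g :: "real \<Rightarrow> real" +
  fixes M :: "'u measure" and N :: "'v measure"
    and X :: "'u \<Rightarrow> real \<Rightarrow> nat" and Y :: "'v \<Rightarrow> real \<Rightarrow> nat"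
    and m :: "(real \<Rightarrow> nat) measure" and p q :: "(real \<Rightarrow> nat) \<Rightarrow> real"
  assumes X: "poisson_process M (intensity_measure f) X"
    and Y: "poisson_process N (intensity_measure g) Y"
    and dens: "common_densities (law M X) (law N Y) m p q"
begin

sublocale prob_X: prob_space "law M X" by (rule prob_space_law[OF X])
sublocale prob_Y: prob_space "law N Y" by (rule prob_space_law[OF Y])

sublocale laws: density_pair m "law M X" "law N Y" p q
  using dens prob_X.finite_measure_axioms prob_Y.finite_measure_axioms
  by unfold_locales (auto simp: common_densities_def finite_measure.emeasure_finite)

lemma sets_m: "sets m = sets path_space"
  using laws.sets_P by (simp add: law_def)

lemma space_m: "space m = counting_paths"
  using sets_eq_imp_space_eq[OF sets_m] by (simp add: space_path_space)

lemma density_pair_increments: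
  "density_pair (increment_space n) (distr (law M X) (increment_space n) (dyadic_increments n))
     (distr (law N Y) (increment_space n) (dyadic_increments n))
     (\<lambda>v. \<Prod>k\<in>{1..Suc n * 2 ^ n}. poisson_mass (cell_mass f n k) (v k))
     (\<lambda>v. \<Prod>k\<in>{1..Suc n * 2 ^ n}. poisson_mass (cell_mass g n k) (v k))"
proof (intro density_pair.intro)
  have S: "dyadic_increments n \<in> measurable (law M X) (increment_space n)"
    "dyadic_increments n \<in> measurable (law N Y) (increment_space n)"
    unfolding law_def measurable_distr_eq1 by (rule measurable_dyadic_increments)+
  show "finite_measure (distr (law M X) (increment_space n) (dyadic_increments n))"
    by (rule prob_X.finite_measure_distr[OF S(1)])
  show "finite_measure (distr (law N Y) (increment_space n) (dyadic_increments n))"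
    by (rule prob_Y.finite_measure_distr[OF S(2)])
  have meas: "(\<lambda>v. \<Prod>k\<in>{1..Suc n * 2 ^ n}. poisson_mass (c k) (v k)) \<in> borel_measurable (increment_space n)" for c
  proof (rule borel_measurable_prod)
    fix k assume "k \<in> {1..Suc n * 2 ^ n}"
    from measurable_component_singleton[where M="\<lambda>_. count_space UNIV", OF this]
    show "(\<lambda>v. poisson_mass (c k) (v k)) \<in> borel_measurable (increment_space n)"
      by (rule measurable_compose) simp
  qed
  show "(\<lambda>v. \<Prod>k\<in>{1..Suc n * 2 ^ n}. poisson_mass (cell_mass f n k) (v k)) \<in> borel_measurable (increment_space n)"
    "(\<lambda>v. \<Prod>k\<in>{1..Suc n * 2 ^ n}. poisson_mass (cell_mass g n k) (v k)) \<in> borel_measurable (increment_space n)"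
    by (rule meas)+
  show "distr (law M X) (increment_space n) (dyadic_increments n) = density (increment_space n)
      (\<lambda>v. ennreal (\<Prod>k\<in>{1..Suc n * 2 ^ n}. poisson_mass (cell_mass f n k) (v k)))"
    unfolding cell_mass_def by (rule distr_increments_law[OF X])
  show "distr (law N Y) (increment_space n) (dyadic_increments n) = density (increment_space n)
      (\<lambda>v. ennreal (\<Prod>k\<in>{1..Suc n * 2 ^ n}. poisson_mass (cell_mass g n k) (v k)))"
    unfolding cell_mass_def by (rule distr_increments_law[OF Y])
qed (intro prod_nonneg poisson_mass_nonneg cell_mass_nonneg)+

text \<open>The grid affinity \<open>A n\<close> is a function of the summed gaps of the cell
  masses, so its limit is known from the intensities. The grid gap \<open>D n\<close> tends to the
  gap of the laws. The relation between gap and affinity holds on each grid and for the laws, which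
  identifies the two limits.\<close>

lemma affinity:
  assumes \<alpha>: "0 < \<alpha>" "\<alpha> \<noteq> 1"
  shows "(\<integral>\<^sup>+x. power_product \<alpha> (p x) (q x) \<partial>m) = poisson_affinity \<alpha> (\<integral>\<^sup>+t. young_gap \<alpha> (f t) (g t) \<partial>lebesgue_Rplus)"
    (is "?A = ?B")
proof -
  define pn qn where "pn n v = (\<Prod>k\<in>{1..Suc n * 2 ^ n}. poisson_mass (cell_mass f n k) (v k))"
    and "qn n v = (\<Prod>k\<in>{1..Suc n * 2 ^ n}. poisson_mass (cell_mass g n k) (v k))" for n and v :: "nat \<Rightarrow> nat"
  define A where "A n = (\<integral>\<^sup>+v. power_product \<alpha> (pn n v) (qn n v) \<partial>increment_space n)" for n
  define D where "D n = (\<integral>\<^sup>+v. young_gap \<alpha> (pn n v) (qn n v) \<partial>increment_space n)" for n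
  note pair = density_pair_increments[folded pn_def qn_def]
  have S: "dyadic_increments n \<in> measurable m (increment_space n)" for n
    unfolding measurable_cong_sets[OF sets_m refl] by (rule measurable_dyadic_increments)
  have A_eq: "A n = poisson_affinity \<alpha> (\<Sum>k\<in>{1..Suc n * 2 ^ n}. young_gap \<alpha> (cell_mass f n k) (cell_mass g n k))" for n
    unfolding A_def pn_def qn_def by (rule poisson_product_affinity[OF \<alpha>]) (simp_all add: cell_mass_nonneg)
  have A_lim: "A \<longlonglongrightarrow> ?B"
    unfolding A_eq by (rule tendsto_poisson_affinity[OF sum_young_gap_tendsto[OF \<alpha>]])
  have D_lim: "D \<longlonglongrightarrow> (\<integral>\<^sup>+x. young_gap \<alpha> (p x) (q x) \<partial>m)"
    unfolding D_def
  proof (rule young_gap_convergence[where S=dyadic_increments and E=increment_space and m'=increment_space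
        and p'=pn and q'=qn and h="\<lambda>n v. \<lambda>k\<in>{1..Suc n * 2 ^ n}. v (2 * k - 1) + v (2 * k)", OF \<alpha> laws.density_pair_axioms S pair measurable_increments_refine])
    show "dyadic_increments n x = (\<lambda>k\<in>{1..Suc n * 2 ^ n}.
        dyadic_increments (Suc n) x (2 * k - 1) + dyadic_increments (Suc n) x (2 * k))" if "x \<in> space m" for n x
      using that unfolding space_m by (rule dyadic_increments_refine)
    show "sets m \<subseteq> sigma_sets (space m) (\<Union>n. {dyadic_increments n -` C \<inter> space m | C. C \<in> sets (increment_space n)})"
      unfolding sets_m space_m by (rule path_space_generated)
  qed
  have prob: "prob_space (distr (law M X) (increment_space n) (dyadic_increments n))"
    "prob_space (distr (law N Y) (increment_space n) (dyadic_increments n))" for n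
    using S[of n] by (auto intro!: prob_X.prob_space_distr prob_Y.prob_space_distr simp: measurable_cong_sets[OF laws.sets_P refl] measurable_cong_sets[OF laws.sets_Q refl])
  note n_level = density_pair.affinity_young_gap[OF pair \<alpha> prob, folded A_def D_def]
  note level = laws.affinity_young_gap[OF \<alpha> prob_X.prob_space_axioms prob_Y.prob_space_axioms]
  show ?thesis
  proof (cases "\<alpha> < 1")
    case True
    have "(\<lambda>n. A n + D n) \<longlonglongrightarrow> ?B + (\<integral>\<^sup>+x. young_gap \<alpha> (p x) (q x) \<partial>m)"
      by (intro tendsto_add A_lim D_lim)
    then have "?B + (\<integral>\<^sup>+x. young_gap \<alpha> (p x) (q x) \<partial>m) = 1"
      using n_level(1)[OF True] by (simp add: LIMSEQ_const_iff)
    with level(1)[OF True] have "(\<integral>\<^sup>+x. young_gap \<alpha> (p x) (q x) \<partial>m) + ?A = (\<integral>\<^sup>+x. young_gap \<alpha> (p x) (q x) \<partial>m) + ?B"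
      by (simp add: add.commute)
    \<comment> \<open>For \<open>\<alpha> < 1\<close> the gap of the laws is at most 1, so it may be
      cancelled in \<open>ennreal\<close>.\<close>
    moreover have "(\<integral>\<^sup>+x. young_gap \<alpha> (p x) (q x) \<partial>m) \<noteq> top"
      using level(1)[OF True] by auto
    ultimately show ?thesis by (simp add: ennreal_add_left_cancel)
  next
    case False
    then have "\<alpha> > 1" using \<alpha> by simp
    have "(\<lambda>n. D n + 1) \<longlonglongrightarrow> (\<integral>\<^sup>+x. young_gap \<alpha> (p x) (q x) \<partial>m) + 1"
      by (intro tendsto_add D_lim tendsto_const)
    then have "A \<longlonglongrightarrow> ?A"
      unfolding level(2)[OF \<open>\<alpha> > 1\<close>] n_level(2)[OF \<open>\<alpha> > 1\<close>, symmetric] .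
    with A_lim show ?thesis by (rule LIMSEQ_unique[rotated])
  qed
qed

lemma young_gap_laws:
  assumes "0 < \<alpha>" "\<alpha> < 1"
  shows "(\<integral>\<^sup>+x. young_gap \<alpha> (p x) (q x) \<partial>m) = ennreal (1 - exp_minus (\<integral>\<^sup>+t. young_gap \<alpha> (f t) (g t) \<partial>lebesgue_Rplus))"
    (is "?D = ennreal (1 - ?e)")
proof -
  have "ennreal ?e + ?D = 1"
    using laws.affinity_young_gap(1)[of \<alpha>] affinity[of \<alpha>] assms prob_X.prob_space_axioms prob_Y.prob_space_axioms
    by (simp add: poisson_affinity_def)
  also have "1 = ennreal ?e + ennreal (1 - ?e)"
    by (simp add: ennreal_plus[symmetric] del: ennreal_plus)
  finally show ?thesis by simp
qed

text \<open>At order 1/2 the squared difference of square roots is twice the Young gap, both for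
  \<open>p\<close>, \<open>q\<close> and for \<open>f\<close>, \<open>g\<close>; the two factors 1/2
  compensate for this.\<close>

lemma hellinger_laws:
  "sqrt (1 / 2 * (\<integral>x. (sqrt (p x) - sqrt (q x))\<^sup>2 \<partial>m)) = sqrt (1 - exp_minus (tsallis_half f g / 2))"
proof -
  have gap: "ennreal ((sqrt x - sqrt y)\<^sup>2) = 2 * young_gap (1 / 2) x y" if "0 \<le> x" "0 \<le> y" for x y
  proof -
    have "(sqrt x - sqrt y)\<^sup>2 = 2 * (x / 2 + y / 2 - sqrt x * sqrt y)"
      using that by (simp add: power2_diff)
    then have "ennreal ((sqrt x - sqrt y)\<^sup>2) = ennreal 2 * ennreal (x / 2 + y / 2 - sqrt x * sqrt y)"
      by (simp only: ennreal_mult' zero_le_numeral)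
    then show ?thesis
      using that by (simp add: young_gap_def powr_half_sqrt)
  qed
  have "tsallis_half f g = (\<integral>\<^sup>+t. 2 * young_gap (1 / 2) (f t) (g t) \<partial>lebesgue_Rplus)"
    unfolding tsallis_half_def by (intro nn_integral_cong gap) (auto simp: space_Rplus f_nonneg g_nonneg)
  also have "\<dots> = 2 * (\<integral>\<^sup>+t. young_gap (1 / 2) (f t) (g t) \<partial>lebesgue_Rplus)"
    by (rule nn_integral_cmult) measurable
  finally have T: "tsallis_half f g / 2 = (\<integral>\<^sup>+t. young_gap (1 / 2) (f t) (g t) \<partial>lebesgue_Rplus)"
    unfolding mult.commute[of 2] by (simp add: ennreal_mult_divide_eq)
  have "(\<integral>\<^sup>+x. ennreal ((sqrt (p x) - sqrt (q x))\<^sup>2) \<partial>m) = (\<integral>\<^sup>+x. 2 * young_gap (1 / 2) (p x) (q x) \<partial>m)"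
    by (intro nn_integral_cong gap) (auto simp: laws.p_nonneg laws.q_nonneg)
  also have "\<dots> = 2 * ennreal (1 - exp_minus (tsallis_half f g / 2))"
    unfolding T by (subst nn_integral_cmult) (auto simp: young_gap_laws)
  also have "\<dots> = ennreal (2 * (1 - exp_minus (tsallis_half f g / 2)))"
    by (simp only: ennreal_mult' zero_le_numeral ennreal_numeral)
  finally have "(\<integral>x. (sqrt (p x) - sqrt (q x))\<^sup>2 \<partial>m) = 2 * (1 - exp_minus (tsallis_half f g / 2))"
    by (subst integral_eq_nn_integral) (auto simp: enn2real_ennreal)
  then show ?thesis by simp
qed

end

section \<open>Extended-real integrands, and the limit of orders towards 1\<close>

lemma ereal_integral_enn2ereal:
  assumes "\<And>x. x \<in> space m \<Longrightarrow> \<phi> x = enn2ereal (h x)"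
  shows "ereal_integral m \<phi> = enn2ereal (\<integral>\<^sup>+x. h x \<partial>m)"
proof -
  have "(\<integral>\<^sup>+x. e2ennreal (\<phi> x) \<partial>m) = (\<integral>\<^sup>+x. h x \<partial>m)"
    by (intro nn_integral_cong) (simp add: assms)
  moreover have "(\<integral>\<^sup>+x. e2ennreal (- \<phi> x) \<partial>m) = (\<integral>\<^sup>+x. 0 \<partial>m)"
    by (intro nn_integral_cong) (simp add: assms e2ennreal_neg)
  ultimately show ?thesis by (simp add: ereal_integral_def zero_ennreal.rep_eq)
qed

text \<open>The sign of \<open>1 - \<alpha>\<close> cancels against the one in
  \<open>young_gap\<close>, so the integrand is nonnegative, with the value infinity where
  \<open>\<alpha> > 1\<close> and \<open>y = 0 < x\<close>.\<close>

lemma renyi_integrand: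
  assumes "0 \<le> \<alpha>" "\<alpha> \<noteq> 1" "0 \<le> x" "0 \<le> y"
  shows "(ereal (\<alpha> * x + (1 - \<alpha>) * y) - enn2ereal (power_product \<alpha> x y)) / ereal (1 - \<alpha>)
    = enn2ereal (ennreal (1 / \<bar>1 - \<alpha>\<bar>) * young_gap \<alpha> x y)"
proof (cases "\<alpha> > 1 \<and> x \<noteq> 0 \<and> y = 0")
  case True
  then have "1 / \<bar>1 - \<alpha>\<bar> > 0" by simp
  with True assms show ?thesis
    by (simp add: power_product_infinite young_gap_def ennreal_mult_top divide_ereal_def)
next
  case False
  let ?w = "x powr \<alpha> * y powr (1 - \<alpha>)"
  have nonneg: "0 \<le> sgn (1 - \<alpha>) * (\<alpha> * x + (1 - \<alpha>) * y - ?w)"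
  \<comment> \<open>Young's inequality above is stated for positive orders; at order 0 the
    expression is \<open>y\<close> or 0.\<close>
  proof (cases "\<alpha> = 0")
    case True
    then show ?thesis using assms by (cases "x = 0") auto
  qed (use young_gap_real_nonneg[OF _ _ _ _ False] assms in auto)
  have "(ereal (\<alpha> * x + (1 - \<alpha>) * y) - enn2ereal (power_product \<alpha> x y)) / ereal (1 - \<alpha>)
      = ereal ((\<alpha> * x + (1 - \<alpha>) * y - ?w) / (1 - \<alpha>))"
    using assms False by (subst power_product_eq) (auto simp: enn2ereal_ennreal)
  also have "(\<alpha> * x + (1 - \<alpha>) * y - ?w) / (1 - \<alpha>) = 1 / \<bar>1 - \<alpha>\<bar> * (sgn (1 - \<alpha>) * (\<alpha> * x + (1 - \<alpha>) * y - ?w))"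
    using assms by (auto simp: sgn_if field_simps)
  also have "ereal \<dots> = enn2ereal (ennreal (1 / \<bar>1 - \<alpha>\<bar>) * young_gap \<alpha> x y)"
    unfolding young_gap_def if_not_P[OF False] using nonneg
    by (subst ennreal_mult[symmetric]) (auto simp: enn2ereal_ennreal)
  finally show ?thesis .
qed

text \<open>The logarithm is \<open>-T\<close> below order 1 and \<open>T\<close> above it, and the
  prefactor changes sign with it.\<close>

lemma ext_log_poisson_affinity:
  assumes "\<alpha> \<noteq> 1"
  shows "ereal (1 / (\<alpha> - 1)) * ext_log (poisson_affinity \<alpha> T) = enn2ereal (ennreal (1 / \<bar>1 - \<alpha>\<bar>) * T)"
proof (cases T)
  case (real r)
  have "ext_log (poisson_affinity \<alpha> T) = ereal (if \<alpha> < 1 then - r else r)"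
    using real by (auto simp: poisson_affinity_def ext_log_def inverse_ennreal exp_minus[symmetric])
  moreover have "enn2ereal (ennreal (1 / \<bar>1 - \<alpha>\<bar>) * T) = ereal (1 / \<bar>1 - \<alpha>\<bar> * r)"
    using real by (subst real(2), subst ennreal_mult[symmetric]) (auto simp: enn2ereal_ennreal)
  ultimately show ?thesis using assms by (auto simp: field_simps)
next
  case top
  then have "ext_log (poisson_affinity \<alpha> T) = (if \<alpha> < 1 then - \<infinity> else \<infinity>)"
    by (auto simp: poisson_affinity_def ext_log_def exp_minus_def)
  moreover have "1 / \<bar>1 - \<alpha>\<bar> > 0" using assms by simp
  ultimately show ?thesis using assms top
    by (auto simp: ennreal_mult_top ennreal_eq_0_iff)
qed

text \<open>The normalized Young gaps \<open>young_gap \<alpha> / (1 - \<alpha>)\<close> increase to \<open>kl_gap\<close> along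
  \<open>1 - \<alpha> = 2\<^sup>-\<^sup>j\<close>.\<close>

definition kl_gap :: "real \<Rightarrow> real \<Rightarrow> ennreal" where
  "kl_gap x y = e2ennreal (x_log_ratio x y + ereal (y - x))"

text \<open>This is \<open>ln z \<le> z - 1\<close> at \<open>z = y / x\<close>, multiplied by
  \<open>x\<close>.\<close>

lemma x_log_ratio_nonneg:
  assumes "0 \<le> x" "0 \<le> y"
  shows "0 \<le> x_log_ratio x y + ereal (y - x)"
proof (cases "x = 0 \<or> y = 0")
  case True
  then show ?thesis using assms by (auto simp: x_log_ratio_def)
next
  case False
  then have xy: "0 < x" "0 < y" using assms by auto
  have "ln (y / x) \<le> y / x - 1" using xy by (intro ln_le_minus_one) auto
  then have "x * ln (y / x) \<le> x * (y / x - 1)" using xy by (intro mult_left_mono) auto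
  then have "0 \<le> x * ln (x / y) + (y - x)" using xy by (simp add: ln_div algebra_simps)
  then show ?thesis using xy by (simp add: x_log_ratio_def)
qed

text \<open>\<open>x^(1-s/2) y^(s/2)\<close> is the geometric mean of \<open>x\<close> and
  \<open>x^(1-s) y^s\<close>, hence at most their arithmetic mean. In effect, the gap divided by
  \<open>s\<close> does not decrease when \<open>s\<close> is halved.\<close>

lemma young_gap_half:
  assumes "0 < s" "s < 1" "0 \<le> x" "0 \<le> y"
  shows "young_gap (1 - s) x y \<le> 2 * young_gap (1 - s / 2) x y"
proof -
  let ?w = "x powr (1 - s) * y powr s" and ?v = "x powr (1 - s / 2) * y powr (s / 2)"
  have "?v = sqrt (x * ?w)"
  proof (rule real_sqrt_unique[symmetric])
    have "(x powr (1 - s / 2))\<^sup>2 = x * x powr (1 - s)"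
      using assms by (cases "x = 0") (simp_all add: power2_eq_square powr_add[symmetric] powr_mult_base)
    moreover have "(y powr (s / 2))\<^sup>2 = y powr s"
      using assms by (simp add: power2_eq_square powr_add[symmetric])
    ultimately show "?v\<^sup>2 = x * ?w" by (simp add: power_mult_distrib)
  qed (use assms in simp)
  also have "\<dots> \<le> (x + ?w) / 2" using assms by (intro arith_geo_mean_sqrt) auto
  finally have "(1 - s) * x + s * y - ?w \<le> 2 * ((1 - s / 2) * x + s / 2 * y - ?v)"
    by (simp add: algebra_simps)
  then have "ennreal ((1 - s) * x + s * y - ?w) \<le> ennreal 2 * ennreal ((1 - s / 2) * x + s / 2 * y - ?v)"
    by (subst ennreal_mult'[symmetric]) (auto intro: ennreal_leI)
  then show ?thesis
    using assms by (simp add: young_gap_def)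
qed

text \<open>The Kittaneh--Manasrah refinement of Young's inequality.\<close>

lemma young_gap_le_hellinger:
  assumes \<alpha>: "0 < \<alpha>" "\<alpha> \<le> 1 / 2" and xy: "0 \<le> x" "0 \<le> y"
  shows "young_gap \<alpha> x y \<le> ennreal ((sqrt x - sqrt y)\<^sup>2)"
proof -
  have "\<alpha> * x + (1 - \<alpha>) * y - x powr \<alpha> * y powr (1 - \<alpha>) \<le> (1 - \<alpha>) * (sqrt x - sqrt y)\<^sup>2"
  proof (cases "x = 0 \<or> y = 0")
    case True
    moreover have "\<alpha> * x \<le> (1 - \<alpha>) * x" using \<alpha> xy by (intro mult_right_mono) auto
    ultimately show ?thesis using xy by auto
  next
    case False
    then have xy: "0 < x" "0 < y" using xy by auto
    \<comment> \<open>\<open>sqrt x * sqrt y\<close> is written as \<open>x^a * w^b\<close> with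
      \<open>a + b = 1\<close>. The exponent of \<open>y\<close> forces
      \<open>b = 1 / (2 (1 - \<alpha>))\<close>, and \<open>\<alpha> \<le> 1/2\<close> makes
      \<open>a\<close> nonnegative.\<close>
    let ?w = "x powr \<alpha> * y powr (1 - \<alpha>)" and ?a = "(1 - 2 * \<alpha>) / (2 * (1 - \<alpha>))" and ?b = "1 / (2 * (1 - \<alpha>))"
    have c: "0 < 1 - \<alpha>" using \<alpha> by simp
    then have ab: "0 \<le> ?a" "0 \<le> ?b" "?a + ?b = 1"
      using \<alpha> by (simp_all add: add_divide_distrib[symmetric])
    have "x powr ?a * ?w powr ?b \<le> ?a * x + ?b * ?w"
      using ab xy by (intro Youngs_inequality_0) auto
    moreover have "x powr ?a * ?w powr ?b = sqrt x * sqrt y"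
    proof -
      have "?a + \<alpha> * ?b = (1 - \<alpha>) / (2 * (1 - \<alpha>))" by (simp add: add_divide_distrib[symmetric])
      with c have e: "?a + \<alpha> * ?b = 1 / 2" "(1 - \<alpha>) * ?b = 1 / 2" by simp_all
      have "x powr a * ?w powr b = x powr (a + \<alpha> * b) * y powr ((1 - \<alpha>) * b)" for a b
        using xy by (simp add: powr_mult powr_powr powr_add)
      then show ?thesis
        using xy by (simp only: e powr_half_sqrt less_imp_le)
    qed
    ultimately have "2 * (1 - \<alpha>) * (sqrt x * sqrt y) \<le> 2 * (1 - \<alpha>) * (?a * x + ?b * ?w)"
      using \<alpha> by (intro mult_left_mono) auto
    also have "\<dots> = (1 - 2 * \<alpha>) * x + ?w"
    proof -
      have "k * (u / k * x + 1 / k * w) = u * x + w" if "k \<noteq> 0" for k u w :: real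
        using that by (simp add: distrib_left)
      then show ?thesis using c by simp
    qed
    finally show ?thesis using xy by (simp add: power2_diff algebra_simps)
  qed
  also have "\<dots> \<le> (sqrt x - sqrt y)\<^sup>2" using \<alpha> by (intro mult_left_le_one_le) auto
  finally show ?thesis using \<alpha> by (simp add: young_gap_def ennreal_leI)
qed

lemma scaled_young_gap_incseq:
  assumes "0 \<le> x" "0 \<le> y"
  shows "incseq (\<lambda>j. ennreal (2 ^ Suc j) * young_gap (1 - 1 / 2 ^ Suc j) x y)"
proof (rule incseq_SucI)
  fix j
  have "young_gap (1 - 1 / 2 ^ Suc j) x y \<le> 2 * young_gap (1 - (1 / 2 ^ Suc j) / 2) x y"
    by (rule young_gap_half) (use assms power_gt1[of "2::real" j] in auto)
  then have "ennreal (2 ^ Suc j) * young_gap (1 - 1 / 2 ^ Suc j) x y \<le>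
      ennreal (2 ^ Suc j) * (2 * young_gap (1 - 1 / 2 ^ Suc (Suc j)) x y)"
    by (intro mult_left_mono) (simp_all add: mult.commute)
  also have "\<dots> = ennreal (2 ^ Suc (Suc j)) * young_gap (1 - 1 / 2 ^ Suc (Suc j)) x y"
  proof -
    have "ennreal (2 ^ Suc j) * 2 = ennreal (2 ^ Suc (Suc j))"
      using ennreal_mult'[of "2 ^ Suc j" 2] by (simp add: mult.commute)
    then show ?thesis by (simp only: mult.assoc[symmetric])
  qed
  finally show "ennreal (2 ^ Suc j) * young_gap (1 - 1 / 2 ^ Suc j) x y \<le>
    ennreal (2 ^ Suc (Suc j)) * young_gap (1 - 1 / 2 ^ Suc (Suc j)) x y" .
qed

text \<open>With \<open>s = 2^-(j+1)\<close> and \<open>r = y / x\<close>, homogeneity reduces the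
  limit to that of \<open>(1 - r^s) / s\<close>, which is \<open>- ln r\<close>. For
  \<open>y = 0 < x\<close> the power term vanishes and the values diverge.\<close>

lemma scaled_young_gap_SUP:
  assumes "0 \<le> x" "0 \<le> y"
  shows "(SUP j. ennreal (2 ^ Suc j) * young_gap (1 - 1 / 2 ^ Suc j) x y) = kl_gap x y"
proof (rule LIMSEQ_unique[OF LIMSEQ_SUP[OF scaled_young_gap_incseq[OF assms]]])
  have eq: "ennreal (2 ^ Suc j) * young_gap (1 - 1 / 2 ^ Suc j) x y =
      ennreal (2 ^ Suc j * ((1 - 1 / 2 ^ Suc j) * x + 1 / 2 ^ Suc j * y - x powr (1 - 1 / 2 ^ Suc j) * y powr (1 / 2 ^ Suc j)))" for j
    by (simp add: young_gap_def ennreal_mult' del: power_Suc)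
  consider "x = 0" | "0 < x" "y = 0" | "0 < x" "0 < y" using assms by fastforce
  then show "(\<lambda>j. ennreal (2 ^ Suc j) * young_gap (1 - 1 / 2 ^ Suc j) x y) \<longlonglongrightarrow> kl_gap x y"
    unfolding eq
  proof cases
    case 1
    then show "(\<lambda>j. ennreal (2 ^ Suc j * ((1 - 1 / 2 ^ Suc j) * x + 1 / 2 ^ Suc j * y - x powr (1 - 1 / 2 ^ Suc j) * y powr (1 / 2 ^ Suc j)))) \<longlonglongrightarrow> kl_gap x y"
      by (simp add: kl_gap_def x_log_ratio_def)
  next
    case 2
    have eq2: "2 ^ Suc j * ((1 - 1 / 2 ^ Suc j) * x) = x * (2 ^ Suc j - 1)" for j
      by (simp add: field_simps)
    have "filterlim (\<lambda>j. 2 ^ Suc j * ((1 - 1 / 2 ^ Suc j) * x)) at_top sequentially"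
      unfolding eq2 using 2 by real_asymp
    then show "(\<lambda>j. ennreal (2 ^ Suc j * ((1 - 1 / 2 ^ Suc j) * x + 1 / 2 ^ Suc j * y - x powr (1 - 1 / 2 ^ Suc j) * y powr (1 / 2 ^ Suc j)))) \<longlonglongrightarrow> kl_gap x y"
      using 2 by (simp add: kl_gap_def x_log_ratio_def ennreal_tendsto_top_eq_at_top del: power_Suc)
  next
    case 3
    define r where "r = y / x"
    have r: "0 < r" "y = x * r" using 3 by (simp_all add: r_def)
    have "(\<lambda>j. 2 ^ Suc j * (1 - r powr (1 / 2 ^ Suc j))) \<longlonglongrightarrow> - ln r"
      using r(1) by real_asymp
    then have "(\<lambda>j. x * (r - 1 + 2 ^ Suc j * (1 - r powr (1 / 2 ^ Suc j)))) \<longlonglongrightarrow> x * (r - 1 + - ln r)"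
      by (intro tendsto_intros)
    moreover have "2 ^ Suc j * ((1 - 1 / 2 ^ Suc j) * x + 1 / 2 ^ Suc j * y - x powr (1 - 1 / 2 ^ Suc j) * y powr (1 / 2 ^ Suc j))
        = x * (r - 1 + 2 ^ Suc j * (1 - r powr (1 / 2 ^ Suc j)))" for j
    proof -
      have "x powr (1 - 1 / 2 ^ Suc j) * y powr (1 / 2 ^ Suc j) = x * r powr (1 / 2 ^ Suc j)"
        using 3 r by (simp add: powr_mult powr_diff)
      then show ?thesis using r(2) by (simp add: field_simps)
    qed
    moreover have "kl_gap x y = ennreal (x * (r - 1 + - ln r))"
      using 3 r by (simp add: kl_gap_def x_log_ratio_def ln_div ln_mult algebra_simps)
    ultimately show "(\<lambda>j. ennreal (2 ^ Suc j * ((1 - 1 / 2 ^ Suc j) * x + 1 / 2 ^ Suc j * y - x powr (1 - 1 / 2 ^ Suc j) * y powr (1 / 2 ^ Suc j)))) \<longlonglongrightarrow> kl_gap x y"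
      by (simp only: tendsto_ennrealI)
  qed
qed

text \<open>Monotone convergence along the halved distances to order 1. The upper bound is kept as
  input for \<open>scaled_exp_minus_tendsto\<close>.\<close>

lemma nn_integral_kl_gap:
  assumes [measurable]: "p \<in> borel_measurable m" "q \<in> borel_measurable m"
    and nonneg: "\<And>x. x \<in> space m \<Longrightarrow> 0 \<le> p x" "\<And>x. x \<in> space m \<Longrightarrow> 0 \<le> q x"
  shows "(\<lambda>j. ennreal (2 ^ Suc j) * (\<integral>\<^sup>+x. young_gap (1 - 1 / 2 ^ Suc j) (p x) (q x) \<partial>m)) \<longlonglongrightarrow> (\<integral>\<^sup>+x. kl_gap (p x) (q x) \<partial>m)"
    and "ennreal (2 ^ Suc j) * (\<integral>\<^sup>+x. young_gap (1 - 1 / 2 ^ Suc j) (p x) (q x) \<partial>m) \<le> (\<integral>\<^sup>+x. kl_gap (p x) (q x) \<partial>m)"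
proof -
  let ?u = "\<lambda>j x. ennreal (2 ^ Suc j) * young_gap (1 - 1 / 2 ^ Suc j) (p x) (q x)"
  have cmult: "ennreal (2 ^ Suc j) * (\<integral>\<^sup>+x. young_gap (1 - 1 / 2 ^ Suc j) (p x) (q x) \<partial>m) = (\<integral>\<^sup>+x. ?u j x \<partial>m)" for j
    by (rule nn_integral_cmult[symmetric]) measurable
  have "(\<integral>\<^sup>+x. kl_gap (p x) (q x) \<partial>m) = (\<integral>\<^sup>+x. (SUP j. ?u j x) \<partial>m)"
    by (intro nn_integral_cong scaled_young_gap_SUP[symmetric] nonneg)
  also have "\<dots> = (SUP j. \<integral>\<^sup>+x. ?u j x \<partial>m)"
  proof (rule nn_integral_monotone_convergence_SUP_AE)
    show "AE x in m. ?u j x \<le> ?u (Suc j) x" for j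
      by (intro AE_I2 incseq_SucD[OF scaled_young_gap_incseq] nonneg)
  qed measurable
  finally have SUP: "(\<integral>\<^sup>+x. kl_gap (p x) (q x) \<partial>m) = (SUP j. \<integral>\<^sup>+x. ?u j x \<partial>m)" .
  have inc: "incseq (\<lambda>j. \<integral>\<^sup>+x. ?u j x \<partial>m)"
    by (intro incseq_SucI nn_integral_mono incseq_SucD[OF scaled_young_gap_incseq] nonneg)
  show "(\<lambda>j. ennreal (2 ^ Suc j) * (\<integral>\<^sup>+x. young_gap (1 - 1 / 2 ^ Suc j) (p x) (q x) \<partial>m)) \<longlonglongrightarrow> (\<integral>\<^sup>+x. kl_gap (p x) (q x) \<partial>m)"
    unfolding cmult SUP by (rule LIMSEQ_SUP[OF inc])
  show "ennreal (2 ^ Suc j) * (\<integral>\<^sup>+x. young_gap (1 - 1 / 2 ^ Suc j) (p x) (q x) \<partial>m) \<le> (\<integral>\<^sup>+x. kl_gap (p x) (q x) \<partial>m)"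
    unfolding cmult SUP by (rule SUP_upper) simp
qed

text \<open>\<open>1 - e^-u\<close> is at most \<open>u\<close> and agrees with it to first order at
  0. Since \<open>t\<close> and \<open>T j\<close> may be infinite, the lower bound compares
  \<open>T j\<close> with \<open>K / 2^(j+1)\<close> for a finite level \<open>K\<close> below
  \<open>t\<close>.\<close>

lemma scaled_exp_minus_tendsto:
  assumes lim: "(\<lambda>j. ennreal (2 ^ Suc j) * T j) \<longlonglongrightarrow> t" and le: "\<And>j. ennreal (2 ^ Suc j) * T j \<le> t"
  shows "(\<lambda>j. ennreal (2 ^ Suc j) * ennreal (1 - exp_minus (T j))) \<longlonglongrightarrow> t"
proof (rule order_tendstoI)
  fix c assume c: "t < c"
  have "ennreal (1 - exp_minus a) \<le> a" for a
  proof (cases a)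
    case (real r)
    have "1 - exp (- r) \<le> r" using exp_ge_add_one_self[of "- r"] by linarith
    with real show ?thesis by (simp add: ennreal_leI)
  qed simp
  then have "ennreal (2 ^ Suc j) * ennreal (1 - exp_minus (T j)) \<le> t" for j
    by (intro order_trans[OF mult_left_mono le]) auto
  then show "\<forall>\<^sub>F j in sequentially. ennreal (2 ^ Suc j) * ennreal (1 - exp_minus (T j)) < c"
    using le_less_trans[OF _ c] by (intro always_eventually allI) blast
next
  fix c assume "c < t"
  then obtain d where d: "c < d" "d < t" using dense by blast
  then obtain K where K: "d = ennreal K" "0 \<le> K" by (cases d) auto
  have "(\<lambda>j. 2 ^ Suc j * (1 - exp (- (K / 2 ^ Suc j)))) \<longlonglongrightarrow> K"
    by real_asymp
  then have "(\<lambda>j. ennreal (2 ^ Suc j * (1 - exp (- (K / 2 ^ Suc j))))) \<longlonglongrightarrow> d"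
    unfolding K(1) by (rule tendsto_ennrealI)
  from order_tendstoD(1)[OF this d(1)] order_tendstoD(1)[OF lim d(2)]
  show "\<forall>\<^sub>F j in sequentially. c < ennreal (2 ^ Suc j) * ennreal (1 - exp_minus (T j))"
  proof eventually_elim
    case (elim j)
    have "exp_minus (T j) \<le> exp (- (K / 2 ^ Suc j))"
    proof (cases "T j")
      case (real r)
      with elim(2) K have "K < 2 ^ Suc j * r"
        by (simp add: ennreal_mult'[symmetric] ennreal_less_iff del: power_Suc)
      then have "K / 2 ^ Suc j \<le> r" by (simp add: field_simps del: power_Suc)
      with real show ?thesis by simp
    qed (simp add: exp_minus_def)
    then have "ennreal (2 ^ Suc j * (1 - exp (- (K / 2 ^ Suc j)))) \<le> ennreal (2 ^ Suc j * (1 - exp_minus (T j)))"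
      by (intro ennreal_leI mult_left_mono) auto
    with elim(1) show ?case by (simp add: ennreal_mult' del: power_Suc)
  qed
qed

text \<open>The terms \<open>q - p\<close> in \<open>kl_gap\<close> contribute nothing because both
  masses are 1. The negative part of \<open>p log (p/q)\<close> is at most \<open>q\<close>, so it
  has a finite integral and the two parts may be subtracted.\<close>

lemma (in density_pair) ereal_integral_x_log_ratio:
  assumes "prob_space P" "prob_space Q"
  shows "ereal_integral m (\<lambda>x. x_log_ratio (p x) (q x)) = enn2ereal (\<integral>\<^sup>+x. kl_gap (p x) (q x) \<partial>m)"
proof -
  define pos where "pos x = e2ennreal (x_log_ratio (p x) (q x))" for x
  define neg where "neg x = e2ennreal (- x_log_ratio (p x) (q x))" for x
  have [measurable]: "(\<lambda>x. x_log_ratio (p x) (q x)) \<in> borel_measurable m"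
    unfolding x_log_ratio_def by measurable
  have [measurable]: "pos \<in> borel_measurable m" "neg \<in> borel_measurable m" "(\<lambda>x. kl_gap (p x) (q x)) \<in> borel_measurable m"
    unfolding pos_def neg_def kl_gap_def by measurable
  \<comment> \<open>The identity \<open>pos - neg = kl_gap + p - q\<close>, rearranged into sums
    because the terms live in \<open>ennreal\<close>.\<close>
  have eq: "pos x + ennreal (q x) = kl_gap (p x) (q x) + ennreal (p x) + neg x" and le: "neg x \<le> ennreal (q x)"
    if "x \<in> space m" for x
  proof -
    have nonneg: "0 \<le> p x" "0 \<le> q x" using that by (auto simp: p_nonneg q_nonneg)
    show "pos x + ennreal (q x) = kl_gap (p x) (q x) + ennreal (p x) + neg x" "neg x \<le> ennreal (q x)"
    proof (atomize (full), cases "x_log_ratio (p x) (q x)")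
      case (real l)
      from x_log_ratio_nonneg[OF nonneg] have l: "0 \<le> l + (q x - p x)"
        unfolding real by (simp only: plus_ereal.simps zero_ereal_def ereal_less_eq)
      have *: "pos x = ennreal l" "neg x = ennreal (- l)" "kl_gap (p x) (q x) = ennreal (l + (q x - p x))"
        unfolding pos_def neg_def kl_gap_def real by simp_all
      show "pos x + ennreal (q x) = kl_gap (p x) (q x) + ennreal (p x) + neg x \<and> neg x \<le> ennreal (q x)"
      proof (cases "0 \<le> l")
        case True
        then have "ennreal l + ennreal (q x) = ennreal (l + (q x - p x)) + ennreal (p x)"
          using l nonneg by (subst (1 2) ennreal_plus[symmetric]) auto
        with True show ?thesis unfolding * by (simp add: ennreal_neg)
      next
        case False
        have "ennreal (l + (q x - p x)) + ennreal (p x) = ennreal (l + q x)"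
          using l nonneg by (subst ennreal_plus[symmetric]) auto
        moreover have "ennreal (l + q x) + ennreal (- l) = ennreal (q x)"
          using False l nonneg by (subst ennreal_plus[symmetric]) auto
        ultimately have "ennreal (q x) = ennreal (l + (q x - p x)) + ennreal (p x) + ennreal (- l)"
          by simp
        with False l nonneg show ?thesis unfolding * by (simp add: ennreal_neg ennreal_leI)
      qed
    next
      case PInf
      then show "pos x + ennreal (q x) = kl_gap (p x) (q x) + ennreal (p x) + neg x \<and> neg x \<le> ennreal (q x)"
        by (simp add: pos_def neg_def kl_gap_def e2ennreal_neg)
    next
      case MInf
      then show "pos x + ennreal (q x) = kl_gap (p x) (q x) + ennreal (p x) + neg x \<and> neg x \<le> ennreal (q x)"
        using x_log_ratio_nonneg[OF nonneg] by simp
    qed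
  qed
  have p1: "(\<integral>\<^sup>+x. ennreal (p x) \<partial>m) = 1" and q1: "(\<integral>\<^sup>+x. ennreal (q x) \<partial>m) = 1"
    using assms[THEN prob_space.emeasure_space_1] nn_integral_p nn_integral_q by simp_all
  have "(\<integral>\<^sup>+x. neg x \<partial>m) \<le> (\<integral>\<^sup>+x. ennreal (q x) \<partial>m)" by (intro nn_integral_mono le)
  then have fin: "(\<integral>\<^sup>+x. neg x \<partial>m) \<noteq> top" using q1 by (auto simp: top_unique)
  have "(\<integral>\<^sup>+x. pos x \<partial>m) + 1 = (\<integral>\<^sup>+x. pos x + ennreal (q x) \<partial>m)"
    by (simp add: nn_integral_add q1)
  also have "\<dots> = (\<integral>\<^sup>+x. kl_gap (p x) (q x) + ennreal (p x) + neg x \<partial>m)"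
    by (intro nn_integral_cong eq)
  also have "\<dots> = (\<integral>\<^sup>+x. kl_gap (p x) (q x) \<partial>m) + (\<integral>\<^sup>+x. neg x \<partial>m) + 1"
    by (simp add: nn_integral_add p1 ac_simps)
  finally have "1 + (\<integral>\<^sup>+x. pos x \<partial>m) = 1 + ((\<integral>\<^sup>+x. kl_gap (p x) (q x) \<partial>m) + (\<integral>\<^sup>+x. neg x \<partial>m))"
    by (simp add: add.commute)
  then have "(\<integral>\<^sup>+x. pos x \<partial>m) = (\<integral>\<^sup>+x. kl_gap (p x) (q x) \<partial>m) + (\<integral>\<^sup>+x. neg x \<partial>m)"
    by (simp add: ennreal_add_left_cancel)
  then have "ereal_integral m (\<lambda>x. x_log_ratio (p x) (q x)) =
      enn2ereal (\<integral>\<^sup>+x. kl_gap (p x) (q x) \<partial>m) + enn2ereal (\<integral>\<^sup>+x. neg x \<partial>m) - enn2ereal (\<integral>\<^sup>+x. neg x \<partial>m)"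
    by (simp add: ereal_integral_def pos_def neg_def plus_ennreal.rep_eq)
  also have "\<dots> = enn2ereal (\<integral>\<^sup>+x. kl_gap (p x) (q x) \<partial>m)"
  proof -
    obtain r where r: "0 \<le> r" "(\<integral>\<^sup>+x. neg x \<partial>m) = ennreal r" using fin by (cases "\<integral>\<^sup>+x. neg x \<partial>m") auto
    then have "enn2ereal (\<integral>\<^sup>+x. neg x \<partial>m) = ereal r" by (simp add: enn2ereal_ennreal)
    then show ?thesis
      by (cases "enn2ereal (\<integral>\<^sup>+x. kl_gap (p x) (q x) \<partial>m)") auto
  qed
  finally show ?thesis .
qed

section \<open>Kullback-Leibler divergence and the order zero\<close>

context poisson_pair
begin

text \<open>At order \<open>1 - 2^-(j+1)\<close> the gap of the laws is \<open>1 - e^-T\<close>,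
  where \<open>T\<close> is the gap of the intensities. After scaling by \<open>2^(j+1)\<close> the
  exponential drops out in the limit, leaving the integral of \<open>kl_gap\<close> on either
  side.\<close>

lemma KL_laws:
  "ereal_integral m (\<lambda>x. x_log_ratio (p x) (q x)) =
    ereal_integral lebesgue_Rplus (\<lambda>t. x_log_ratio (f t) (g t) + ereal (g t - f t))"
proof -
  let ?T = "\<lambda>j. \<integral>\<^sup>+t. young_gap (1 - 1 / 2 ^ Suc j) (f t) (g t) \<partial>lebesgue_Rplus"
  have fg: "f \<in> borel_measurable lebesgue_Rplus" "g \<in> borel_measurable lebesgue_Rplus"
    "\<And>t. t \<in> space lebesgue_Rplus \<Longrightarrow> 0 \<le> f t" "\<And>t. t \<in> space lebesgue_Rplus \<Longrightarrow> 0 \<le> g t"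
    by (auto simp: space_Rplus f_nonneg g_nonneg)
  have gap: "(\<integral>\<^sup>+x. young_gap (1 - 1 / 2 ^ Suc j) (p x) (q x) \<partial>m) = ennreal (1 - exp_minus (?T j))" for j
    by (rule young_gap_laws) (use power_gt1[of "2::real" j] in auto)
  have "(\<lambda>j. ennreal (2 ^ Suc j) * ennreal (1 - exp_minus (?T j))) \<longlonglongrightarrow> (\<integral>\<^sup>+x. kl_gap (p x) (q x) \<partial>m)"
    using nn_integral_kl_gap(1)[OF laws.p_meas laws.q_meas laws.p_nonneg laws.q_nonneg] by (simp only: gap)
  moreover have "(\<lambda>j. ennreal (2 ^ Suc j) * ennreal (1 - exp_minus (?T j))) \<longlonglongrightarrow> (\<integral>\<^sup>+t. kl_gap (f t) (g t) \<partial>lebesgue_Rplus)"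
    by (rule scaled_exp_minus_tendsto[OF nn_integral_kl_gap[OF fg]])
  ultimately have "(\<integral>\<^sup>+x. kl_gap (p x) (q x) \<partial>m) = (\<integral>\<^sup>+t. kl_gap (f t) (g t) \<partial>lebesgue_Rplus)"
    by (rule LIMSEQ_unique)
  moreover have "ereal_integral lebesgue_Rplus (\<lambda>t. x_log_ratio (f t) (g t) + ereal (g t - f t)) = enn2ereal (\<integral>\<^sup>+t. kl_gap (f t) (g t) \<partial>lebesgue_Rplus)"
    by (rule ereal_integral_enn2ereal)
      (simp add: kl_gap_def enn2ereal_e2ennreal x_log_ratio_nonneg fg(3,4))
  ultimately show ?thesis
    by (simp add: laws.ereal_integral_x_log_ratio prob_X.prob_space_axioms prob_Y.prob_space_axioms)
qed

text \<open>Both sides are limits of the affinities as the order decreases to 0. For the laws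
  \<open>p + q\<close> dominates. For the intensities either the Hellinger integrand dominates, or
  the gap integral is infinite at every order in \<open>[0,1)\<close>.\<close>

lemma affinity_0:
  assumes cond: "tsallis_half f g < \<infinity> \<or> emeasure (intensity_measure g) {t. 0 \<le> t \<and> f t = 0} = \<infinity>"
  shows "emeasure (law N Y) {x \<in> space m. p x > 0} = ennreal (exp_minus (\<integral>\<^sup>+t. young_gap 0 (f t) (g t) \<partial>lebesgue_Rplus))"
proof -
  define \<alpha> where "\<alpha> j = (1 / 2 ^ Suc j :: real)" for j
  have \<alpha>: "0 < \<alpha> j" "\<alpha> j \<le> 1 / 2" "\<alpha> j < 1" for j
    using power_gt1[of "2::real" j] by (auto simp: \<alpha>_def)
  have \<alpha>_lim: "\<alpha> \<longlonglongrightarrow> 0" unfolding \<alpha>_def by real_asymp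
  let ?T = "\<lambda>\<alpha>. \<integral>\<^sup>+t. young_gap \<alpha> (f t) (g t) \<partial>lebesgue_Rplus"
  have power_lim: "(\<lambda>j. x powr \<alpha> j * y powr (1 - \<alpha> j)) \<longlonglongrightarrow> x powr 0 * y powr (1 - 0)" if "0 \<le> x" "0 \<le> y" for x y
  proof (cases "x = 0 \<or> y = 0")
    case False
    then show ?thesis using that by (intro tendsto_intros \<alpha>_lim) auto
  qed auto
  have "(\<lambda>j. \<integral>\<^sup>+x. power_product (\<alpha> j) (p x) (q x) \<partial>m) \<longlonglongrightarrow> (\<integral>\<^sup>+x. power_product 0 (p x) (q x) \<partial>m)"
  proof (rule nn_integral_dominated_convergence[where w="\<lambda>x. ennreal (p x) + ennreal (q x)"])
    show "(\<integral>\<^sup>+x. ennreal (p x) + ennreal (q x) \<partial>m) < \<infinity>"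
      using prob_X.emeasure_space_1 prob_Y.emeasure_space_1 laws.nn_integral_p laws.nn_integral_q
      by (simp add: nn_integral_add)
    show "AE x in m. power_product (\<alpha> j) (p x) (q x) \<le> ennreal (p x) + ennreal (q x)" for j
    proof (rule AE_I2)
      fix x assume "x \<in> space m"
      then have nonneg: "0 \<le> p x" "0 \<le> q x" by (auto simp: laws.p_nonneg laws.q_nonneg)
      have "power_product (\<alpha> j) (p x) (q x) \<le> power_product (\<alpha> j) (p x) (q x) + young_gap (\<alpha> j) (p x) (q x)"
        by simp
      also have "\<dots> = ennreal (\<alpha> j * p x + (1 - \<alpha> j) * q x)"
        by (rule power_product_young_gap(1)) (use \<alpha>[of j] nonneg in auto)
      also have "\<dots> \<le> ennreal (p x + q x)"
        using \<alpha>[of j] nonneg by (intro ennreal_leI add_mono mult_left_le_one_le) auto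
      finally show "power_product (\<alpha> j) (p x) (q x) \<le> ennreal (p x) + ennreal (q x)"
        using nonneg by simp
    qed
    show "AE x in m. (\<lambda>j. power_product (\<alpha> j) (p x) (q x)) \<longlonglongrightarrow> power_product 0 (p x) (q x)"
    proof (rule AE_I2)
      fix x assume "x \<in> space m"
      then have nonneg: "0 \<le> p x" "0 \<le> q x" by (auto simp: laws.p_nonneg laws.q_nonneg)
      show "(\<lambda>j. power_product (\<alpha> j) (p x) (q x)) \<longlonglongrightarrow> power_product 0 (p x) (q x)"
      proof -
        have "power_product a (p x) (q x) = ennreal (p x powr a * q x powr (1 - a))" if "a < 1" for a
          using that by (simp add: power_product_def)
        then show ?thesis
          using tendsto_ennrealI[OF power_lim[OF nonneg]] \<alpha>(3) by (simp only: zero_less_one)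
      qed
    qed
  qed measurable
  also have "(\<integral>\<^sup>+x. power_product 0 (p x) (q x) \<partial>m) = (\<integral>\<^sup>+x. ennreal (q x) * indicator {x \<in> space m. p x > 0} x \<partial>m)"
  proof (rule nn_integral_cong)
    fix x assume "x \<in> space m"
    then show "power_product 0 (p x) (q x) = ennreal (q x) * indicator {x \<in> space m. p x > 0} x"
      using laws.p_nonneg[of x] laws.q_nonneg[of x] by (auto simp: power_product_def indicator_def)
  qed
  also have "\<dots> = emeasure (law N Y) {x \<in> space m. p x > 0}"
    unfolding laws.Q_eq by (rule emeasure_density[symmetric]) measurable
  finally have lim1: "(\<lambda>j. \<integral>\<^sup>+x. power_product (\<alpha> j) (p x) (q x) \<partial>m) \<longlonglongrightarrow> emeasure (law N Y) {x \<in> space m. p x > 0}" .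
  have aff: "(\<integral>\<^sup>+x. power_product (\<alpha> j) (p x) (q x) \<partial>m) = ennreal (exp_minus (?T (\<alpha> j)))" for j
    using affinity[of "\<alpha> j"] \<alpha>[of j] by (simp add: poisson_affinity_def)
  have "(\<lambda>j. ?T (\<alpha> j)) \<longlonglongrightarrow> ?T 0"
  proof (cases "tsallis_half f g < \<infinity>")
    case True
    show ?thesis
    proof (rule nn_integral_dominated_convergence[where w="\<lambda>t. ennreal ((sqrt (f t) - sqrt (g t))\<^sup>2)"])
      show "(\<integral>\<^sup>+t. ennreal ((sqrt (f t) - sqrt (g t))\<^sup>2) \<partial>lebesgue_Rplus) < \<infinity>"
        using True by (simp add: tsallis_half_def)
      show "AE t in lebesgue_Rplus. young_gap (\<alpha> j) (f t) (g t) \<le> ennreal ((sqrt (f t) - sqrt (g t))\<^sup>2)" for j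
        by (intro AE_I2 young_gap_le_hellinger) (use \<alpha>[of j] in \<open>auto simp: space_Rplus f_nonneg g_nonneg\<close>)
      show "AE t in lebesgue_Rplus. (\<lambda>j. young_gap (\<alpha> j) (f t) (g t)) \<longlonglongrightarrow> young_gap 0 (f t) (g t)"
      proof (rule AE_I2)
        fix t assume "t \<in> space lebesgue_Rplus"
        then have "0 \<le> f t" "0 \<le> g t" by (auto simp: space_Rplus f_nonneg g_nonneg)
        note power_lim = power_lim[OF this]
        have "(\<lambda>j. \<alpha> j * f t + (1 - \<alpha> j) * g t - f t powr \<alpha> j * g t powr (1 - \<alpha> j)) \<longlonglongrightarrow>
            0 * f t + (1 - 0) * g t - f t powr 0 * g t powr (1 - 0)"
          by (intro tendsto_diff[OF _ power_lim] tendsto_intros \<alpha>_lim)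
        note lim = tendsto_ennrealI[OF this]
        have "young_gap a (f t) (g t) = ennreal (a * f t + (1 - a) * g t - f t powr a * g t powr (1 - a))"
          if "a < 1" for a
          using that by (simp add: young_gap_def)
        then show "(\<lambda>j. young_gap (\<alpha> j) (f t) (g t)) \<longlonglongrightarrow> young_gap 0 (f t) (g t)"
          using lim \<alpha>(3) by (simp only: zero_less_one)
      qed
    qed measurable
  next
    case False
    let ?Z = "{t. 0 \<le> t \<and> f t = 0}"
    have Z: "?Z \<in> sets lebesgue_Rplus"
    proof -
      have "{t \<in> space lebesgue_Rplus. f t = 0} \<in> sets lebesgue_Rplus" by measurable
      then show ?thesis by (simp add: space_Rplus Collect_conj_eq)
    qed
    from False cond have inf: "(\<integral>\<^sup>+t. ennreal (g t) * indicator ?Z t \<partial>lebesgue_Rplus) = \<infinity>"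
      using Z by (simp add: intensity_measure_def emeasure_density)
    \<comment> \<open>On \<open>{f = 0}\<close> the gap of order \<open>a\<close> is
      \<open>(1 - a) * g\<close>.\<close>
    have T_inf: "?T a = \<infinity>" if a: "0 \<le> a" "a < 1" for a
    proof -
      have "ennreal (1 - a) * (\<integral>\<^sup>+t. ennreal (g t) * indicator ?Z t \<partial>lebesgue_Rplus) = (\<integral>\<^sup>+t. ennreal (1 - a) * (ennreal (g t) * indicator ?Z t) \<partial>lebesgue_Rplus)"
        using Z by (intro nn_integral_cmult[symmetric] borel_measurable_times_ennreal borel_measurable_indicator) auto
      also have "\<dots> \<le> ?T a"
        using a by (intro nn_integral_mono) (auto simp: young_gap_def indicator_def ennreal_mult'[symmetric])
      finally show ?thesis using a unfolding inf by (simp add: ennreal_mult_top top_unique)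
    qed
    have "?T (\<alpha> j) = ?T 0" for j
      using T_inf[of "\<alpha> j"] T_inf[of 0] \<alpha>[of j] by simp
    then show ?thesis by simp
  qed
  from tendsto_ennrealI[OF tendsto_exp_minus[OF this]] have lim2: "(\<lambda>j. \<integral>\<^sup>+x. power_product (\<alpha> j) (p x) (q x) \<partial>m) \<longlonglongrightarrow> ennreal (exp_minus (?T 0))"
    unfolding aff .
  show ?thesis by (rule LIMSEQ_unique[OF lim1 lim2])
qed

lemma renyi_laws:
  assumes \<alpha>: "0 \<le> \<alpha>" "\<alpha> \<noteq> 1"
    and cond: "\<alpha> = 0 \<longrightarrow> tsallis_half f g < \<infinity> \<or> emeasure (intensity_measure g) {t. 0 \<le> t \<and> f t = 0} = \<infinity>"
  shows "(if \<alpha> = 0 then - ext_log (emeasure (law N Y) {x \<in> space m. p x > 0})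
      else if \<alpha> = 1 then ereal_integral m (\<lambda>x. x_log_ratio (p x) (q x))
      else ereal (1 / (\<alpha> - 1)) * ext_log (\<integral>\<^sup>+x. power_product \<alpha> (p x) (q x) \<partial>m)) =
    ereal_integral lebesgue_Rplus (\<lambda>t. (ereal (\<alpha> * f t + (1 - \<alpha>) * g t) - enn2ereal (power_product \<alpha> (f t) (g t))) / ereal (1 - \<alpha>))"
proof -
  let ?T = "\<integral>\<^sup>+t. young_gap \<alpha> (f t) (g t) \<partial>lebesgue_Rplus"
  have "(if \<alpha> = 0 then - ext_log (emeasure (law N Y) {x \<in> space m. p x > 0})
      else if \<alpha> = 1 then ereal_integral m (\<lambda>x. x_log_ratio (p x) (q x))
      else ereal (1 / (\<alpha> - 1)) * ext_log (\<integral>\<^sup>+x. power_product \<alpha> (p x) (q x) \<partial>m))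
    = ereal (1 / (\<alpha> - 1)) * ext_log (poisson_affinity \<alpha> ?T)"
  proof (cases "\<alpha> = 0")
    case True
    then have "emeasure (law N Y) {x \<in> space m. p x > 0} = poisson_affinity \<alpha> ?T"
      using affinity_0 cond by (simp add: poisson_affinity_def)
    moreover have "- z = ereal (1 / (0 - 1)) * z" for z by (cases z) auto
    ultimately show ?thesis using True by (simp only: if_True simp_thms)
  qed (use affinity \<alpha> in simp)
  also have "\<dots> = enn2ereal (ennreal (1 / \<bar>1 - \<alpha>\<bar>) * ?T)"
    by (rule ext_log_poisson_affinity[OF \<alpha>(2)])
  also have "ennreal (1 / \<bar>1 - \<alpha>\<bar>) * ?T = (\<integral>\<^sup>+t. ennreal (1 / \<bar>1 - \<alpha>\<bar>) * young_gap \<alpha> (f t) (g t) \<partial>lebesgue_Rplus)"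
    by (rule nn_integral_cmult[symmetric]) measurable
  also have "enn2ereal \<dots> = ereal_integral lebesgue_Rplus (\<lambda>t. (ereal (\<alpha> * f t + (1 - \<alpha>) * g t) - enn2ereal (power_product \<alpha> (f t) (g t))) / ereal (1 - \<alpha>))"
    by (rule ereal_integral_enn2ereal[symmetric], rule renyi_integrand)
      (auto simp: \<alpha> space_Rplus f_nonneg g_nonneg)
  finally show ?thesis .
qed

end

theorem theorem6p1:
  fixes M :: "'u measure" and N :: "'v measure"
    and X :: "'u \<Rightarrow> real \<Rightarrow> nat" and Y :: "'v \<Rightarrow> real \<Rightarrow> nat"
    and f g :: "real \<Rightarrow> real"
  assumes "intensity_function f" and "intensity_function g"
    and "poisson_process M (intensity_measure f) X"
    and "poisson_process N (intensity_measure g) Y"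
  shows "KL (law M X) (law N Y) =
           ereal_integral lebesgue_Rplus (\<lambda>t. x_log_ratio (f t) (g t) + ereal (g t - f t))
       \<and> (\<forall>\<alpha>::real. 0 \<le> \<alpha> \<and> \<alpha> \<noteq> 1 \<and>
            (\<alpha> = 0 \<longrightarrow> tsallis_half f g < \<infinity> \<or>
                      emeasure (intensity_measure g) {t. 0 \<le> t \<and> f t = 0} = \<infinity>) \<longrightarrow>
            renyi_divergence \<alpha> (law M X) (law N Y) =
            ereal_integral lebesgue_Rplus
              (\<lambda>t. (ereal (\<alpha> * f t + (1 - \<alpha>) * g t) - enn2ereal (power_product \<alpha> (f t) (g t)))
                    / ereal (1 - \<alpha>)))
       \<and> hellinger_distance (law M X) (law N Y) = sqrt (1 - exp_minus (tsallis_half f g / 2))"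
proof (intro conjI allI impI)
  \<comment> \<open>This holds for every choice of densities, which gives the uniqueness half of
    each \<open>the_equality\<close>; \<open>ex\<close> gives the existence half.\<close>
  have pair: "poisson_pair f g M N X Y m p q" if "common_densities (law M X) (law N Y) m p q" for m p q
    using that assms poisson_process_intensity_finite[OF assms(3)] poisson_process_intensity_finite[OF assms(4)]
    by unfold_locales auto
  have "finite_measure (law M X)" "finite_measure (law N Y)" "sets (law N Y) = sets (law M X)"
    using prob_space_law[OF assms(3)] prob_space_law[OF assms(4)]
    by (simp_all add: prob_space.axioms(1) law_def)
  then obtain m p q where ex: "common_densities (law M X) (law N Y) m p q"
    using ex_common_densities by blast
  show "KL (law M X) (law N Y) =
      ereal_integral lebesgue_Rplus (\<lambda>t. x_log_ratio (f t) (g t) + ereal (g t - f t))"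
    unfolding KL_def
  proof (rule the_equality, goal_cases)
    case 1
    show ?case using ex poisson_pair.KL_laws[OF pair[OF ex]] by (intro exI conjI) (assumption, simp only:)
  next
    case (2 r)
    then show ?case using poisson_pair.KL_laws[OF pair] by (elim exE conjE) (simp only:)
  qed
  show "hellinger_distance (law M X) (law N Y) = sqrt (1 - exp_minus (tsallis_half f g / 2))"
    unfolding hellinger_distance_def
  proof (rule the_equality, goal_cases)
    case 1
    show ?case using ex poisson_pair.hellinger_laws[OF pair[OF ex]] by (intro exI conjI) (assumption, simp only:)
  next
    case (2 r)
    then show ?case using poisson_pair.hellinger_laws[OF pair] by (elim exE conjE) (simp only:)
  qed
  fix \<alpha> :: real
  assume "0 \<le> \<alpha> \<and> \<alpha> \<noteq> 1 \<and> (\<alpha> = 0 \<longrightarrow> tsallis_half f g < \<infinity> \<or>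
      emeasure (intensity_measure g) {t. 0 \<le> t \<and> f t = 0} = \<infinity>)"
  then have \<alpha>: "0 \<le> \<alpha>" "\<alpha> \<noteq> 1" "\<alpha> = 0 \<longrightarrow> tsallis_half f g < \<infinity> \<or>
      emeasure (intensity_measure g) {t. 0 \<le> t \<and> f t = 0} = \<infinity>" by auto
  note laws = poisson_pair.renyi_laws[OF pair \<alpha>]
  show "renyi_divergence \<alpha> (law M X) (law N Y) =
      ereal_integral lebesgue_Rplus
        (\<lambda>t. (ereal (\<alpha> * f t + (1 - \<alpha>) * g t) - enn2ereal (power_product \<alpha> (f t) (g t))) / ereal (1 - \<alpha>))"
    unfolding renyi_divergence_def
  proof (rule the_equality, goal_cases)
    case 1
    show ?case using ex laws[OF ex] by (intro exI conjI) (assumption, simp only:)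
  next
    case (2 r)
    then show ?case using laws by (elim exE conjE) (simp only:)
  qed
qed

end
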